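(* Let $\Phi$ be an isometric automorphism of the norm closed parabolic algebra $A_p$. Then there exist $t\in\mathbb{R}$ and characters $c,d$ of the discrete group of the real numbers such that $$\Phi(M_\lambda D_\mu)=c(\mu)\,d(\lambda)\,\mathrm{Ad}(V_t)(M_\lambda D_\mu)\qquad\text{for all }\lambda,\mu\in[0,\infty).$$ Moreover, for every $t\in\mathbb{R}$ and all characters $c,d$ of the discrete group of the real numbers, this formula gives a well-defined isometric automorphism of $A_p$.
   Context: On $L^2(\mathbb{R})$ define the unitary operators $(M_\lambda f)(x)=e^{i\lambda x}f(x)$, $(D_\mu f)(x)=f(x-\mu)$, $(V_tf)(x)=e^{t/2}f(e^tx)$ for $\lambda,\mu,t\in\mathbb{R}$. The norm closed parabolic algebra $A_p$ is the operator-norm closed (non-selfadjoint) subalgebra of $B(L^2(\mathbb{R}))$ generated by $\{M_\lambda,D_\mu:\lambda,\mu\ge 0\}$. For a unitary $U$, $\mathrm{Ad}(U)(T)=UTU^\ast$. A character of the discrete group of the real numbers is a (not necessarily continuous) group homomorphism $\mathbb{R}\to\mathbb{T}=\{z\in\mathbb{C}:|z|=1\}$. An isometric automorphism is a bijective algebra homomorphism of the algebra onto itself that is isometric for the operator norm. *)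

theory Defs
  imports "HOL-Analysis.Analysis"
begin

definition sq_integrable :: "(real \<Rightarrow> complex) \<Rightarrow> bool" where
  "sq_integrable f \<longleftrightarrow>
     f \<in> borel_measurable lborel \<and> integrable lborel (\<lambda>x. (cmod (f x))\<^sup>2)"

lemma sq_integrable_zero: "sq_integrable (\<lambda>_. 0)"
  by (simp add: sq_integrable_def)

lemma sq_integrable_mult_cnj:
  assumes "sq_integrable f" "sq_integrable g"
  shows "integrable lborel (\<lambda>x. f x * cnj (g x))"
proof (rule Bochner_Integration.integrable_bound)
  show "integrable lborel (\<lambda>x. (cmod (f x))\<^sup>2 + (cmod (g x))\<^sup>2)"
    using assms by (auto simp: sq_integrable_def)
  have m: "f \<in> borel_measurable borel" "g \<in> borel_measurable borel"
    using assms by (auto simp: sq_integrable_def)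
  have "(\<lambda>x. cnj (g x)) \<in> borel_measurable borel"
    using m(2) by (rule borel_measurable_continuous_on[OF continuous_on_cnj[OF continuous_on_id]])
  then show "(\<lambda>x. f x * cnj (g x)) \<in> borel_measurable lborel"
    using m by simp
  have "cmod (f x) * cmod (g x) \<le> (cmod (f x))\<^sup>2 + (cmod (g x))\<^sup>2" for x
  proof -
    have "2 * (cmod (f x) * cmod (g x)) \<le> (cmod (f x))\<^sup>2 + (cmod (g x))\<^sup>2"
      using sum_squares_bound[of "cmod (f x)" "cmod (g x)"] by simp
    moreover have "0 \<le> cmod (f x) * cmod (g x)" by simp
    ultimately show ?thesis by linarith
  qed
  then show "AE x in lborel. norm (f x * cnj (g x)) \<le> norm ((cmod (f x))\<^sup>2 + (cmod (g x))\<^sup>2)"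
    by (auto simp: norm_mult)
qed

lemma sq_integrable_add:
  assumes "sq_integrable f" "sq_integrable g"
  shows "sq_integrable (\<lambda>x. f x + g x)"
proof -
  have "(cmod (f x + g x))\<^sup>2 = (cmod (f x))\<^sup>2 + (cmod (g x))\<^sup>2 + 2 * Re (f x * cnj (g x))" for x
    unfolding cmod_power2 by (simp add: power2_eq_square algebra_simps)
  moreover have "integrable lborel (\<lambda>x. Re (f x * cnj (g x)))"
    using sq_integrable_mult_cnj[OF assms] by (rule integrable_Re)
  moreover have "integrable lborel (\<lambda>x. (cmod (f x))\<^sup>2 + (cmod (g x))\<^sup>2)"
    using assms by (auto simp: sq_integrable_def)
  ultimately have "integrable lborel (\<lambda>x. (cmod (f x + g x))\<^sup>2)"
    by (simp only: Bochner_Integration.integrable_add integrable_mult_right)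
  then show ?thesis
    using assms by (auto simp: sq_integrable_def)
qed

lemma sq_integrable_scale: "sq_integrable f \<Longrightarrow> sq_integrable (\<lambda>x. c * f x)"
  by (auto simp: sq_integrable_def norm_mult power_mult_distrib)

lemma sq_integrable_unimodular:
  assumes "sq_integrable f" "u \<in> borel_measurable borel" "\<And>x. cmod (u x) = 1"
  shows "sq_integrable (\<lambda>x. u x * f x)"
  using assms by (auto simp: sq_integrable_def norm_mult)

lemma sq_integrable_affine:
  assumes "sq_integrable f" "c \<noteq> 0"
  shows "sq_integrable (\<lambda>x. f (t + c * x))"
proof -
  have "f \<in> borel_measurable borel" "integrable lborel (\<lambda>x. (cmod (f x))\<^sup>2)"
    using assms by (auto simp: sq_integrable_def)
  with lborel_integrable_real_affine[OF this(2) assms(2), of t] show ?thesis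
    by (simp add: sq_integrable_def)
qed

lemma sq_integrable_shift: "sq_integrable f \<Longrightarrow> sq_integrable (\<lambda>x. f (x - m))"
  using sq_integrable_affine[of f 1 "- m"] by simp

lemma sq_integrable_dilate: "sq_integrable f \<Longrightarrow> sq_integrable (\<lambda>x. f (exp t * x))"
  using sq_integrable_affine[of f "exp t" 0] by simp

lemma AE_affine_eq:
  fixes f g :: "real \<Rightarrow> complex"
  assumes "sq_integrable f" "sq_integrable g" "AE x in lborel. f x = g x" "c \<noteq> 0"
  shows "AE x in lborel. f (t + c * x) = g (t + c * x)"
  using assms by (intro AE_borel_affine[where P = "\<lambda>x. f x = g x"])
    (auto simp: sq_integrable_def intro!: measurable_equality_set)

quotient_type l2r = "real \<Rightarrow> complex" / partial:
  "\<lambda>f g. sq_integrable f \<and> sq_integrable g \<and> (AE x in lborel. f x = g x)"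
proof (rule part_equivpI)
  show "\<exists>f. sq_integrable f \<and> sq_integrable f \<and> (AE x in lborel. f x = f x)"
    using sq_integrable_zero by auto
  show "symp (\<lambda>f g. sq_integrable f \<and> sq_integrable g \<and> (AE x in lborel. f x = g x))"
    by (auto simp: symp_def)
  show "transp (\<lambda>f g. sq_integrable f \<and> sq_integrable g \<and> (AE x in lborel. f x = g x))"
    unfolding transp_def by (auto elim: AE_mp)
qed

lift_definition scaleC :: "complex \<Rightarrow> l2r \<Rightarrow> l2r" is "\<lambda>c f x. c * f x"
  by (auto simp: sq_integrable_scale)

text \<open>Linear in the first argument.\<close>

lift_definition cinner :: "l2r \<Rightarrow> l2r \<Rightarrow> complex" is
  "\<lambda>f g. LINT x|lborel. f x * cnj (g x)"
proof -
  fix f f' g g' :: "real \<Rightarrow> complex"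
  assume f: "sq_integrable f \<and> sq_integrable f' \<and> (AE x in lborel. f x = f' x)"
    and g: "sq_integrable g \<and> sq_integrable g' \<and> (AE x in lborel. g x = g' x)"
  from f g have "AE x in lborel. f x * cnj (g x) = f' x * cnj (g' x)" by auto
  with f g show "(LINT x|lborel. f x * cnj (g x)) = (LINT x|lborel. f' x * cnj (g' x))"
    by (intro integral_cong_AE) (auto dest: sq_integrable_mult_cnj)
qed

instantiation l2r :: real_vector
begin

lift_definition zero_l2r :: l2r is "\<lambda>_. 0" by (simp add: sq_integrable_zero)
lift_definition plus_l2r :: "l2r \<Rightarrow> l2r \<Rightarrow> l2r" is "\<lambda>f g x. f x + g x"
  by (auto simp: sq_integrable_add)
definition uminus_l2r :: "l2r \<Rightarrow> l2r" where "uminus_l2r f = scaleC (-1) f"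
definition minus_l2r :: "l2r \<Rightarrow> l2r \<Rightarrow> l2r" where "minus_l2r f g = f + scaleC (-1) g"
definition scaleR_l2r :: "real \<Rightarrow> l2r \<Rightarrow> l2r" where "scaleR_l2r r f = scaleC (of_real r) f"

instance
proof
  fix f g h :: l2r and a b :: real
  show "f + g + h = f + (g + h)"
    by transfer (auto simp: add.assoc sq_integrable_add)
  show "f + g = g + f"
    by transfer (auto simp: add.commute sq_integrable_add)
  show "0 + f = f"
    by transfer auto
  show "- f + f = 0"
    unfolding uminus_l2r_def by transfer (auto simp: sq_integrable_zero)
  show "f - g = f + - g"
    by (simp add: minus_l2r_def uminus_l2r_def)
  show "a *\<^sub>R (f + g) = a *\<^sub>R f + a *\<^sub>R g"
    unfolding scaleR_l2r_def
    by transfer (simp add: distrib_left sq_integrable_add sq_integrable_scale)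
  show "(a + b) *\<^sub>R f = a *\<^sub>R f + b *\<^sub>R f"
    unfolding scaleR_l2r_def
    by transfer (simp add: distrib_right sq_integrable_add sq_integrable_scale)
  show "a *\<^sub>R b *\<^sub>R f = (a * b) *\<^sub>R f"
    unfolding scaleR_l2r_def
    by transfer (auto simp: mult.assoc sq_integrable_scale)
  show "1 *\<^sub>R f = f"
    unfolding scaleR_l2r_def by transfer auto
qed

end

lemma scaleC_add_right: "scaleC c (f + g) = scaleC c f + scaleC c g"
  by transfer (auto simp: distrib_left sq_integrable_add sq_integrable_scale)

lemma scaleC_scaleC: "scaleC a (scaleC b f) = scaleC (a * b) f"
  by transfer (auto simp: mult.assoc sq_integrable_scale)

lemma scaleC_scaleR: "scaleC c (r *\<^sub>R f) = r *\<^sub>R scaleC c f"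
  by (simp add: scaleR_l2r_def scaleC_scaleC mult.commute)

lemma cinner_add_left: "cinner (f + g) h = cinner f h + cinner g h"
proof transfer
  fix f g h :: "real \<Rightarrow> complex"
  assume "sq_integrable f \<and> sq_integrable f \<and> (AE x in lborel. f x = f x)"
    "sq_integrable g \<and> sq_integrable g \<and> (AE x in lborel. g x = g x)"
    "sq_integrable h \<and> sq_integrable h \<and> (AE x in lborel. h x = h x)"
  then show "(LINT x|lborel. (f x + g x) * cnj (h x)) =
      (LINT x|lborel. f x * cnj (h x)) + (LINT x|lborel. g x * cnj (h x))"
    by (simp add: distrib_right sq_integrable_mult_cnj)
qed

lemma cinner_scaleC_left: "cinner (scaleC c f) g = c * cinner f g"
  by transfer (simp add: mult.assoc)

lemma cinner_commute: "cinner f g = cnj (cinner g f)"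
  by transfer (subst Bochner_Integration.integral_cnj[symmetric], simp add: mult.commute)

lemma cinner_self: "cinner f f = of_real (Re (cinner f f))" "0 \<le> Re (cinner f f)"
  "Re (cinner f f) = 0 \<longleftrightarrow> f = 0"
proof -
  have eq: "(LINT x|lborel. f x * cnj (f x)) = of_real (LINT x|lborel. (cmod (f x))\<^sup>2)"
    for f :: "real \<Rightarrow> complex"
    unfolding complex_norm_square[symmetric] by (simp only: integral_complex_of_real of_real_power[symmetric])
  show "cinner f f = of_real (Re (cinner f f))"
    by transfer (simp add: eq)
  show "0 \<le> Re (cinner f f)"
    by transfer (simp add: eq)
  show "Re (cinner f f) = 0 \<longleftrightarrow> f = 0"
  proof transfer
    fix f :: "real \<Rightarrow> complex"
    assume "sq_integrable f \<and> sq_integrable f \<and> (AE x in lborel. f x = f x)"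
    then have "sq_integrable f" by simp
    then show "(Re (LINT x|lborel. f x * cnj (f x)) = 0) =
        (sq_integrable f \<and> sq_integrable (\<lambda>_. 0) \<and> (AE x in lborel. f x = 0))"
      by (simp add: eq sq_integrable_zero)
         (subst integral_nonneg_eq_0_iff_AE, auto simp: sq_integrable_def)
  qed
qed

text \<open>The underlying real inner product space; the norm is the usual $L^2$ norm.\<close>

instantiation l2r :: real_inner
begin

definition inner_l2r :: "l2r \<Rightarrow> l2r \<Rightarrow> real" where "inner_l2r f g = Re (cinner f g)"
definition norm_l2r :: "l2r \<Rightarrow> real" where "norm_l2r f = sqrt (f \<bullet> f)"
definition sgn_l2r :: "l2r \<Rightarrow> l2r" where "sgn_l2r f = f /\<^sub>R norm f"
definition dist_l2r :: "l2r \<Rightarrow> l2r \<Rightarrow> real" where "dist_l2r f g = norm (f - g)"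
definition uniformity_l2r :: "(l2r \<times> l2r) filter" where
  "uniformity_l2r = (INF e\<in>{0<..}. principal {(x, y). dist x y < e})"
definition open_l2r :: "l2r set \<Rightarrow> bool" where
  "open_l2r U \<longleftrightarrow> (\<forall>x\<in>U. \<forall>\<^sub>F (x', y) in uniformity. x' = x \<longrightarrow> y \<in> U)"

instance
proof
  fix f g h :: l2r and r :: real
  show "f \<bullet> g = g \<bullet> f"
    unfolding inner_l2r_def by (subst cinner_commute) simp
  show "(f + g) \<bullet> h = f \<bullet> h + g \<bullet> h"
    by (simp add: inner_l2r_def cinner_add_left)
  show "(r *\<^sub>R f) \<bullet> g = r * (f \<bullet> g)"
    by (simp add: inner_l2r_def scaleR_l2r_def cinner_scaleC_left)
  show "0 \<le> f \<bullet> f" "(f \<bullet> f = 0) = (f = 0)"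
    by (simp_all add: inner_l2r_def cinner_self(2,3))
qed (simp_all add: norm_l2r_def sgn_l2r_def dist_l2r_def uniformity_l2r_def open_l2r_def)

end

lemma norm_scaleC: "norm (scaleC c f) = cmod c * norm f"
proof -
  have "cinner (scaleC c f) (scaleC c f) = c * (cnj c * cinner f f)"
    by (metis cinner_commute cinner_scaleC_left complex_cnj_mult)
  also have "\<dots> = of_real ((cmod c)\<^sup>2) * cinner f f"
    by (simp add: complex_norm_square[symmetric] mult.assoc[symmetric] del: of_real_power)
  finally show ?thesis
    by (simp add: norm_l2r_def inner_l2r_def real_sqrt_mult)
qed

lemma norm_eqI: "cinner f f = cinner g g \<Longrightarrow> norm f = norm g"
  by (simp add: norm_l2r_def inner_l2r_def)

text \<open>The type \<^typ>\<open>l2r \<Rightarrow>\<^sub>L l2r\<close> consists of the bounded real-linear operators, so the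
  algebra of bounded (complex-linear) operators is a subset of it.  The norm of
  \<^typ>\<open>l2r \<Rightarrow>\<^sub>L l2r\<close> restricts to the usual operator norm.\<close>

definition B_L2 :: "(l2r \<Rightarrow>\<^sub>L l2r) set" where
  "B_L2 = {T :: l2r \<Rightarrow>\<^sub>L l2r. \<forall>c f. T (scaleC c f) = scaleC c (T f)}"

lemma bounded_linear_scaleC: "bounded_linear (scaleC c)"
  by (rule bounded_linear_intro[where K = "cmod c"])
    (simp_all add: scaleC_add_right scaleC_scaleR norm_scaleC mult.commute)

definition scaleC_op :: "complex \<Rightarrow> (l2r \<Rightarrow>\<^sub>L l2r) \<Rightarrow> (l2r \<Rightarrow>\<^sub>L l2r)" where
  "scaleC_op c T = Blinfun (\<lambda>f. scaleC c (T f))"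

lemma scaleC_op_apply [simp]: "blinfun_apply (scaleC_op c T) f = scaleC c (T f)"
  unfolding scaleC_op_def
  by (simp add: bounded_linear_Blinfun_apply
      bounded_linear_compose[OF bounded_linear_scaleC blinfun.bounded_linear_right])

lift_definition M_fun :: "real \<Rightarrow> l2r \<Rightarrow> l2r" is "\<lambda>l f x. exp (\<i> * of_real (l * x)) * f x"
  by (auto intro!: sq_integrable_unimodular simp del: of_real_mult)

lift_definition D_fun :: "real \<Rightarrow> l2r \<Rightarrow> l2r" is "\<lambda>m f x. f (x - m)"
proof -
  fix m and f g :: "real \<Rightarrow> complex"
  assume "sq_integrable f \<and> sq_integrable g \<and> (AE x in lborel. f x = g x)"
  then show "sq_integrable (\<lambda>x. f (x - m)) \<and> sq_integrable (\<lambda>x. g (x - m)) \<and>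
      (AE x in lborel. f (x - m) = g (x - m))"
    using AE_affine_eq[of f g 1 "- m"] by (simp add: sq_integrable_shift)
qed

lift_definition V_fun :: "real \<Rightarrow> l2r \<Rightarrow> l2r" is
  "\<lambda>t f x. of_real (exp (t / 2)) * f (exp t * x)"
proof -
  fix t and f g :: "real \<Rightarrow> complex"
  assume "sq_integrable f \<and> sq_integrable g \<and> (AE x in lborel. f x = g x)"
  then show "sq_integrable (\<lambda>x. of_real (exp (t / 2)) * f (exp t * x)) \<and>
      sq_integrable (\<lambda>x. of_real (exp (t / 2)) * g (exp t * x)) \<and>
      (AE x in lborel. of_real (exp (t / 2)) * f (exp t * x) = of_real (exp (t / 2)) * g (exp t * x))"
    using sq_integrable_affine[of f "exp t" 0] sq_integrable_affine[of g "exp t" 0]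
      AE_affine_eq[of f g "exp t" 0] by (auto intro!: sq_integrable_scale)
qed

lemma cinner_M_fun: "cinner (M_fun l f) (M_fun l g) = cinner f g"
proof transfer
  fix l and f g :: "real \<Rightarrow> complex"
  have "exp (\<i> * of_real (l * x)) * f x * cnj (exp (\<i> * of_real (l * x)) * g x) = f x * cnj (g x)" for x
  proof -
    have "exp (\<i> * of_real (l * x)) * cnj (exp (\<i> * of_real (l * x))) = 1"
      by (simp flip: complex_norm_square del: of_real_mult)
    then show ?thesis
      by (simp only: complex_cnj_mult) (metis (no_types, lifting) mult.assoc mult.commute mult_1)
  qed
  then show "(LINT x|lborel. exp (\<i> * of_real (l * x)) * f x * cnj (exp (\<i> * of_real (l * x)) * g x)) =
      (LINT x|lborel. f x * cnj (g x))" by (simp only:)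
qed

lemma cinner_D_fun: "cinner (D_fun m f) (D_fun m g) = cinner f g"
proof transfer
  fix m and f g :: "real \<Rightarrow> complex"
  show "(LINT x|lborel. f (x - m) * cnj (g (x - m))) = (LINT x|lborel. f x * cnj (g x))"
    using lborel_integral_real_affine[of 1 "\<lambda>x. f x * cnj (g x)" "- m"] by simp
qed

lemma cinner_V_fun: "cinner (V_fun t f) (V_fun t g) = cinner f g"
proof transfer
  fix t and f g :: "real \<Rightarrow> complex"
  have e: "of_real (exp (t / 2)) * a * cnj (of_real (exp (t / 2)) * b) = exp t *\<^sub>R (a * cnj b)" for a b
  proof -
    have "exp t = exp (t / 2) * exp (t / 2)" by (simp flip: exp_add)
    then show ?thesis by (simp add: scaleR_conv_of_real)
  qed
  show "(LINT x|lborel. of_real (exp (t / 2)) * f (exp t * x) *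
      cnj (of_real (exp (t / 2)) * g (exp t * x))) = (LINT x|lborel. f x * cnj (g x))"
    unfolding e
    using lborel_integral_real_affine[of "exp t" "\<lambda>x. f x * cnj (g x)" 0] by simp
qed

lemma M_fun_scaleC: "M_fun l (scaleC c f) = scaleC c (M_fun l f)"
proof transfer
  fix l c and f :: "real \<Rightarrow> complex"
  assume "sq_integrable f \<and> sq_integrable f \<and> (AE x in lborel. f x = f x)"
  then have "sq_integrable (\<lambda>x. c * (exp (\<i> * of_real (l * x)) * f x))"
    by (intro sq_integrable_scale sq_integrable_unimodular) (simp_all del: of_real_mult)
  then show "sq_integrable (\<lambda>x. exp (\<i> * of_real (l * x)) * (c * f x)) \<and>
      sq_integrable (\<lambda>x. c * (exp (\<i> * of_real (l * x)) * f x)) \<and>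
      (AE x in lborel. exp (\<i> * of_real (l * x)) * (c * f x) = c * (exp (\<i> * of_real (l * x)) * f x))"
    by (simp add: mult.left_commute[of c] del: of_real_mult)
qed

lemma D_fun_scaleC: "D_fun m (scaleC c f) = scaleC c (D_fun m f)"
  by transfer (simp add: sq_integrable_scale sq_integrable_shift)

lemma V_fun_scaleC: "V_fun t (scaleC c f) = scaleC c (V_fun t f)"
proof transfer
  fix t c and f :: "real \<Rightarrow> complex"
  assume "sq_integrable f \<and> sq_integrable f \<and> (AE x in lborel. f x = f x)"
  then have "sq_integrable (\<lambda>x. c * (of_real (exp (t / 2)) * f (exp t * x)))"
    by (auto intro!: sq_integrable_scale[OF sq_integrable_scale[OF sq_integrable_dilate[of f t]]])
  then show "sq_integrable (\<lambda>x. of_real (exp (t / 2)) * (c * f (exp t * x))) \<and>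
      sq_integrable (\<lambda>x. c * (of_real (exp (t / 2)) * f (exp t * x))) \<and>
      (AE x in lborel. of_real (exp (t / 2)) * (c * f (exp t * x)) =
         c * (of_real (exp (t / 2)) * f (exp t * x)))"
    by (simp add: mult.left_commute[of c])
qed

lemma bounded_linear_M_fun: "bounded_linear (M_fun a)"
proof (rule bounded_linear_intro[where K = 1])
  show "M_fun l (f + g) = M_fun l f + M_fun l g" for l f g
    by transfer (auto simp: distrib_left simp del: of_real_mult
        intro!: sq_integrable_unimodular sq_integrable_add)
  show "M_fun l (r *\<^sub>R f) = r *\<^sub>R M_fun l f" for l r f
    by (simp add: scaleR_l2r_def M_fun_scaleC)
  show "norm (M_fun l f) \<le> norm f * 1" for l f
    by (simp add: norm_eqI[OF cinner_M_fun])
qed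

lemma bounded_linear_D_fun: "bounded_linear (D_fun a)"
proof (rule bounded_linear_intro[where K = 1])
  show "D_fun m (f + g) = D_fun m f + D_fun m g" for m f g
    by transfer (simp add: sq_integrable_add sq_integrable_shift)
  show "D_fun m (r *\<^sub>R f) = r *\<^sub>R D_fun m f" for m r f
    by (simp add: scaleR_l2r_def D_fun_scaleC)
  show "norm (D_fun m f) \<le> norm f * 1" for m f
    by (simp add: norm_eqI[OF cinner_D_fun])
qed

lemma bounded_linear_V_fun: "bounded_linear (V_fun a)"
proof (rule bounded_linear_intro[where K = 1])
  show "V_fun t (f + g) = V_fun t f + V_fun t g" for t f g
  proof transfer
    fix t and f g :: "real \<Rightarrow> complex"
    assume "sq_integrable f \<and> sq_integrable f \<and> (AE x in lborel. f x = f x)"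
      "sq_integrable g \<and> sq_integrable g \<and> (AE x in lborel. g x = g x)"
    then have "sq_integrable (\<lambda>x. of_real (exp (t / 2)) * f (exp t * x) + of_real (exp (t / 2)) * g (exp t * x))"
      by (auto intro!: sq_integrable_add[OF sq_integrable_scale[OF sq_integrable_dilate[of f t]]
            sq_integrable_scale[OF sq_integrable_dilate[of g t]]])
    then show "sq_integrable (\<lambda>x. of_real (exp (t / 2)) * (f (exp t * x) + g (exp t * x))) \<and>
        sq_integrable (\<lambda>x. of_real (exp (t / 2)) * f (exp t * x) + of_real (exp (t / 2)) * g (exp t * x)) \<and>
        (AE x in lborel. of_real (exp (t / 2)) * (f (exp t * x) + g (exp t * x)) =
           of_real (exp (t / 2)) * f (exp t * x) + of_real (exp (t / 2)) * g (exp t * x))"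
      by (simp add: distrib_left)
  qed
  show "V_fun t (r *\<^sub>R f) = r *\<^sub>R V_fun t f" for t r f
    by (simp add: scaleR_l2r_def V_fun_scaleC)
  show "norm (V_fun t f) \<le> norm f * 1" for t f
    by (simp add: norm_eqI[OF cinner_V_fun])
qed

definition M_op :: "real \<Rightarrow> (l2r \<Rightarrow>\<^sub>L l2r)" where "M_op a = Blinfun (M_fun a)"
definition D_op :: "real \<Rightarrow> (l2r \<Rightarrow>\<^sub>L l2r)" where "D_op a = Blinfun (D_fun a)"
definition V_op :: "real \<Rightarrow> (l2r \<Rightarrow>\<^sub>L l2r)" where "V_op a = Blinfun (V_fun a)"

lemma
  M_op_apply [simp]: "blinfun_apply (M_op a) = M_fun a" and
  D_op_apply [simp]: "blinfun_apply (D_op a) = D_fun a" and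
  V_op_apply [simp]: "blinfun_apply (V_op a) = V_fun a"
  by (simp_all add: M_op_def D_op_def V_op_def bounded_linear_Blinfun_apply
      bounded_linear_M_fun bounded_linear_D_fun bounded_linear_V_fun)

definition adj :: "(l2r \<Rightarrow>\<^sub>L l2r) \<Rightarrow> (l2r \<Rightarrow>\<^sub>L l2r)" where
  "adj T = (THE S :: l2r \<Rightarrow>\<^sub>L l2r. \<forall>f g. cinner (T f) g = cinner f (S g))"

definition Ad :: "(l2r \<Rightarrow>\<^sub>L l2r) \<Rightarrow> (l2r \<Rightarrow>\<^sub>L l2r) \<Rightarrow> (l2r \<Rightarrow>\<^sub>L l2r)" where
  "Ad U T = U o\<^sub>L T o\<^sub>L adj U"

lemma adj_eqI:
  fixes S T :: "l2r \<Rightarrow>\<^sub>L l2r"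
  assumes "\<And>f g. cinner (T f) g = cinner f (S g)"
  shows "adj T = S"
  unfolding adj_def
proof (rule the_equality)
  show "\<forall>f g. cinner (T f) g = cinner f (S g)" using assms by blast
next
  fix S' :: "l2r \<Rightarrow>\<^sub>L l2r"
  assume "\<forall>f g. cinner (T f) g = cinner f (S' g)"
  then have "cinner f (S' g) = cinner f (S g)" for f g using assms by metis
  then have "f \<bullet> S' g = f \<bullet> S g" for f g by (simp add: inner_l2r_def)
  then have "S' g = S g" for g by (metis vector_eq_ldot)
  then show "S' = S" by (rule blinfun_eqI)
qed

lemma V_fun_V_fun: "V_fun s (V_fun t f) = V_fun (s + t) f"
proof transfer
  fix s t and f :: "real \<Rightarrow> complex"
  assume f: "sq_integrable f \<and> sq_integrable f \<and> (AE x in lborel. f x = f x)"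
  have "(\<lambda>x. complex_of_real (exp (s / 2)) * (of_real (exp (t / 2)) * f (exp t * (exp s * x)))) =
      (\<lambda>x. of_real (exp ((s + t) / 2)) * f (exp (s + t) * x))"
    by (auto simp: exp_add add_divide_distrib mult_ac)
  moreover have "sq_integrable (\<lambda>x. of_real (exp ((s + t) / 2)) * f (exp (s + t) * x))"
    using f by (auto intro!: sq_integrable_scale[OF sq_integrable_dilate[of f "s + t"]])
  ultimately show "sq_integrable (\<lambda>x. complex_of_real (exp (s / 2)) * (of_real (exp (t / 2)) * f (exp t * (exp s * x)))) \<and>
      sq_integrable (\<lambda>x. of_real (exp ((s + t) / 2)) * f (exp (s + t) * x)) \<and>
      (AE x in lborel. complex_of_real (exp (s / 2)) * (of_real (exp (t / 2)) * f (exp t * (exp s * x))) =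
        of_real (exp ((s + t) / 2)) * f (exp (s + t) * x))"
    by (simp add: fun_eq_iff)
qed

lemma V_fun_0: "V_fun 0 f = f"
  by transfer auto

lemma adj_V_op: "adj (V_op t) = V_op (- t)"
proof (rule adj_eqI)
  fix f g
  show "cinner (V_op t f) g = cinner f (V_op (- t) g)"
    using cinner_V_fun[of t f "V_fun (- t) g"]
    by (simp add: V_fun_V_fun V_fun_0)
qed

definition closed_subalgebra :: "(l2r \<Rightarrow>\<^sub>L l2r) set \<Rightarrow> bool" where
  "closed_subalgebra A \<longleftrightarrow> A \<subseteq> B_L2 \<and> closed A \<and> 0 \<in> A \<and>
     (\<forall>S\<in>A. \<forall>T\<in>A. S + T \<in> A) \<and> (\<forall>c. \<forall>T\<in>A. scaleC_op c T \<in> A) \<and>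
     (\<forall>S\<in>A. \<forall>T\<in>A. S o\<^sub>L T \<in> A)"

definition A_p :: "(l2r \<Rightarrow>\<^sub>L l2r) set" where
  "A_p = closed_subalgebra hull ({M_op l |l. 0 \<le> l} \<union> {D_op m |m. 0 \<le> m})"

text \<open>The hull is an intersection, which has the intended meaning because the family it ranges
  over contains \<^const>\<open>B_L2\<close>.\<close>

lemma closed_subalgebra_B_L2: "closed_subalgebra B_L2"
proof -
  have "B_L2 = (\<Inter>c. \<Inter>f. {T :: l2r \<Rightarrow>\<^sub>L l2r. T (scaleC c f) = scaleC c (T f)})"
    by (auto simp: B_L2_def)
  moreover have "closed {T :: l2r \<Rightarrow>\<^sub>L l2r. T (scaleC c f) = scaleC c (T f)}" for c f
    by (intro closed_Collect_eq bounded_linear.continuous_on[OF bounded_linear_scaleC] continuous_intros)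
  ultimately have "closed B_L2" by (metis (no_types, lifting) closed_INT)
  then show ?thesis
    by (auto simp: closed_subalgebra_def B_L2_def blinfun.add_left scaleC_add_right
        scaleC_scaleC mult.commute linear_0[OF bounded_linear.linear[OF bounded_linear_scaleC]])
qed

lemma M_op_B_L2: "M_op l \<in> B_L2" and D_op_B_L2: "D_op m \<in> B_L2" and V_op_B_L2: "V_op t \<in> B_L2"
  by (simp_all add: B_L2_def M_fun_scaleC D_fun_scaleC V_fun_scaleC)

lemma closed_subalgebra_Inter:
  assumes "\<And>A. A \<in> F \<Longrightarrow> closed_subalgebra A" "F \<noteq> {}"
  shows "closed_subalgebra (\<Inter>F)"
  using assms unfolding closed_subalgebra_def
  by (intro conjI) (blast, auto intro!: closed_Inter)

lemma closed_subalgebra_A_p: "closed_subalgebra A_p"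
  unfolding A_p_def hull_def using closed_subalgebra_B_L2 M_op_B_L2 D_op_B_L2
  by (intro closed_subalgebra_Inter) auto

lemma M_op_A_p: "0 \<le> l \<Longrightarrow> M_op l \<in> A_p" and D_op_A_p: "0 \<le> m \<Longrightarrow> D_op m \<in> A_p"
  unfolding A_p_def by (auto intro!: hull_inc)

text \<open>Only the values of \<open>\<Phi>\<close> on \<open>A\<close> matter.\<close>

definition isometric_automorphism ::
  "(l2r \<Rightarrow>\<^sub>L l2r) set \<Rightarrow> ((l2r \<Rightarrow>\<^sub>L l2r) \<Rightarrow> (l2r \<Rightarrow>\<^sub>L l2r)) \<Rightarrow> bool" where
  "isometric_automorphism A \<Phi> \<longleftrightarrow> bij_betw \<Phi> A A \<and>
     (\<forall>S\<in>A. \<forall>T\<in>A. \<Phi> (S + T) = \<Phi> S + \<Phi> T) \<and>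
     (\<forall>c. \<forall>T\<in>A. \<Phi> (scaleC_op c T) = scaleC_op c (\<Phi> T)) \<and>
     (\<forall>S\<in>A. \<forall>T\<in>A. \<Phi> (S o\<^sub>L T) = \<Phi> S o\<^sub>L \<Phi> T) \<and>
     (\<forall>T\<in>A. norm (\<Phi> T) = norm T)"

definition real_character :: "(real \<Rightarrow> complex) \<Rightarrow> bool" where
  "real_character c \<longleftrightarrow> (\<forall>x. cmod (c x) = 1) \<and> (\<forall>x y. c (x + y) = c x * c y)"

end

theory Submission
  imports Defs "HOL-Complex_Analysis.Conformal_Mappings" "HOL-Real_Asymp.Real_Asymp"
    "HOL-Analysis.Kronecker_Approximation_Theorem"
begin

text \<open>
  The relation \<open>D\<^sub>\<mu> M\<^sub>\<lambda> = e\<^bsup>-i\<lambda>\<mu>\<^esup> M\<^sub>\<lambda> D\<^sub>\<mu>\<close> makes \<^const>\<open>A_p\<close> the closed linear span of the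
  monomials \<open>M\<^sub>\<lambda> D\<^sub>\<mu>\<close> with \<open>\<lambda>, \<mu> \<ge> 0\<close>, and both halves of the theorem are about what an automorphism does
  to these monomials.

  \<^bold>\<open>Existence.\<close>  For continuous characters, multiplying \<open>M\<^sub>\<lambda> D\<^sub>\<mu>\<close> by \<open>c(\<mu>) d(\<lambda>)\<close> is conjugation by
  some unitary \<open>M\<^sub>s D\<^sub>r\<close>.  Kronecker's theorem approximates an arbitrary character by continuous ones on
  each finite set of frequencies (\<open>character_approximation\<close>), so there is a filter of pairs \<open>(r, s)\<close>
  along which the conjugations converge on every monomial, hence in norm on the whole algebra.  A limit of
  conjugations is isometric and multiplicative; composing with the conjugation by \<open>V\<^sub>t\<close> gives the
  automorphism (\<open>gauge_dilation_aut\<close>).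

  \<^bold>\<open>Rigidity.\<close>  Averaging \<open>e\<^bsup>-i\<nu>s\<^esup> M\<^sub>s T M\<^sub>-\<^sub>s\<close> over \<open>s\<close> extracts the part of \<open>T\<close> that is a multiple
  of \<open>D\<^sub>\<nu>\<close>.  These modes determine \<open>T\<close> because the mean is faithful on positive operators
  (\<open>mode_faithful\<close>, \<open>mode_injective\<close>).  The mode at frequency \<open>0\<close> is a contractive homomorphism \<open>\<pi>\<close> of the
  algebra onto the closed span \<open>H\<close> of the \<open>M\<^sub>\<lambda>\<close>, with kernel the ideal \<open>K\<close> generated by the \<open>D\<^sub>\<mu>\<close>,
  \<open>\<mu> > 0\<close>.  The elements of \<open>H\<close> are analytic almost periodic functions; they extend to the upper half
  plane, so \<open>H\<close> is an integral domain (\<open>H_domain\<close>).  All this holds equally with the two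
  families interchanged, up to a sign in the relation, and is therefore developed for an abstract pair
  \<open>P, Q\<close>.

  Let \<open>\<Phi>\<close> be an isometric automorphism.  In the commutative domain \<open>H\<close> the elements \<open>\<pi> (\<Phi> M\<^sub>\<lambda>)\<close> and
  \<open>\<pi> (\<Phi> D\<^sub>\<mu>)\<close> commute and also commute up to the factor \<open>e\<^bsup>-i\<lambda>\<mu>\<^esup>\<close>, so one of the two families
  vanishes (\<open>kills_dichotomy\<close>).  Consequently \<open>\<Phi>\<close> either preserves the two ideals, the one generated by the
  translations and the one generated by the modulations, or interchanges them.  If an ideal with quotient \<open>H\<close>
  is mapped to one with the same kind of quotient, then \<open>\<Phi>\<close> induces an isometry between the quotients,
  and \<open>f = \<pi> (\<Phi> M\<^sub>\<lambda>)\<close> multiplies isometrically; this forces \<open>f\<close> to be unitary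
  (\<open>isometric_multiplier_unitary\<close>), and a contraction whose mean is unitary equals its mean
  (\<open>contraction_eq_expectation\<close>), so \<open>\<Phi> M\<^sub>\<lambda> = f\<close>.  Comparing the modes of both sides of
  \<open>\<Phi>(D\<^sub>\<mu>) f = e\<^bsup>-i\<lambda>\<mu>\<^esup> f \<Phi>(D\<^sub>\<mu>)\<close> shows that if \<open>f\<close> had two frequencies \<open>s \<noteq> s'\<close>, all of the algebra
  would commute with \<open>M\<^sub>s\<^sub>-\<^sub>s\<^sub>'\<close> (\<open>frequency_unique\<close>).  Hence \<open>\<Phi> M\<^sub>\<lambda>\<close> is a multiple of some
  \<open>M\<^sub>\<kappa>\<^sub>\<lambda>\<close>, similarly for \<open>D\<^sub>\<mu>\<close>, and the Weyl relation leaves only reciprocal scalings \<open>e\<^sup>t\<close>, \<open>e\<^sup>-\<^sup>t\<close>.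
  It also excludes the interchanged case, where the product of two nonnegative scalings would have to
  be \<open>-1\<close>.
\<close>

section \<open>Completeness of the space of square integrable functions\<close>

lemma sq_integrable_rep: "sq_integrable (rep_l2r u)"
  using Quotient_rep_reflp[OF Quotient_l2r] by blast

lemma abs_rep_l2r: "abs_l2r (rep_l2r u) = u"
  by (rule Quotient_abs_rep[OF Quotient_l2r])

lemma norm_abs_l2r:
  assumes "sq_integrable f"
  shows "(norm (abs_l2r f))\<^sup>2 = (LINT x|lborel. (cmod (f x))\<^sup>2)"
proof -
  have "cinner (abs_l2r f) (abs_l2r f) = of_real (LINT x|lborel. (cmod (f x))\<^sup>2)"
    using assms unfolding integral_complex_of_real[symmetric]
    by (simp add: cinner.abs_eq complex_norm_square[symmetric])
  moreover have "0 \<le> (LINT x|lborel. (cmod (f x))\<^sup>2)" by simp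
  ultimately show ?thesis
    by (simp add: norm_l2r_def inner_l2r_def)
qed

lemma abs_l2r_diff:
  assumes "sq_integrable f" "sq_integrable g"
  shows "abs_l2r f - abs_l2r g = abs_l2r (\<lambda>x. f x - g x)"
  using assms sq_integrable_scale[of g "-1"]
  by (simp add: minus_l2r_def scaleC.abs_eq plus_l2r.abs_eq)

lemma sq_integrable_diff:
  assumes "sq_integrable f" "sq_integrable g"
  shows "sq_integrable (\<lambda>x. f x - g x)"
  using sq_integrable_add[OF assms(1) sq_integrable_scale[of g "-1"]] assms by simp

text \<open>The Riesz--Fischer argument.  With \<open>d n\<close> the successive differences, the weighted sum
  \<open>G = (\<Sum>n. 2\<^sup>n |d n|\<^sup>2)\<close> is integrable.  It controls everything: where it is finite the sequence converges
  pointwise, and by the Cauchy--Schwarz inequality the squared pointwise distances between its members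
  are at most \<open>2 G\<close>, so dominated convergence applies.\<close>

lemma l2r_rapidly_Cauchy_convergent:
  fixes X :: "nat \<Rightarrow> l2r"
  assumes X: "\<And>n. norm (X (Suc n) - X n) \<le> (1/4)^n"
  shows "\<exists>L. X \<longlonglongrightarrow> L"
proof -
  define F where "F n = rep_l2r (X n)" for n
  define d where "d n x = F (Suc n) x - F n x" for n x
  define h where "h n x = 2^n * (cmod (d n x))\<^sup>2" for n x
  define G where "G x = (\<Sum>n. h n x)" for x
  have sF: "sq_integrable (F n)" for n by (simp add: F_def sq_integrable_rep)
  have absF: "abs_l2r (F n) = X n" for n by (simp add: F_def abs_rep_l2r)
  have mF[measurable]: "F n \<in> borel_measurable borel" for n
    using sF[of n] by (simp add: sq_integrable_def)
  have sd: "sq_integrable (d n)" for n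
    unfolding d_def[abs_def] by (intro sq_integrable_diff sF)
  have ih: "integrable lborel (h n)" for n
    using sd[of n] by (auto simp: h_def[abs_def] sq_integrable_def)
  have mh[measurable]: "h n \<in> borel_measurable borel" for n
    using borel_measurable_integrable[OF ih[of n]] by simp
  have h0: "0 \<le> h n x" for n x by (simp add: h_def)
  have Ih: "(LINT x|lborel. h n x) \<le> (1/2)^n" for n
  proof -
    have "(LINT x|lborel. (cmod (d n x))\<^sup>2) = (norm (X (Suc n) - X n))\<^sup>2"
      unfolding norm_abs_l2r[OF sd, symmetric] absF[symmetric] abs_l2r_diff[OF sF sF]
      by (simp add: d_def[abs_def])
    also have "\<dots> \<le> ((1/4)^n)\<^sup>2" by (intro power_mono X) auto
    finally have "(LINT x|lborel. h n x) \<le> 2^n * ((1/4)^n)\<^sup>2" by (simp add: h_def[abs_def])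
    also have "\<dots> = (2 * (1/4) * (1/4))^n"
      by (simp only: power2_eq_square power_mult_distrib mult.assoc)
    also have "\<dots> \<le> (1/2)^n" by (intro power_mono) auto
    finally show ?thesis .
  qed
  have sIh: "summable (\<lambda>n. LINT x|lborel. h n x)"
  proof (rule summable_comparison_test)
    show "\<exists>N. \<forall>n\<ge>N. norm (LINT x|lborel. h n x) \<le> (1/2)^n"
      using Ih by (auto simp: abs_of_nonneg h0)
  qed (simp add: summable_geometric)
  have AEs: "AE x in lborel. summable (\<lambda>n. h n x)"
  proof -
    have "(\<integral>\<^sup>+x. (\<Sum>n. ennreal (h n x)) \<partial>lborel) = (\<Sum>n. \<integral>\<^sup>+x. ennreal (h n x) \<partial>lborel)"
      by (intro nn_integral_suminf) auto
    also have "\<dots> = (\<Sum>n. ennreal (LINT x|lborel. h n x))"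
      by (intro suminf_cong nn_integral_eq_integral ih) (auto simp: h0)
    also have "\<dots> = ennreal (\<Sum>n. LINT x|lborel. h n x)"
      by (intro suminf_ennreal2 sIh) (auto simp: h0)
    finally have "(\<integral>\<^sup>+x. (\<Sum>n. ennreal (h n x)) \<partial>lborel) \<noteq> \<infinity>" by simp
    then have "AE x in lborel. (\<Sum>n. ennreal (h n x)) \<noteq> \<infinity>"
      by (intro nn_integral_PInf_AE) auto
    then show ?thesis
      by eventually_elim (auto intro!: summable_suminf_not_top simp: h0)
  qed
  have iG: "integrable lborel G"
    unfolding G_def[abs_def]
    using AEs sIh by (intro integrable_suminf ih) (auto simp: h0)
  define f where "f x = lim (\<lambda>n. F n x)" for x
  have mf[measurable]: "f \<in> borel_measurable borel"
    unfolding f_def[abs_def] by measurable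
  have tele: "F m x - F n x = (\<Sum>k=n..<m. d k x)" if "n \<le> m" for m n x
    using sum_Suc_diff'[OF that, of "\<lambda>k. F k x"] by (simp add: d_def)
  have bnd: "(cmod (F m x - F n x))\<^sup>2 \<le> 2 * G x" if "n \<le> m" "summable (\<lambda>n. h n x)" for m n x
  proof -
    have "cmod (F m x - F n x) \<le> (\<Sum>k=n..<m. cmod (d k x))"
      unfolding tele[OF that(1)] by (rule norm_sum)
    also have "\<dots> = (\<Sum>k=n..<m. sqrt ((1/2)^k) * (sqrt (2^k) * cmod (d k x)))"
      by (intro sum.cong refl) (simp add: real_sqrt_divide power_divide)
    finally have "(cmod (F m x - F n x))\<^sup>2 \<le> (\<Sum>k=n..<m. sqrt ((1/2)^k) * (sqrt (2^k) * cmod (d k x)))\<^sup>2"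
      by (intro power_mono) auto
    also have "\<dots> \<le> (\<Sum>k=n..<m. (sqrt ((1/2)^k))\<^sup>2) * (\<Sum>k=n..<m. (sqrt (2^k) * cmod (d k x))\<^sup>2)"
      by (rule Cauchy_Schwarz_ineq_sum)
    also have "\<dots> = (\<Sum>k=n..<m. (1/2)^k) * (\<Sum>k=n..<m. h k x)"
      by (simp add: power_mult_distrib h_def)
    also have "\<dots> \<le> 2 * G x"
    proof (rule mult_mono)
      have "(\<Sum>k=n..<m. (1/2::real)^k) \<le> (\<Sum>k. (1/2)^k)"
        by (intro sum_le_suminf) (auto simp: summable_geometric)
      then show "(\<Sum>k=n..<m. (1/2::real)^k) \<le> 2" by (simp add: suminf_geometric)
      show "(\<Sum>k=n..<m. h k x) \<le> G x"
        unfolding G_def using that by (intro sum_le_suminf) (auto simp: h0)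
    qed (auto simp: h0 sum_nonneg)
    finally show ?thesis .
  qed
  have conv: "(\<lambda>n. F n x) \<longlonglongrightarrow> f x" if "summable (\<lambda>n. h n x)" for x
  proof -
    have "norm (d n x) \<le> (1/2)^n + h n x" for n
    proof -
      define a where "a = sqrt ((1/2)^n)"
      define b where "b = sqrt (2^n) * cmod (d n x)"
      have "cmod (d n x) = a * b" by (simp add: a_def b_def real_sqrt_divide power_divide)
      also have "\<dots> \<le> a\<^sup>2 + b\<^sup>2"
      proof -
        have "2 * a * b \<le> a\<^sup>2 + b\<^sup>2" by (rule sum_squares_bound)
        moreover have "0 \<le> a * b" by (simp add: a_def b_def)
        ultimately show ?thesis by linarith
      qed
      also have "\<dots> = (1/2)^n + h n x" by (simp add: a_def b_def h_def power_mult_distrib)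
      finally show ?thesis by simp
    qed
    then have "summable (\<lambda>n. d n x)"
      by (intro summable_comparison_test[OF _ summable_add[OF summable_geometric that]]) auto
    then have "convergent (\<lambda>n. \<Sum>k<n. d k x)" by (simp add: summable_iff_convergent)
    then obtain l where "(\<lambda>n. \<Sum>k<n. d k x) \<longlonglongrightarrow> l" by (auto simp: convergent_def)
    then have "(\<lambda>n. F 0 x + (\<Sum>k<n. d k x)) \<longlonglongrightarrow> F 0 x + l" by (intro tendsto_intros)
    moreover have "F 0 x + (\<Sum>k<n. d k x) = F n x" for n
      using tele[of 0 n x] by (simp add: atLeast0LessThan algebra_simps)
    ultimately have "(\<lambda>n. F n x) \<longlonglongrightarrow> F 0 x + l" by simp
    then show ?thesis by (simp add: f_def limI)
  qed
  have bnd': "(cmod (f x - F n x))\<^sup>2 \<le> 2 * G x" if "summable (\<lambda>n. h n x)" for n x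
  proof (rule tendsto_upperbound)
    show "(\<lambda>m. (cmod (F m x - F n x))\<^sup>2) \<longlonglongrightarrow> (cmod (f x - F n x))\<^sup>2"
      by (intro tendsto_intros conv that)
    show "\<forall>\<^sub>F m in sequentially. (cmod (F m x - F n x))\<^sup>2 \<le> 2 * G x"
      using eventually_ge_at_top[of n] by eventually_elim (use bnd that in auto)
  qed auto
  have sfF: "sq_integrable (\<lambda>x. f x - F n x)" for n
    unfolding sq_integrable_def
  proof (intro conjI, measurable)
    show "integrable lborel (\<lambda>x. (cmod (f x - F n x))\<^sup>2)"
    proof (rule Bochner_Integration.integrable_bound)
      show "integrable lborel (\<lambda>x. 2 * G x)" using iG by simp
      show "AE x in lborel. norm ((cmod (f x - F n x))\<^sup>2) \<le> norm (2 * G x)"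
        using AEs by eventually_elim (use bnd' in \<open>auto intro: order_trans[OF _ abs_ge_self]\<close>)
    qed measurable
  qed
  have sf: "sq_integrable f"
    using sq_integrable_add[OF sfF[of 0] sF[of 0]] by simp
  have "(\<lambda>n. LINT x|lborel. (cmod (f x - F n x))\<^sup>2) \<longlonglongrightarrow> (LINT x|(lborel::real measure). (0::real))"
  proof (rule Bochner_Integration.integral_dominated_convergence)
    show "integrable lborel (\<lambda>x. 2 * G x)" using iG by simp
    show "AE x in lborel. (\<lambda>n. (cmod (f x - F n x))\<^sup>2) \<longlonglongrightarrow> 0"
      using AEs
    proof eventually_elim
      case (elim x)
      have "(\<lambda>n. (cmod (f x - F n x))\<^sup>2) \<longlonglongrightarrow> (cmod (f x - f x))\<^sup>2"
        by (intro tendsto_intros conv elim)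
      then show ?case by simp
    qed
    show "AE x in lborel. norm ((cmod (f x - F n x))\<^sup>2) \<le> 2 * G x" for n
      using AEs by eventually_elim (use bnd' in auto)
  qed measurable
  then have "(\<lambda>n. (norm (abs_l2r f - X n))\<^sup>2) \<longlonglongrightarrow> 0"
    unfolding absF[symmetric] abs_l2r_diff[OF sf sF] norm_abs_l2r[OF sfF] by simp
  then have "(\<lambda>n. norm (abs_l2r f - X n)) \<longlonglongrightarrow> 0"
    using tendsto_real_sqrt by fastforce
  then have "X \<longlonglongrightarrow> abs_l2r f"
    by (subst tendsto_dist_iff) (simp add: dist_norm norm_minus_commute)
  then show ?thesis by blast
qed

instance l2r :: banach
proof
  fix X :: "nat \<Rightarrow> l2r"
  assume C: "Cauchy X"
  have "\<exists>N. \<forall>m\<ge>N. \<forall>n\<ge>N. dist (X m) (X n) < (1/4)^k" for k :: nat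
    using C by (auto intro!: metric_CauchyD)
  then obtain N where N: "\<And>k m n. N k \<le> m \<Longrightarrow> N k \<le> n \<Longrightarrow> dist (X m) (X n) < (1/4)^k"
    by metis
  define r where "r n = (\<Sum>k\<le>n. N k) + n" for n
  have r1: "N n \<le> r n" for n
    unfolding r_def by (simp add: member_le_sum trans_le_add1)
  have r2: "strict_mono r"
    unfolding strict_mono_Suc_iff by (simp add: r_def)
  have "norm (X (r (Suc n)) - X (r n)) \<le> (1/4)^n" for n
    using N[of n "r (Suc n)" "r n"] r1[of n] strict_monoD[OF r2, of n "Suc n"]
    by (simp add: dist_norm)
  then obtain L where "(\<lambda>n. X (r n)) \<longlonglongrightarrow> L"
    using l2r_rapidly_Cauchy_convergent[of "\<lambda>n. X (r n)"] by auto
  then have "X \<longlonglongrightarrow> L"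
    using C r2 Cauchy_converges_subseq[of X r L] by (simp add: o_def)
  then show "convergent X" by (auto simp: convergent_def)
qed

section \<open>Modulations, translations and dilations\<close>

lemma AE_trivial_l2r:
  "sq_integrable f \<Longrightarrow> (\<And>x. f x = g x) \<Longrightarrow>
    sq_integrable f \<and> sq_integrable g \<and> (AE x in lborel. f x = g x)"
  for f g :: "real \<Rightarrow> complex"
proof -
  assume "sq_integrable f" "\<And>x. f x = g x"
  then have "g = f" by (intro ext) simp
  then show ?thesis using \<open>sq_integrable f\<close> by simp
qed

lemma sq_integrable_M: "sq_integrable f \<Longrightarrow> sq_integrable (\<lambda>x. exp (\<i> * of_real (a * x)) * f x)"
  by (intro sq_integrable_unimodular) (auto simp del: of_real_mult)

lemma sq_integrable_V: "sq_integrable f \<Longrightarrow> sq_integrable (\<lambda>x. of_real (exp (t / 2)) * f (exp t * x))"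
  by (intro sq_integrable_scale[of "\<lambda>x. f (exp t * x)"] sq_integrable_dilate)

lemma M_fun_0: "M_fun 0 v = v"
  by transfer auto

lemma D_fun_0: "D_fun 0 v = v"
  by transfer auto

lemma M_fun_add: "M_fun (a + b) v = M_fun a (M_fun b v)"
  by transfer
    (rule AE_trivial_l2r, simp add: sq_integrable_M del: of_real_mult, simp add: algebra_simps exp_add)

lemma D_fun_add: "D_fun (a + b) v = D_fun a (D_fun b v)"
  by transfer
    (rule AE_trivial_l2r, simp add: sq_integrable_shift, simp add: algebra_simps)

lemma D_fun_M_fun: "D_fun b (M_fun a v) = scaleC (cis (- (a * b))) (M_fun a (D_fun b v))"
proof transfer
  fix a b and f :: "real \<Rightarrow> complex"
  assume f: "sq_integrable f \<and> sq_integrable f \<and> (AE x in lborel. f x = f x)"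
  show "sq_integrable (\<lambda>x. exp (\<i> * of_real (a * (x - b))) * f (x - b)) \<and>
    sq_integrable (\<lambda>x. cis (- (a * b)) * (exp (\<i> * of_real (a * x)) * f (x - b))) \<and>
    (AE x in lborel. exp (\<i> * of_real (a * (x - b))) * f (x - b) =
      cis (- (a * b)) * (exp (\<i> * of_real (a * x)) * f (x - b)))"
  proof (rule AE_trivial_l2r)
    show "sq_integrable (\<lambda>x. exp (\<i> * of_real (a * (x - b))) * f (x - b))"
      using f by (intro sq_integrable_shift[OF sq_integrable_M]) auto
    show "exp (\<i> * of_real (a * (x - b))) * f (x - b) =
        cis (- (a * b)) * (exp (\<i> * of_real (a * x)) * f (x - b))" for x
      unfolding cis_conv_exp mult.assoc[symmetric] exp_add[symmetric]
      by (simp add: algebra_simps)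
  qed
qed

lemma V_fun_M_fun: "V_fun t (M_fun a v) = M_fun (exp t * a) (V_fun t v)"
proof transfer
  fix t a and f :: "real \<Rightarrow> complex"
  assume f: "sq_integrable f \<and> sq_integrable f \<and> (AE x in lborel. f x = f x)"
  show "sq_integrable (\<lambda>x. of_real (exp (t / 2)) * (exp (\<i> * of_real (a * (exp t * x))) * f (exp t * x))) \<and>
    sq_integrable (\<lambda>x. exp (\<i> * of_real (exp t * a * x)) * (of_real (exp (t / 2)) * f (exp t * x))) \<and>
    (AE x in lborel. of_real (exp (t / 2)) * (exp (\<i> * of_real (a * (exp t * x))) * f (exp t * x)) =
      exp (\<i> * of_real (exp t * a * x)) * (of_real (exp (t / 2)) * f (exp t * x)))"
    by (rule AE_trivial_l2r)
      (use f sq_integrable_V[OF sq_integrable_M, of f t a] in \<open>auto simp: mult_ac\<close>)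
qed

lemma V_fun_D_fun: "V_fun t (D_fun m v) = D_fun (exp (- t) * m) (V_fun t v)"
proof transfer
  fix t m and f :: "real \<Rightarrow> complex"
  assume f: "sq_integrable f \<and> sq_integrable f \<and> (AE x in lborel. f x = f x)"
  show "sq_integrable (\<lambda>x. of_real (exp (t / 2)) * f (exp t * x - m)) \<and>
    sq_integrable (\<lambda>x. of_real (exp (t / 2)) * f (exp t * (x - exp (- t) * m))) \<and>
    (AE x in lborel. of_real (exp (t / 2)) * f (exp t * x - m) =
      of_real (exp (t / 2)) * f (exp t * (x - exp (- t) * m)))"
    by (rule AE_trivial_l2r)
      (use f sq_integrable_V[OF sq_integrable_shift, of f t m] in
        \<open>auto simp: algebra_simps simp flip: exp_add mult.assoc\<close>)
qed

lemma cinner_M_fun_adjoint: "cinner (M_fun a v) w = cinner v (M_fun (- a) w)"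
  using cinner_M_fun[of a v "M_fun (- a) w"] by (simp add: M_fun_0 flip: M_fun_add)

lemma cinner_D_fun_adjoint: "cinner (D_fun a v) w = cinner v (D_fun (- a) w)"
  using cinner_D_fun[of a v "D_fun (- a) w"] by (simp add: D_fun_0 flip: D_fun_add)

lemma sq_integrable_indicator: "sq_integrable (\<lambda>x. complex_of_real (indicat_real {a..b} x))"
proof -
  have "(\<lambda>x. (cmod (complex_of_real (indicat_real {a..b} x)))\<^sup>2) = indicat_real {a..b}"
    by (auto simp: indicator_def)
  moreover have "integrable lborel (indicat_real {a..b})"
    by (intro integrable_real_indicator) (auto simp: emeasure_lborel_Icc_eq)
  ultimately show ?thesis by (simp add: sq_integrable_def)
qed

text \<open>Any fixed unit vector would do: its dilates become almost invariant under the modulations or under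
  the translations, and it witnesses that the identity has norm \<open>1\<close>.\<close>

definition unit_box :: l2r where
  "unit_box = abs_l2r (\<lambda>x. complex_of_real (indicat_real {0..1} x))"

lemma norm_unit_box [simp]: "norm unit_box = 1"
proof -
  have "(norm unit_box)\<^sup>2 = (LINT x|lborel. indicat_real {0..1::real} x)"
    unfolding unit_box_def norm_abs_l2r[OF sq_integrable_indicator]
    by (intro Bochner_Integration.integral_cong) (auto simp: indicator_def)
  also have "\<dots> = 1" by simp
  finally show ?thesis by (simp add: power2_eq_1_iff)
    (smt (verit) norm_ge_zero power2_eq_1_iff)
qed

lemma M_fun_unit_box_tendsto:
  assumes "e \<longlonglongrightarrow> 0"
  shows "(\<lambda>n. M_fun (e n) unit_box) \<longlonglongrightarrow> unit_box"
proof -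
  let ?u = "\<lambda>x. complex_of_real (indicat_real {0..1} x)"
  let ?g = "\<lambda>n x. exp (\<i> * of_real (e n * x)) * ?u x - ?u x"
  have su: "sq_integrable ?u" by (rule sq_integrable_indicator)
  have sg: "sq_integrable (?g n)" for n by (intro sq_integrable_diff sq_integrable_M su)
  have eq: "(norm (M_fun (e n) unit_box - unit_box))\<^sup>2 = (LINT x|lborel. (cmod (?g n x))\<^sup>2)" for n
    using su sg[of n]
    by (simp add: unit_box_def M_fun.abs_eq abs_l2r_diff sq_integrable_M norm_abs_l2r del: of_real_mult)
  have "(\<lambda>n. LINT x|lborel. (cmod (?g n x))\<^sup>2) \<longlonglongrightarrow> (LINT x|(lborel :: real measure). (0::real))"
  proof (rule Bochner_Integration.integral_dominated_convergence)
    show "integrable lborel (\<lambda>x. 4 * indicat_real {0..1::real} x)"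
      by (intro integrable_mult_right integrable_real_indicator) (auto simp: emeasure_lborel_Icc_eq)
    show "AE x in lborel. (\<lambda>n. (cmod (?g n x))\<^sup>2) \<longlonglongrightarrow> 0"
    proof (intro AE_I2)
      fix x
      have "(\<lambda>n. (cmod (?g n x))\<^sup>2) \<longlonglongrightarrow> (cmod (exp (\<i> * of_real (0 * x)) * ?u x - ?u x))\<^sup>2"
        by (intro tendsto_intros assms)
      then show "(\<lambda>n. (cmod (?g n x))\<^sup>2) \<longlonglongrightarrow> 0" by simp
    qed
    show "AE x in lborel. norm ((cmod (?g n x))\<^sup>2) \<le> 4 * indicat_real {0..1} x" for n
    proof (intro AE_I2)
      fix x
      have "cmod (exp (\<i> * of_real (e n * x)) - 1) \<le> 2"
        using norm_triangle_ineq4[of "exp (\<i> * of_real (e n * x))" 1] by (simp del: of_real_mult)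
      then have "(cmod (exp (\<i> * of_real (e n * x)) - 1))\<^sup>2 \<le> 2\<^sup>2" by (intro power_mono) auto
      then show "norm ((cmod (?g n x))\<^sup>2) \<le> 4 * indicat_real {0..1} x"
        by (auto simp: indicator_def simp del: of_real_mult)
    qed
  next
    fix n
    show "(\<lambda>x. (cmod (?g n x))\<^sup>2) \<in> borel_measurable lborel"
      using sg[of n] unfolding sq_integrable_def by measurable
  qed simp
  then have "(\<lambda>n. (norm (M_fun (e n) unit_box - unit_box))\<^sup>2) \<longlonglongrightarrow> 0"
    by (simp add: eq)
  from tendsto_real_sqrt[OF this] have "(\<lambda>n. norm (M_fun (e n) unit_box - unit_box)) \<longlonglongrightarrow> 0" by simp
  then show ?thesis by (rule LIM_zero_cancel[OF tendsto_norm_zero_cancel])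
qed

lemma D_fun_unit_box_tendsto:
  assumes "e \<longlonglongrightarrow> 0"
  shows "(\<lambda>n. D_fun (e n) unit_box) \<longlonglongrightarrow> unit_box"
proof -
  let ?u = "\<lambda>x. complex_of_real (indicat_real {0..1} x)"
  have su: "sq_integrable ?u" by (rule sq_integrable_indicator)
  have bound: "(norm (D_fun r unit_box - unit_box))\<^sup>2 \<le> 4 * \<bar>r\<bar>" for r
  proof -
    let ?g = "\<lambda>x. ?u (x - r) - ?u x"
    have sg: "sq_integrable ?g" by (intro sq_integrable_diff sq_integrable_shift su)
    have int: "integrable lborel (indicat_real {a..b})" for a b :: real
      by (intro integrable_real_indicator) (auto simp: emeasure_lborel_Icc_eq)
    have "(norm (D_fun r unit_box - unit_box))\<^sup>2 = (LINT x|lborel. (cmod (?g x))\<^sup>2)"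
      using su sg sq_integrable_shift[OF su, of r]
      by (simp add: unit_box_def D_fun.abs_eq abs_l2r_diff norm_abs_l2r)
    \<comment> \<open>The two indicator functions differ only within distance \<open>|r|\<close> of an endpoint.\<close>
    also have "\<dots> \<le> (LINT x|lborel. indicat_real {-\<bar>r\<bar>..\<bar>r\<bar>} x + indicat_real {1-\<bar>r\<bar>..1+\<bar>r\<bar>} x)"
    proof (rule integral_mono)
      show "integrable lborel (\<lambda>x. (cmod (?g x))\<^sup>2)" using sg by (simp add: sq_integrable_def)
      show "integrable lborel (\<lambda>x. indicat_real {-\<bar>r\<bar>..\<bar>r\<bar>} x + indicat_real {1-\<bar>r\<bar>..1+\<bar>r\<bar>} x)"
        by (intro Bochner_Integration.integrable_add int)
      show "(cmod (?g x))\<^sup>2 \<le> indicat_real {-\<bar>r\<bar>..\<bar>r\<bar>} x + indicat_real {1-\<bar>r\<bar>..1+\<bar>r\<bar>} x" for x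
        by (auto simp: indicator_def)
    qed
    also have "\<dots> = 4 * \<bar>r\<bar>"
      by (subst Bochner_Integration.integral_add[OF int int]) simp
    finally show ?thesis .
  qed
  have "(\<lambda>n. norm (D_fun (e n) unit_box - unit_box)) \<longlonglongrightarrow> 0"
  proof (rule Lim_null_comparison)
    have "(\<lambda>n. sqrt (4 * \<bar>e n\<bar>)) \<longlonglongrightarrow> sqrt (4 * \<bar>0\<bar>)" by (intro tendsto_intros assms)
    then show "(\<lambda>n. sqrt (4 * \<bar>e n\<bar>)) \<longlonglongrightarrow> 0" by simp
    show "\<forall>\<^sub>F n in sequentially. norm (norm (D_fun (e n) unit_box - unit_box)) \<le> sqrt (4 * \<bar>e n\<bar>)"
      using bound by (intro always_eventually allI) (simp add: real_le_rsqrt)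
  qed
  then show ?thesis by (rule LIM_zero_cancel[OF tendsto_norm_zero_cancel])
qed

section \<open>The normed algebra of bounded operators\<close>

lemma scaleC_add_left: "scaleC (a + b) v = scaleC a v + scaleC b v"
  by transfer (auto simp: distrib_right sq_integrable_scale sq_integrable_add)

text \<open>From here on vectors are opaque, so that lifting to the operator type does not unfold them.\<close>

lifting_forget l2r.lifting

lemma convergent_if_dist_le:
  fixes S :: "nat \<Rightarrow> 'a::complete_space" and Y :: "nat \<Rightarrow> 'b::metric_space"
  assumes "Y \<longlonglongrightarrow> T" "\<And>m n. dist (S m) (S n) \<le> dist (Y m) (Y n)"
  obtains R where "S \<longlonglongrightarrow> R"
proof -
  have "Cauchy Y" using assms(1) by (rule LIMSEQ_imp_Cauchy)
  then have "Cauchy S" unfolding Cauchy_def by (meson assms(2) le_less_trans)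
  then show ?thesis using that by (auto simp: Cauchy_convergent_iff convergent_def)
qed

lemma tendsto_if_norm_le:
  fixes f :: "nat \<Rightarrow> 'a::real_normed_vector" and Y :: "nat \<Rightarrow> 'b::real_normed_vector"
  assumes "Y \<longlonglongrightarrow> T" "\<And>n. norm (f n - l) \<le> norm (Y n - T)"
  shows "f \<longlonglongrightarrow> l"
  by (rule LIM_zero_cancel, rule Lim_null_comparison[OF _ tendsto_norm_zero[OF LIM_zero[OF assms(1)]]])
    (simp add: assms(2))

lemma closed_B_L2: "closed B_L2"
  using closed_subalgebra_B_L2 by (simp add: closed_subalgebra_def)

text \<open>A type of its own for the complex-linear operators makes them a Banach algebra in the sense of the type
  classes, with composition as the product; complex scalars enter as central elements \<open>sc c\<close>.\<close>

typedef oper = B_L2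
  using M_op_B_L2 by blast

setup_lifting type_definition_oper

lift_definition app :: "oper \<Rightarrow> l2r \<Rightarrow> l2r" (infixr "\<star>" 69) is blinfun_apply .

instantiation oper :: real_normed_algebra_1
begin

lift_definition zero_oper :: oper is 0 by (simp add: B_L2_def linear_0[OF bounded_linear.linear[OF bounded_linear_scaleC]])
lift_definition one_oper :: oper is id_blinfun by (simp add: B_L2_def)
lift_definition plus_oper :: "oper \<Rightarrow> oper \<Rightarrow> oper" is "(+)"
  by (simp add: B_L2_def blinfun.add_left scaleC_add_right)
lift_definition scaleR_oper :: "real \<Rightarrow> oper \<Rightarrow> oper" is "(*\<^sub>R)"
  by (simp add: B_L2_def blinfun.scaleR_left scaleC_scaleR)
lift_definition uminus_oper :: "oper \<Rightarrow> oper" is uminus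
  by (simp add: B_L2_def blinfun.minus_left linear_neg[OF bounded_linear.linear[OF bounded_linear_scaleC]])
lift_definition minus_oper :: "oper \<Rightarrow> oper \<Rightarrow> oper" is "(-)"
  by (simp add: B_L2_def blinfun.diff_left linear_diff[OF bounded_linear.linear[OF bounded_linear_scaleC]])
lift_definition times_oper :: "oper \<Rightarrow> oper \<Rightarrow> oper" is "(o\<^sub>L)"
  by (simp add: B_L2_def)
lift_definition norm_oper :: "oper \<Rightarrow> real" is norm .
definition sgn_oper :: "oper \<Rightarrow> oper" where "sgn_oper f = scaleR (inverse (norm f)) f"
definition dist_oper :: "oper \<Rightarrow> oper \<Rightarrow> real" where "dist_oper f g = norm (f - g)"
definition uniformity_oper :: "(oper \<times> oper) filter" where
  "uniformity_oper = (INF e\<in>{0<..}. principal {(x, y). dist x y < e})"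
definition open_oper :: "oper set \<Rightarrow> bool" where
  "open_oper U \<longleftrightarrow> (\<forall>x\<in>U. \<forall>\<^sub>F (x', y) in uniformity. x' = x \<longrightarrow> y \<in> U)"

instance
proof
  fix S T U :: oper and a b :: real
  show "S + T + U = S + (T + U)" by transfer simp
  show "S + T = T + S" by transfer simp
  show "0 + S = S" by transfer simp
  show "- S + S = 0" by transfer simp
  show "S - T = S + - T" by transfer simp
  show "a *\<^sub>R (S + T) = a *\<^sub>R S + a *\<^sub>R T" by transfer (simp add: scaleR_add_right)
  show "(a + b) *\<^sub>R S = a *\<^sub>R S + b *\<^sub>R S" by transfer (simp add: scaleR_add_left)
  show "a *\<^sub>R b *\<^sub>R S = (a * b) *\<^sub>R S" by transfer simp
  show "1 *\<^sub>R S = S" by transfer simp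
  show "S * T * U = S * (T * U)" by transfer (simp add: blinfun_eqI)
  show "(S + T) * U = S * U + T * U"
    by transfer (auto intro!: blinfun_eqI simp: blinfun.add_left)
  show "S * (T + U) = S * T + S * U"
    by transfer (auto intro!: blinfun_eqI simp: blinfun.add_left blinfun.add_right)
  show "1 * S = S" "S * 1 = S" by (transfer, auto intro!: blinfun_eqI)+
  show "a *\<^sub>R S * T = a *\<^sub>R (S * T)"
    by transfer (auto intro!: blinfun_eqI simp: blinfun.scaleR_left)
  show "S * a *\<^sub>R T = a *\<^sub>R (S * T)"
    by transfer (auto intro!: blinfun_eqI simp: blinfun.scaleR_left blinfun.scaleR_right)
  show "(norm S = 0) = (S = 0)" by transfer simp
  show "norm (S + T) \<le> norm S + norm T" by transfer (rule norm_triangle_ineq)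
  show "norm (a *\<^sub>R S) = \<bar>a\<bar> * norm S" by transfer simp
  show "norm (S * T) \<le> norm S * norm T" by transfer (rule norm_blinfun_compose)
  have "1 \<le> norm (id_blinfun :: l2r \<Rightarrow>\<^sub>L l2r)"
    using norm_blinfun[of id_blinfun unit_box] by simp
  moreover have "norm (id_blinfun :: l2r \<Rightarrow>\<^sub>L l2r) \<le> 1"
    by (intro norm_blinfun_bound) auto
  ultimately show one: "norm (1::oper) = 1" by transfer simp
  then show "(0::oper) \<noteq> 1"
    by transfer auto
qed (simp_all add: sgn_oper_def dist_oper_def uniformity_oper_def open_oper_def)

end

lemma dist_Rep_oper: "dist (Rep_oper S) (Rep_oper T) = dist S T"
  unfolding dist_norm by transfer simp

lemma tendsto_Rep_oper_iff:
  "(X \<longlongrightarrow> T) F \<longleftrightarrow> ((\<lambda>n. Rep_oper (X n)) \<longlongrightarrow> Rep_oper T) F"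
  by (simp add: tendsto_iff dist_Rep_oper)

instance oper :: banach
proof
  fix X :: "nat \<Rightarrow> oper"
  assume "Cauchy X"
  then have "Cauchy (\<lambda>n. Rep_oper (X n))"
    by (simp add: Cauchy_def dist_Rep_oper)
  then obtain L where L: "(\<lambda>n. Rep_oper (X n)) \<longlonglongrightarrow> L"
    by (auto simp: Cauchy_convergent_iff convergent_def)
  have "L \<in> B_L2"
    using closed_sequentially[OF closed_B_L2 _ L] Rep_oper by blast
  then have "Rep_oper (Abs_oper L) = L" by (simp add: Abs_oper_inverse)
  then have "X \<longlonglongrightarrow> Abs_oper L" using L by (simp add: tendsto_Rep_oper_iff)
  then show "convergent X" by (auto simp: convergent_def)
qed

lemma app_mult [simp]: "(S * T) \<star> v = S \<star> T \<star> v" by transfer simp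
lemma app_one [simp]: "1 \<star> v = v" by transfer simp
lemma app_zero [simp]: "0 \<star> v = 0" by transfer simp
lemma app_add: "(S + T) \<star> v = (S \<star> v) + (T \<star> v)" by transfer (simp add: blinfun.add_left)
lemma app_diff: "(S - T) \<star> v = (S \<star> v) - (T \<star> v)" by transfer (simp add: blinfun.diff_left)
lemma app_scaleR: "(r *\<^sub>R T) \<star> v = r *\<^sub>R (T \<star> v)" by transfer (simp add: blinfun.scaleR_left)
lemma app_diff_right: "T \<star> (v - w) = (T \<star> v) - (T \<star> w)" by transfer (simp add: blinfun.diff_right)
lemma app_scaleR_right: "T \<star> (r *\<^sub>R v) = r *\<^sub>R (T \<star> v)" by transfer (simp add: blinfun.scaleR_right)
lemma app_zero_right [simp]: "T \<star> 0 = 0" by transfer simp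
lemma app_scaleC_right: "T \<star> scaleC c v = scaleC c (T \<star> v)" by transfer (simp add: B_L2_def)

lemma norm_app: "norm (T \<star> v) \<le> norm T * norm v"
  by transfer (rule norm_blinfun)

lemma oper_eqI: "(\<And>v. S \<star> v = T \<star> v) \<Longrightarrow> S = T"
  by transfer (rule blinfun_eqI)

lemma norm_oper_bound: "0 \<le> b \<Longrightarrow> (\<And>v. norm (T \<star> v) \<le> b * norm v) \<Longrightarrow> norm T \<le> b"
  by transfer (rule norm_blinfun_bound)

lemma tendsto_app: "(X \<longlongrightarrow> T) F \<Longrightarrow> ((\<lambda>n. X n \<star> v) \<longlongrightarrow> T \<star> v) F"
  unfolding tendsto_Rep_oper_iff app.rep_eq by (intro tendsto_intros)

lift_definition sc :: "complex \<Rightarrow> oper" is "\<lambda>c. scaleC_op c id_blinfun"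
  by (simp add: B_L2_def scaleC_scaleC mult.commute)

lemma sc_app [simp]: "sc c \<star> v = scaleC c v" by transfer simp

lemma scaleC_of_real: "scaleC (of_real r) v = r *\<^sub>R v"
  by (simp add: scaleR_l2r_def)

lemma sc_add: "sc (a + b) = sc a + sc b"
  by (rule oper_eqI) (simp add: app_add scaleC_add_left)
lemma sc_mult: "sc (a * b) = sc a * sc b"
  by (rule oper_eqI) (simp add: scaleC_scaleC)
lemma sc_of_real: "sc (of_real r) = r *\<^sub>R 1"
  by (rule oper_eqI) (simp add: app_scaleR scaleC_of_real)
lemma sc_0 [simp]: "sc 0 = 0" using sc_of_real[of 0] by simp
lemma sc_1 [simp]: "sc 1 = 1" using sc_of_real[of 1] by simp
lemma sc_minus: "sc (- a) = - sc a"
  using sc_add[of "-a" a] by (simp add: eq_neg_iff_add_eq_0)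
lemma sc_diff: "sc (a - b) = sc a - sc b"
  using sc_add[of a "-b"] by (simp add: sc_minus)
lemma sc_commute: "T * sc c = sc c * T"
  by (rule oper_eqI) (simp add: app_scaleC_right)
lemma sc_left_commute: "T * (sc c * S) = sc c * (T * S)"
  by (simp add: mult.assoc[symmetric] sc_commute)

lemma sc_sc: "sc a * sc b = sc (a * b)" "sc a * (sc b * T) = sc (a * b) * T"
  by (simp_all add: sc_mult mult.assoc)

lemma norm_sc_mult [simp]: "norm (sc c * T) = cmod c * norm T"
proof (cases "c = 0")
  case False
  have le: "norm (sc c * T) \<le> cmod c * norm T" for c T
  proof (rule norm_oper_bound)
    fix v
    have "norm (T \<star> v) \<le> norm T * norm v" by (rule norm_app)
    then show "norm ((sc c * T) \<star> v) \<le> cmod c * norm T * norm v"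
      by (simp add: norm_scaleC mult_left_mono mult.assoc)
  qed simp
  have "norm T = norm (sc (1 / c) * (sc c * T))"
    using False by (simp flip: mult.assoc sc_mult)
  also have "\<dots> \<le> cmod (1 / c) * norm (sc c * T)" by (rule le)
  finally have "cmod c * norm T \<le> norm (sc c * T)"
    using False by (simp add: norm_divide field_simps)
  with le[of c T] show ?thesis by simp
qed simp

lemma norm_sc [simp]: "norm (sc c) = cmod c"
  using norm_sc_mult[of c 1] by simp

lemma tendsto_sc: "(X \<longlongrightarrow> c) F \<Longrightarrow> ((\<lambda>n. sc (X n)) \<longlongrightarrow> sc c) F"
  by (simp add: tendsto_iff dist_norm sc_diff[symmetric])

lemma norm_mult_invertible_contraction:
  fixes U V T :: "'a::real_normed_algebra_1"
  assumes U: "norm U \<le> 1" and V: "norm V \<le> 1" and inv: "U * V = 1" "V * U = 1"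
  shows "norm (U * T) = norm T" "norm (T * U) = norm T"
proof -
  have le: "norm (X * T) \<le> norm T" "norm (T * X) \<le> norm T" if "norm X \<le> 1" for X T :: 'a
    using norm_mult_ineq[of X T] norm_mult_ineq[of T X]
      mult_right_mono[OF that, of "norm T"] mult_left_mono[OF that, of "norm T"] by auto
  have "V * (U * T) = T" "T * U * V = T"
    using inv by (metis mult.assoc mult_1_left, metis mult.assoc mult_1_right)
  then show "norm (U * T) = norm T" "norm (T * U) = norm T"
    using le(1)[OF U, of T] le(1)[OF V, of "U * T"] le(2)[OF U, of T] le(2)[OF V, of "T * U"] by auto
qed

section \<open>Closed spans of Weyl monomials and their modes\<close>

text \<open>The sets of frequencies are parameters because the algebra, its ideals, its commutative
  subalgebras and the enveloping selfadjoint algebra are all of this form.  A real span suffices: the scalar \<open>c\<close>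
  already ranges over the complex numbers.\<close>

definition wspan :: "(real \<Rightarrow> oper) \<Rightarrow> (real \<Rightarrow> oper) \<Rightarrow> real set \<Rightarrow> real set \<Rightarrow> oper set" where
  "wspan P Q I J = closure (span {sc c * (P a * Q b) |c a b. a \<in> I \<and> b \<in> J})"

lemma wspan_limit: "(\<And>n. X n \<in> wspan P Q I J) \<Longrightarrow> X \<longlonglongrightarrow> T \<Longrightarrow> T \<in> wspan P Q I J"
  unfolding wspan_def by (rule closed_sequentially[OF closed_closure])

lemma wspan_monomial: "a \<in> I \<Longrightarrow> b \<in> J \<Longrightarrow> sc c * (P a * Q b) \<in> wspan P Q I J"
  unfolding wspan_def by (intro subsetD[OF closure_subset] span_base) auto

lemma wspan_zero: "0 \<in> wspan P Q I J"
  unfolding wspan_def by (intro subsetD[OF closure_subset] span_zero)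

lemma wspan_add:
  assumes "S \<in> wspan P Q I J" "T \<in> wspan P Q I J"
  shows "S + T \<in> wspan P Q I J"
proof -
  obtain X Y where "\<And>n. X n \<in> span {sc c * (P a * Q b) |c a b. a \<in> I \<and> b \<in> J}" "X \<longlonglongrightarrow> S"
    "\<And>n. Y n \<in> span {sc c * (P a * Q b) |c a b. a \<in> I \<and> b \<in> J}" "Y \<longlonglongrightarrow> T"
    using assms by (auto simp: wspan_def closure_sequential)
  then show ?thesis
    unfolding wspan_def closure_sequential
    by (intro exI[of _ "\<lambda>n. X n + Y n"]) (auto intro: span_add tendsto_add)
qed

lemma wspan_induct [consumes 1, case_names zero monomial add limit]:
  assumes T: "T \<in> wspan P Q I J"
    and zero: "X 0"
    and mono: "\<And>c a b. a \<in> I \<Longrightarrow> b \<in> J \<Longrightarrow> X (sc c * (P a * Q b))"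
    and add: "\<And>S T. S \<in> wspan P Q I J \<Longrightarrow> T \<in> wspan P Q I J \<Longrightarrow> X S \<Longrightarrow> X T \<Longrightarrow> X (S + T)"
    and limit: "\<And>Y T. (\<And>n. Y n \<in> wspan P Q I J) \<Longrightarrow> (\<And>n. X (Y n)) \<Longrightarrow> Y \<longlonglongrightarrow> T \<Longrightarrow>
      T \<in> wspan P Q I J \<Longrightarrow> X T"
  shows "X T"
proof -
  let ?G = "{sc c * (P a * Q b) |c a b. a \<in> I \<and> b \<in> J}"
  have span: "S \<in> wspan P Q I J \<and> X S" if "S \<in> span ?G" for S
    using that
  proof (induction rule: span_induct_alt)
    case base
    then show ?case using zero wspan_zero by auto
  next
    case (step r x y)
    then obtain c a b where x: "x = sc c * (P a * Q b)" "a \<in> I" "b \<in> J" by auto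
    then have "r *\<^sub>R x = sc (of_real r * c) * (P a * Q b)"
      by (simp add: sc_mult sc_of_real)
    then show ?case
      using step x mono[OF x(2,3)] wspan_monomial[OF x(2,3)] by (auto intro!: add wspan_add)
  qed
  from T obtain Y where Y: "\<And>n. Y n \<in> span ?G" "Y \<longlonglongrightarrow> T"
    by (auto simp: wspan_def closure_sequential)
  show ?thesis
    by (rule limit[OF _ _ Y(2) T]) (use span Y(1) in blast)+
qed

lemma wspan_sc: "T \<in> wspan P Q I J \<Longrightarrow> sc c * T \<in> wspan P Q I J"
proof (induction rule: wspan_induct)
  case (monomial c' a b)
  then show ?case
    using wspan_monomial[of a I b J "c * c'" P Q] by (simp add: sc_mult mult.assoc)
next
  case (limit Y T)
  show ?case by (rule wspan_limit[of "\<lambda>n. sc c * Y n", OF limit.IH]) (intro tendsto_intros limit.hyps(2))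
qed (auto simp: wspan_zero wspan_add distrib_left)

lemma wspan_uminus: "T \<in> wspan P Q I J \<Longrightarrow> - T \<in> wspan P Q I J"
  using wspan_sc[of T P Q I J "-1"] by (simp add: sc_minus)

lemma wspan_diff: "S \<in> wspan P Q I J \<Longrightarrow> T \<in> wspan P Q I J \<Longrightarrow> S - T \<in> wspan P Q I J"
  using wspan_add[OF _ wspan_uminus] by fastforce

lemma wspan_least:
  assumes "closed C" "0 \<in> C" "\<And>c a b. a \<in> I \<Longrightarrow> b \<in> J \<Longrightarrow> sc c * (P a * Q b) \<in> C"
    "\<And>S T. S \<in> C \<Longrightarrow> T \<in> C \<Longrightarrow> S + T \<in> C"
  shows "wspan P Q I J \<subseteq> C"
proof
  fix T assume "T \<in> wspan P Q I J"
  then show "T \<in> C"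
    by (induction rule: wspan_induct) (use assms closed_sequentially in \<open>blast+\<close>)
qed

lemma wspan_mono: "I \<subseteq> I' \<Longrightarrow> J \<subseteq> J' \<Longrightarrow> wspan P Q I J \<subseteq> wspan P Q I' J'"
  unfolding wspan_def by (intro closure_mono span_mono) blast

text \<open>A sequence of finite averages that replaces the Bohr mean \<open>lim 1/R \<integral>\<^sub>0\<^sup>R \<phi>\<close>.  The step \<open>1/N\<close> shrinks
  while the range \<open>[0, N]\<close> grows, so that no nonzero frequency is aliased to \<open>0\<close>.\<close>

definition cesaro :: "(real \<Rightarrow> 'a::real_vector) \<Rightarrow> nat \<Rightarrow> 'a" where
  "cesaro \<phi> N = (1 / (real N)\<^sup>2) *\<^sub>R (\<Sum>k<N\<^sup>2. \<phi> (real k / real N))"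

lemma cesaro_add: "cesaro (\<lambda>s. \<phi> s + \<psi> s) N = cesaro \<phi> N + cesaro \<psi> N"
  by (simp add: cesaro_def sum.distrib scaleR_add_right)

lemma cesaro_linear: "linear f \<Longrightarrow> f (cesaro \<phi> N) = cesaro (\<lambda>s. f (\<phi> s)) N"
  by (simp add: cesaro_def linear_scale linear_sum)

lemma cesaro_const: "N > 0 \<Longrightarrow> cesaro (\<lambda>_. c) N = c"
  unfolding cesaro_def by (simp add: sum_constant_scaleR)

lemma cesaro_mono:
  fixes \<phi> \<psi> :: "real \<Rightarrow> real"
  shows "(\<And>s. \<phi> s \<le> \<psi> s) \<Longrightarrow> cesaro \<phi> N \<le> cesaro \<psi> N"
  unfolding cesaro_def by (intro scaleR_left_mono sum_mono) auto

lemma norm_cesaro: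
  fixes \<phi> :: "real \<Rightarrow> 'a::real_normed_vector"
  assumes "\<And>s. norm (\<phi> s) \<le> B" "0 \<le> B"
  shows "norm (cesaro \<phi> N) \<le> B"
proof -
  have "norm (\<Sum>k<N\<^sup>2. \<phi> (real k / real N)) \<le> (\<Sum>k<N\<^sup>2. B)"
    by (intro sum_norm_le assms)
  then have "norm (cesaro \<phi> N) \<le> (1 / (real N)\<^sup>2) * ((real N)\<^sup>2 * B)"
    unfolding cesaro_def norm_scaleR by (intro mult_mono) auto
  also have "\<dots> \<le> B" using assms(2) by simp
  finally show ?thesis .
qed

lemma cesaro_cis:
  assumes "\<nu> \<noteq> 0"
  shows "cesaro (\<lambda>s. cis (\<nu> * s)) \<longlonglongrightarrow> 0"
proof (rule Lim_null_comparison)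
  have lim: "(\<lambda>N. real N * sin (\<nu> / real N)) \<longlonglongrightarrow> \<nu>"
    by real_asymp
  have "(\<lambda>N. (2 / real N) * (1 / \<bar>real N * sin (\<nu> / real N)\<bar>)) \<longlonglongrightarrow> 0 * (1 / \<bar>\<nu>\<bar>)"
  proof (rule tendsto_mult)
    show "(\<lambda>N. 2 / real N) \<longlonglongrightarrow> 0" by real_asymp
    show "(\<lambda>N. 1 / \<bar>real N * sin (\<nu> / real N)\<bar>) \<longlonglongrightarrow> 1 / \<bar>\<nu>\<bar>"
      using assms by (intro tendsto_divide tendsto_rabs tendsto_const lim) auto
  qed
  then show "(\<lambda>N. (2 / real N) * (1 / \<bar>real N * sin (\<nu> / real N)\<bar>)) \<longlonglongrightarrow> 0" by simp
  have "\<forall>\<^sub>F N in sequentially. real N * sin (\<nu> / real N) \<noteq> 0"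
    using tendsto_imp_eventually_ne[OF lim assms] .
  then show "\<forall>\<^sub>F N in sequentially. norm (cesaro (\<lambda>s. cis (\<nu> * s)) N) \<le>
      (2 / real N) * (1 / \<bar>real N * sin (\<nu> / real N)\<bar>)"
  proof eventually_elim
    case (elim N)
    \<comment> \<open>The average is a geometric sum with ratio \<open>z\<close>, and \<open>|z - 1| \<ge> |sin (\<nu> / N)|\<close>.\<close>
    define z where "z = cis (\<nu> / real N)"
    have "\<bar>sin (\<nu> / real N)\<bar> = \<bar>Im (z - 1)\<bar>" by (simp add: z_def)
    also have "\<dots> \<le> cmod (z - 1)" by (rule abs_Im_le_cmod)
    finally have z1: "\<bar>sin (\<nu> / real N)\<bar> \<le> cmod (z - 1)" .
    with elim have "z \<noteq> 1" by auto
    have "(\<Sum>k<N\<^sup>2. cis (\<nu> * (real k / real N))) = (\<Sum>k<N\<^sup>2. z ^ k)"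
      by (intro sum.cong refl) (simp add: z_def Complex.DeMoivre mult.commute)
    also have "\<dots> = (z ^ N\<^sup>2 - 1) / (z - 1)"
      using \<open>z \<noteq> 1\<close> by (rule geometric_sum)
    also have "cmod \<dots> \<le> 2 / \<bar>sin (\<nu> / real N)\<bar>"
      unfolding norm_divide
    proof (intro frac_le z1)
      show "cmod (z ^ N\<^sup>2 - 1) \<le> 2"
        using norm_triangle_ineq4[of "z ^ N\<^sup>2" 1] by (simp add: norm_power z_def)
    qed (use elim in auto)
    finally have "norm (cesaro (\<lambda>s. cis (\<nu> * s)) N) \<le> (1 / (real N)\<^sup>2) * (2 / \<bar>sin (\<nu> / real N)\<bar>)"
      unfolding cesaro_def norm_scaleR by (intro mult_mono) auto
    also have "\<dots> = (2 / real N) * (1 / \<bar>real N * sin (\<nu> / real N)\<bar>)"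
      by (simp add: abs_mult power2_eq_square)
    finally show ?case .
  qed
qed

text \<open>The means defining the \<open>\<nu>\<close>-th mode, that is, the \<open>\<nu>\<close>-th Fourier coefficient of the almost periodic
  function \<open>s \<mapsto> P s * T * P (- s)\<close>.\<close>

definition mode_mean :: "(real \<Rightarrow> oper) \<Rightarrow> real \<Rightarrow> oper \<Rightarrow> nat \<Rightarrow> oper" where
  "mode_mean P \<nu> T N = cesaro (\<lambda>s. sc (cis (- (\<nu> * s))) * (P s * T * P (- s))) N"

definition mode :: "(real \<Rightarrow> oper) \<Rightarrow> real \<Rightarrow> oper \<Rightarrow> oper" where
  "mode P \<nu> T = lim (mode_mean P \<nu> T)"

text \<open>Two one-parameter unitary groups with the Weyl relation.  The sign \<open>\<sigma>\<close> lets the same development apply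
  to modulations and translations in either order.\<close>

locale weyl0 =
  fixes P Q :: "real \<Rightarrow> oper" and \<sigma> :: real
  assumes P_0 [simp]: "P 0 = 1" and P_add: "P (a + b) = P a * P b"
    and Q_0 [simp]: "Q 0 = 1" and Q_add: "Q (a + b) = Q a * Q b"
    and P_adj: "(P a \<star> v) \<bullet> w = v \<bullet> (P (- a) \<star> w)"
    and Q_adj: "(Q a \<star> v) \<bullet> w = v \<bullet> (Q (- a) \<star> w)"
    and weyl: "Q b * P a = sc (cis (- (\<sigma> * a * b))) * (P a * Q b)"
    and \<sigma>: "\<sigma> * \<sigma> = 1"
begin

lemma swap: "weyl0 Q P (- \<sigma>)"
proof unfold_locales
  fix a b
  have "sc (cis (- (- \<sigma> * a * b))) * (Q a * P b) =
      sc (cis (\<sigma> * a * b) * cis (- (\<sigma> * b * a))) * (P b * Q a)"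
    by (simp only: weyl sc_mult mult.assoc) simp
  then show "P b * Q a = sc (cis (- (- \<sigma> * a * b))) * (Q a * P b)"
    by (simp add: cis_mult mult_ac)
qed (auto simp: P_add Q_add P_adj Q_adj \<sigma>)

lemma P_minus [simp]: "P a * P (- a) = 1" "P (- a) * P a = 1"
  using P_add[of a "-a"] P_add[of "-a" a] by auto

lemma P_minus_left [simp]: "P a * (P (- a) * T) = T" "P (- a) * (P a * T) = T"
  by (simp_all flip: mult.assoc)

lemma norm_P_app [simp]: "norm (P a \<star> v) = norm v"
proof -
  have "(P a \<star> v) \<bullet> (P a \<star> v) = v \<bullet> ((P (- a) * P a) \<star> v)"
    unfolding P_adj app_mult ..
  then show ?thesis by (simp add: norm_eq_sqrt_inner)
qed

lemma norm_P_le: "norm (P a) \<le> 1"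
  by (rule norm_oper_bound) auto

lemma norm_P_mult [simp]: "norm (P a * T) = norm T" "norm (T * P a) = norm T"
  using norm_mult_invertible_contraction[OF norm_P_le norm_P_le P_minus] by auto

lemma norm_P [simp]: "norm (P a) = 1"
  using norm_P_mult(1)[of a 1] by simp

lemma P_mult_Q: "P a * Q b = sc (cis (\<sigma> * a * b)) * (Q b * P a)"
  using weyl0.weyl[OF swap, of a b] by (simp add: mult_ac)

lemma P_commute: "P a * P b = P b * P a"
  by (metis P_add add.commute)

lemma P_sc: "P a * (sc c * T) = sc c * (P a * T)" and Q_sc: "Q a * (sc c * T) = sc c * (Q a * T)"
  by (rule sc_left_commute)+

lemmas weyl_simps = mult.assoc sc_sc P_sc Q_sc

lemma conj_monomial:
  "P s * (sc c * (P a * Q b)) * P (- s) = sc (cis (\<sigma> * b * s)) * (sc c * (P a * Q b))"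
proof -
  have "P s * (sc c * (P a * Q b)) * P (- s) = sc c * (P a * (P s * Q b) * P (- s))"
    by (simp add: weyl_simps) (simp add: P_commute[of s a] flip: mult.assoc)
  also have "\<dots> = sc (c * cis (\<sigma> * s * b)) * (P a * Q b)"
    by (simp add: P_mult_Q[of s b] weyl_simps)
  also have "\<dots> = sc (cis (\<sigma> * b * s)) * (sc c * (P a * Q b))"
    by (simp add: weyl_simps mult_ac)
  finally show ?thesis .
qed

text \<open>The enveloping selfadjoint algebra.\<close>

abbreviation "B \<equiv> wspan P Q UNIV UNIV"

lemma monomial_mult:
  "(sc c * (P a * Q b)) * (sc c' * (P a' * Q b')) =
    sc (c * c' * cis (- (\<sigma> * a' * b))) * (P (a + a') * Q (b + b'))"
proof -
  have "(sc c * (P a * Q b)) * (sc c' * (P a' * Q b')) = sc (c * c') * (P a * (Q b * P a') * Q b')"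
    by (simp add: weyl_simps)
  also have "\<dots> = sc (c * c') * (sc (cis (- (\<sigma> * a' * b))) * (P (a + a') * Q (b + b')))"
    unfolding weyl by (simp add: weyl_simps P_add Q_add)
  finally show ?thesis by (simp add: weyl_simps)
qed

lemma wspan_mult:
  assumes S: "S \<in> wspan P Q I J" and T: "T \<in> wspan P Q I' J'"
    and I: "\<And>a a'. a \<in> I \<Longrightarrow> a' \<in> I' \<Longrightarrow> a + a' \<in> I''"
    and J: "\<And>b b'. b \<in> J \<Longrightarrow> b' \<in> J' \<Longrightarrow> b + b' \<in> J''"
  shows "S * T \<in> wspan P Q I'' J''"
  using S
proof (induction rule: wspan_induct)
  case (monomial c a b)
  show ?case
    using T
  proof (induction rule: wspan_induct)
    case (monomial c' a' b')
    then show ?case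
      unfolding monomial_mult using I J \<open>a \<in> I\<close> \<open>b \<in> J\<close> by (intro wspan_monomial) auto
  next
    case (limit Y T)
    show ?case by (rule wspan_limit[of "\<lambda>n. sc c * (P a * Q b) * Y n", OF limit.IH]) (intro tendsto_intros limit.hyps(2))
  qed (auto simp: wspan_zero wspan_add distrib_left)
next
  case (limit Y S)
  show ?case by (rule wspan_limit[of "\<lambda>n. Y n * T", OF limit.IH]) (intro tendsto_intros limit.hyps(2))
qed (auto simp: wspan_zero wspan_add distrib_right)

lemma P_in_wspan: "a \<in> I \<Longrightarrow> 0 \<in> J \<Longrightarrow> P a \<in> wspan P Q I J"
  using wspan_monomial[of a I 0 J 1 P Q] by simp

lemma Q_in_wspan: "0 \<in> I \<Longrightarrow> b \<in> J \<Longrightarrow> Q b \<in> wspan P Q I J"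
  using wspan_monomial[of 0 I b J 1 P Q] by simp

lemma sub_B: "T \<in> wspan P Q I J \<Longrightarrow> T \<in> B"
  using wspan_mono[of I UNIV J UNIV P Q] by auto

lemma wspan_swap: "wspan Q P J I = wspan P Q I J"
proof -
  have sub: "wspan q p J I \<subseteq> wspan p q I J" if "weyl0 p q s" for p q s I J
  proof (rule wspan_least)
    show "closed (wspan p q I J)" by (simp add: wspan_def)
    show "sc c * (q a * p b) \<in> wspan p q I J" if "a \<in> J" "b \<in> I" for c a b
      unfolding weyl0.weyl[OF \<open>weyl0 p q s\<close>] mult.assoc[symmetric] sc_mult[symmetric]
      unfolding mult.assoc by (rule wspan_monomial[OF that(2,1)])
  qed (auto simp: wspan_zero wspan_add)
  show ?thesis using sub[OF weyl0_axioms] sub[OF swap] by blast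
qed

lemma norm_mode_mean: "norm (mode_mean P \<nu> T N) \<le> norm T"
  unfolding mode_mean_def by (rule norm_cesaro) auto

lemma mode_mean_add: "mode_mean P \<nu> (S + T) N = mode_mean P \<nu> S N + mode_mean P \<nu> T N"
  unfolding mode_mean_def cesaro_add[symmetric] by (simp add: algebra_simps)

lemma mode_mean_left:
  assumes "\<And>s. P s * S = S * P s"
  shows "mode_mean P \<nu> (S * T) N = S * mode_mean P \<nu> T N"
proof -
  have "linear (\<lambda>T. S * T)" by (rule linearI) (simp_all add: distrib_left)
  moreover have "P s * (S * T) * P (- s) = S * (P s * T * P (- s))" for s
    using assms[of s] by (simp add: mult.assoc[symmetric])
  ultimately show ?thesis
    unfolding mode_mean_def by (simp only: cesaro_linear sc_left_commute[of S])
qed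

lemma mode_mean_right:
  assumes "\<And>s. P s * S = S * P s"
  shows "mode_mean P \<nu> (T * S) N = mode_mean P \<nu> T N * S"
  unfolding mode_mean_def
  by (subst cesaro_linear[where f = "\<lambda>T. T * S"])
    (auto intro!: linearI simp: distrib_right assms mult.assoc)

lemma mode_mean_sc: "mode_mean P \<nu> (sc c * T) N = sc c * mode_mean P \<nu> T N"
  by (rule mode_mean_left) (simp add: sc_commute)

lemma mode_mean_zero [simp]: "mode_mean P \<nu> 0 = (\<lambda>_. 0)"
  using mode_mean_sc[of \<nu> 0 0] by auto

lemma mode_mean_diff: "mode_mean P \<nu> (S - T) N = mode_mean P \<nu> S N - mode_mean P \<nu> T N"
  using mode_mean_add[of \<nu> S "- T" N] mode_mean_sc[of \<nu> "-1" T N] by (simp add: sc_minus)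

lemma mode_mean_monomial:
  "mode_mean P \<nu> (sc c * (P a * Q b)) N = sc (cesaro (\<lambda>s. cis ((\<sigma> * b - \<nu>) * s)) N) * (sc c * (P a * Q b))"
proof -
  have "linear (\<lambda>z. sc z * (sc c * (P a * Q b)))"
    by (rule linearI) (simp_all add: sc_add distrib_right scaleR_conv_of_real[where 'a = complex] sc_mult sc_of_real)
  moreover have "sc (cis (- (\<nu> * s))) * (sc (cis (\<sigma> * b * s)) * T) = sc (cis ((\<sigma> * b - \<nu>) * s)) * T" for s T
    by (simp add: sc_sc cis_mult left_diff_distrib)
  ultimately show ?thesis
    unfolding mode_mean_def conj_monomial
    by (simp only: cesaro_linear[where f = "\<lambda>z. sc z * (sc c * (P a * Q b))"])
qed

lemma mode_mean_monomial_tendsto: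
  "mode_mean P \<nu> (sc c * (P a * Q b)) \<longlonglongrightarrow> (if \<sigma> * b = \<nu> then sc c * (P a * Q b) else 0)"
proof (cases "\<sigma> * b = \<nu>")
  case True
  have "mode_mean P \<nu> (sc c * (P a * Q b)) N = sc c * (P a * Q b)" if "N > 0" for N
    unfolding mode_mean_monomial using True that by (simp add: cesaro_const)
  then have "\<forall>\<^sub>F N in sequentially. mode_mean P \<nu> (sc c * (P a * Q b)) N = sc c * (P a * Q b)"
    by (intro eventually_sequentiallyI[of 1]) auto
  then show ?thesis using True by (simp add: tendsto_eventually)
next
  case False
  then have "cesaro (\<lambda>s. cis ((\<sigma> * b - \<nu>) * s)) \<longlonglongrightarrow> 0" by (intro cesaro_cis) auto
  then have "(\<lambda>N. sc (cesaro (\<lambda>s. cis ((\<sigma> * b - \<nu>) * s)) N) * (sc c * (P a * Q b))) \<longlonglongrightarrow>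
      sc 0 * (sc c * (P a * Q b))"
    by (intro tendsto_intros tendsto_sc)
  then show ?thesis using False by (simp add: mode_mean_monomial[abs_def])
qed

text \<open>The means are uniformly contractive, so convergence survives limits in \<open>T\<close>.\<close>

lemma mode_mean_convergent_limit:
  assumes "\<And>n. convergent (mode_mean P \<nu> (Y n))" "Y \<longlonglongrightarrow> T"
  shows "convergent (mode_mean P \<nu> T)"
  unfolding Cauchy_convergent_iff[symmetric]
proof (rule metric_CauchyI)
  fix e :: real assume "e > 0"
  then obtain n where n: "norm (Y n - T) < e / 4"
    using LIMSEQ_D[OF assms(2), of "e/4"] by auto
  have "Cauchy (mode_mean P \<nu> (Y n))" using assms(1) by (simp add: Cauchy_convergent_iff)
  then obtain M where M: "\<And>k l. k \<ge> M \<Longrightarrow> l \<ge> M \<Longrightarrow> norm (mode_mean P \<nu> (Y n) k - mode_mean P \<nu> (Y n) l) < e / 2"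
    using \<open>e > 0\<close> by (meson CauchyD half_gt_zero)
  have le: "norm (mode_mean P \<nu> (Y n) k - mode_mean P \<nu> T k) \<le> norm (Y n - T)" for k
    unfolding mode_mean_diff[symmetric] by (rule norm_mode_mean)
  have "dist (mode_mean P \<nu> T k) (mode_mean P \<nu> T l) < e" if "k \<ge> M" "l \<ge> M" for k l
  proof -
    have "mode_mean P \<nu> T k - mode_mean P \<nu> T l = - (mode_mean P \<nu> (Y n) k - mode_mean P \<nu> T k) +
        (mode_mean P \<nu> (Y n) k - mode_mean P \<nu> (Y n) l) + (mode_mean P \<nu> (Y n) l - mode_mean P \<nu> T l)" by simp
    then have "norm (mode_mean P \<nu> T k - mode_mean P \<nu> T l) \<le> norm (mode_mean P \<nu> (Y n) k - mode_mean P \<nu> T k) +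
        norm (mode_mean P \<nu> (Y n) k - mode_mean P \<nu> (Y n) l) + norm (mode_mean P \<nu> (Y n) l - mode_mean P \<nu> T l)"
      by (metis (no_types, lifting) norm_triangle_mono norm_minus_cancel order_refl)
    then show ?thesis using le[of k] le[of l] M[OF that] n by (simp add: dist_norm)
  qed
  then show "\<exists>M. \<forall>m\<ge>M. \<forall>n\<ge>M. dist (mode_mean P \<nu> T m) (mode_mean P \<nu> T n) < e" by blast
qed

lemma mode_mean_convergent: "T \<in> B \<Longrightarrow> convergent (mode_mean P \<nu> T)"
proof (induction rule: wspan_induct)
  case (monomial c a b)
  show ?case unfolding convergent_def using mode_mean_monomial_tendsto by blast
next
  case (limit Y T)
  then show ?case using mode_mean_convergent_limit by blast
next
  case zero
  then show ?case by (simp add: convergent_const)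
next
  case (add S T)
  then show ?case by (simp add: mode_mean_add[abs_def] convergent_add)
qed

lemma mode_mean_tendsto: "T \<in> B \<Longrightarrow> mode_mean P \<nu> T \<longlonglongrightarrow> mode P \<nu> T"
  unfolding mode_def using mode_mean_convergent convergent_LIMSEQ_iff by blast

lemma mode_eqI: "mode_mean P \<nu> T \<longlonglongrightarrow> L \<Longrightarrow> mode P \<nu> T = L"
  unfolding mode_def by (rule limI)

lemma mode_zero [simp]: "mode P \<nu> 0 = 0"
  by (rule mode_eqI) simp

lemma mode_add: "S \<in> B \<Longrightarrow> T \<in> B \<Longrightarrow> mode P \<nu> (S + T) = mode P \<nu> S + mode P \<nu> T"
  by (rule mode_eqI) (auto simp: mode_mean_add[abs_def] intro!: tendsto_intros mode_mean_tendsto)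

lemma mode_diff: "S \<in> B \<Longrightarrow> T \<in> B \<Longrightarrow> mode P \<nu> (S - T) = mode P \<nu> S - mode P \<nu> T"
  by (rule mode_eqI) (auto simp: mode_mean_diff[abs_def] intro!: tendsto_intros mode_mean_tendsto)

lemma mode_sc: "T \<in> B \<Longrightarrow> mode P \<nu> (sc c * T) = sc c * mode P \<nu> T"
  by (rule mode_eqI) (auto simp: mode_mean_sc[abs_def] intro!: tendsto_intros mode_mean_tendsto)

lemma mode_left:
  assumes "\<And>s. P s * S = S * P s" "T \<in> B"
  shows "mode P \<nu> (S * T) = S * mode P \<nu> T"
proof (rule mode_eqI)
  have "mode_mean P \<nu> (S * T) = (\<lambda>N. S * mode_mean P \<nu> T N)" by (rule ext) (rule mode_mean_left[OF assms(1)])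
  then show "mode_mean P \<nu> (S * T) \<longlonglongrightarrow> S * mode P \<nu> T"
    by (simp only:) (intro tendsto_intros mode_mean_tendsto assms(2))
qed

lemma mode_right:
  assumes "\<And>s. P s * S = S * P s" "T \<in> B"
  shows "mode P \<nu> (T * S) = mode P \<nu> T * S"
proof (rule mode_eqI)
  have "mode_mean P \<nu> (T * S) = (\<lambda>N. mode_mean P \<nu> T N * S)" by (rule ext) (rule mode_mean_right[OF assms(1)])
  then show "mode_mean P \<nu> (T * S) \<longlonglongrightarrow> mode P \<nu> T * S"
    by (simp only:) (intro tendsto_intros mode_mean_tendsto assms(2))
qed

lemma mode_monomial: "mode P \<nu> (sc c * (P a * Q b)) = (if \<sigma> * b = \<nu> then sc c * (P a * Q b) else 0)"
  by (rule mode_eqI) (rule mode_mean_monomial_tendsto)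

lemma norm_mode: "T \<in> B \<Longrightarrow> norm (mode P \<nu> T) \<le> norm T"
  by (rule LIMSEQ_le_const2[OF tendsto_norm[OF mode_mean_tendsto]]) (auto simp: norm_mode_mean)

lemma mode_limit:
  assumes "\<And>n. Y n \<in> B" "Y \<longlonglongrightarrow> T"
  shows "(\<lambda>n. mode P \<nu> (Y n)) \<longlonglongrightarrow> mode P \<nu> T"
proof -
  have T: "T \<in> B" by (rule wspan_limit[OF assms])
  show ?thesis
  proof (rule tendsto_if_norm_le[OF assms(2)])
    show "norm (mode P \<nu> (Y n) - mode P \<nu> T) \<le> norm (Y n - T)" for n
      unfolding mode_diff[OF assms(1) T, symmetric] by (intro norm_mode wspan_diff assms T)
  qed
qed

text \<open>The group \<open>P\<close> rotates \<open>Q b\<close> with frequency \<open>\<sigma> * b\<close>; since \<open>\<sigma>\<^sup>2 = 1\<close>, the mode at \<open>\<sigma> * \<nu>\<close> picks out the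
  multiples of \<open>Q \<nu>\<close>.\<close>

lemma mode_sigma_monomial: "mode P (\<sigma> * \<nu>) (sc c * (P a * Q b)) = (if b = \<nu> then sc c * (P a * Q b) else 0)"
  using \<sigma> by (auto simp: mode_monomial)

lemma mode_in_wspan: "T \<in> wspan P Q I J \<Longrightarrow> \<nu> \<in> J \<Longrightarrow> mode P (\<sigma> * \<nu>) T \<in> wspan P Q I {\<nu>}"
proof (induction rule: wspan_induct)
  case (monomial c a b)
  then show ?case by (auto simp: mode_sigma_monomial wspan_zero intro: wspan_monomial)
next
  case (limit Y T)
  show ?case
    by (rule wspan_limit[of "\<lambda>n. mode P (\<sigma> * \<nu>) (Y n)"]) (use limit in \<open>auto intro!: mode_limit intro: sub_B\<close>)
next
  case (add S T)
  then show ?case by (simp add: mode_add[OF sub_B sub_B] wspan_add)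
qed (simp add: wspan_zero)

lemma mode_eq_0: "T \<in> wspan P Q I J \<Longrightarrow> \<nu> \<notin> J \<Longrightarrow> mode P (\<sigma> * \<nu>) T = 0"
proof (induction rule: wspan_induct)
  case (monomial c a b)
  then show ?case by (auto simp: mode_sigma_monomial)
next
  case (limit Y T)
  have "(\<lambda>n. mode P (\<sigma> * \<nu>) (Y n)) \<longlonglongrightarrow> mode P (\<sigma> * \<nu>) T"
    using limit by (intro mode_limit) (auto intro: sub_B)
  then show ?case using limit by (simp add: LIMSEQ_const_iff)
next
  case (add S T)
  then show ?case by (simp add: mode_add[OF sub_B sub_B])
qed simp

lemma mode_id: "T \<in> wspan P Q I {\<nu>} \<Longrightarrow> mode P (\<sigma> * \<nu>) T = T"
proof (induction rule: wspan_induct)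
  case (monomial c a b)
  then show ?case by (auto simp: mode_sigma_monomial)
next
  case (limit Y T)
  have "(\<lambda>n. mode P (\<sigma> * \<nu>) (Y n)) \<longlonglongrightarrow> mode P (\<sigma> * \<nu>) T"
    using limit by (intro mode_limit) (auto intro: sub_B)
  then show ?case using limit LIMSEQ_unique by auto
next
  case (add S T)
  then show ?case by (simp add: mode_add[OF sub_B sub_B])
qed simp

lemma commute_P: "T \<in> wspan P Q I {0} \<Longrightarrow> P s * T = T * P s"
proof (induction rule: wspan_induct)
  case (monomial c a b)
  then show ?case by (simp add: weyl_simps P_commute)
next
  case (limit Y T)
  have "(\<lambda>n. P s * Y n) \<longlonglongrightarrow> P s * T" "(\<lambda>n. Y n * P s) \<longlonglongrightarrow> T * P s"
    by (intro tendsto_intros limit)+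
  then show ?case using limit LIMSEQ_unique by auto
qed (auto simp: algebra_simps)

lemma commute_wspan: "T \<in> wspan P Q I {0} \<Longrightarrow> S \<in> wspan P Q I' {0} \<Longrightarrow> S * T = T * S"
proof (induction rule: wspan_induct)
  case (monomial c a b)
  then show ?case by (simp add: weyl_simps sc_left_commute[of S] commute_P)
next
  case (limit Y T)
  have "(\<lambda>n. S * Y n) \<longlonglongrightarrow> S * T" "(\<lambda>n. Y n * S) \<longlonglongrightarrow> T * S"
    by (intro tendsto_intros limit)+
  then show ?case using limit LIMSEQ_unique by auto
qed (auto simp: algebra_simps)

end

section \<open>Adjoints and faithfulness of the mean\<close>

text \<open>A relation rather than a function: existence of adjoints is needed only inside the closed spans, where it
  follows by approximation.  Adjointness for the real inner product is enough, since complex-linear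
  operators adjoint for its real part are adjoint for the complex one.\<close>

definition adjoint_pair :: "oper \<Rightarrow> oper \<Rightarrow> bool" where
  "adjoint_pair T S \<longleftrightarrow> (\<forall>v w. (T \<star> v) \<bullet> w = v \<bullet> (S \<star> w))"

lemma adjoint_pair_norm_le:
  assumes "adjoint_pair T S"
  shows "norm S \<le> norm T"
proof (rule norm_oper_bound)
  fix w
  have "(norm (S \<star> w))\<^sup>2 = (T \<star> (S \<star> w)) \<bullet> w"
    using assms by (simp add: adjoint_pair_def power2_norm_eq_inner)
  also have "\<dots> \<le> norm (T \<star> (S \<star> w)) * norm w" by (rule norm_cauchy_schwarz)
  also have "\<dots> \<le> (norm T * norm (S \<star> w)) * norm w"
    by (intro mult_right_mono norm_app) auto
  finally have "norm (S \<star> w) * norm (S \<star> w) \<le> (norm T * norm w) * norm (S \<star> w)"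
    by (simp add: power2_eq_square mult_ac)
  then show "norm (S \<star> w) \<le> norm T * norm w"
    by (cases "norm (S \<star> w) = 0") (simp_all add: mult_le_cancel_right)
qed simp

lemma adjoint_pair_diff: "adjoint_pair T S \<Longrightarrow> adjoint_pair T' S' \<Longrightarrow> adjoint_pair (T - T') (S - S')"
  by (simp add: adjoint_pair_def app_diff inner_diff_left inner_diff_right)

lemma adjoint_pair_add: "adjoint_pair T S \<Longrightarrow> adjoint_pair T' S' \<Longrightarrow> adjoint_pair (T + T') (S + S')"
  by (simp add: adjoint_pair_def app_add inner_add_left inner_add_right)

lemma adjoint_pair_mult: "adjoint_pair T S \<Longrightarrow> adjoint_pair T' S' \<Longrightarrow> adjoint_pair (T * T') (S' * S)"
  by (simp add: adjoint_pair_def)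

lemma adjoint_pair_sc: "adjoint_pair (sc c) (sc (cnj c))"
proof -
  have "cinner (scaleC c v) w = cinner v (scaleC (cnj c) w)" for v w
    by (metis cinner_commute cinner_scaleC_left complex_cnj_cnj complex_cnj_mult)
  then show ?thesis by (simp add: adjoint_pair_def inner_l2r_def)
qed

lemma adjoint_pair_sum: "(\<And>k. k \<in> K \<Longrightarrow> adjoint_pair (T k) (S k)) \<Longrightarrow> adjoint_pair (\<Sum>k\<in>K. T k) (\<Sum>k\<in>K. S k)"
  by (induction K rule: infinite_finite_induct) (auto intro: adjoint_pair_add simp: adjoint_pair_def[of 0])

lemma adjoint_pair_cesaro:
  assumes "\<And>s. adjoint_pair (T s) (S s)"
  shows "adjoint_pair (cesaro T N) (cesaro S N)"
proof -
  have scale: "adjoint_pair (r *\<^sub>R A) (r *\<^sub>R A')" if "adjoint_pair A A'" for r A A'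
    using that by (simp add: adjoint_pair_def app_scaleR)
  show ?thesis unfolding cesaro_def by (intro scale adjoint_pair_sum assms)
qed

lemma adjoint_pair_limit:
  assumes adj: "\<And>n. adjoint_pair (Y n) (S n)" and lim: "Y \<longlonglongrightarrow> T"
  obtains R where "S \<longlonglongrightarrow> R" "adjoint_pair T R"
proof -
  have "dist (S m) (S n) \<le> dist (Y m) (Y n)" for m n
    unfolding dist_norm by (intro adjoint_pair_norm_le adjoint_pair_diff adj)
  then obtain R where R: "S \<longlonglongrightarrow> R" using convergent_if_dist_le[OF lim] by blast
  have "(T \<star> v) \<bullet> w = v \<bullet> (R \<star> w)" for v w
  proof (rule LIMSEQ_unique)
    show "(\<lambda>n. (Y n \<star> v) \<bullet> w) \<longlonglongrightarrow> (T \<star> v) \<bullet> w"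
      by (intro tendsto_intros tendsto_app lim)
    have "(\<lambda>n. v \<bullet> (S n \<star> w)) \<longlonglongrightarrow> v \<bullet> (R \<star> w)"
      by (intro tendsto_intros tendsto_app R)
    then show "(\<lambda>n. (Y n \<star> v) \<bullet> w) \<longlonglongrightarrow> v \<bullet> (R \<star> w)"
      using adj by (simp add: adjoint_pair_def)
  qed
  then show ?thesis using R that by (simp add: adjoint_pair_def)
qed

lemma cesaro_sum: "cesaro (\<lambda>s. \<Sum>i\<in>I. \<phi> i s) N = (\<Sum>i\<in>I. cesaro (\<phi> i) N)"
  unfolding cesaro_def by (subst sum.swap) (simp add: scaleR_sum_right)

context weyl0 begin

lemma adjoint_pair_P: "adjoint_pair (P a) (P (- a))" and adjoint_pair_Q: "adjoint_pair (Q a) (Q (- a))"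
  by (simp_all add: adjoint_pair_def P_adj Q_adj)

lemma wspan_adjoint:
  assumes "T \<in> wspan P Q I J" "\<And>a. a \<in> I \<Longrightarrow> - a \<in> I'" "\<And>b. b \<in> J \<Longrightarrow> - b \<in> J'"
  obtains S where "S \<in> wspan P Q I' J'" "adjoint_pair T S"
proof -
  have "\<exists>S \<in> wspan P Q I' J'. adjoint_pair T S"
    using assms(1)
  proof (induction rule: wspan_induct)
    case zero
    then show ?case by (intro bexI[of _ 0] wspan_zero) (simp add: adjoint_pair_def)
  next
    case (monomial c a b)
    have "adjoint_pair (sc c * (P a * Q b)) ((Q (- b) * P (- a)) * sc (cnj c))"
      by (intro adjoint_pair_mult adjoint_pair_sc adjoint_pair_P adjoint_pair_Q)
    moreover have "(Q (- b) * P (- a)) * sc (cnj c) = sc (cnj c) * (Q (- b) * P (- a))"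
      by (rule sc_commute)
    moreover have "\<dots> = sc (cnj c * cis (- (\<sigma> * a * b))) * (P (- a) * Q (- b))"
      unfolding weyl by (simp add: weyl_simps)
    ultimately show ?case
      using wspan_monomial[of "-a" I' "-b" J'] assms(2,3) monomial by metis
  next
    case (add S T)
    then show ?case using adjoint_pair_add wspan_add by blast
  next
    case (limit Y T)
    then obtain S where "\<And>n. S n \<in> wspan P Q I' J'" "\<And>n. adjoint_pair (Y n) (S n)" by metis
    moreover from adjoint_pair_limit[OF this(2) limit.hyps(2)] obtain R where "S \<longlonglongrightarrow> R" "adjoint_pair T R" .
    ultimately show ?case using wspan_limit by blast
  qed
  then show ?thesis using that by blast
qed

text \<open>Operators in \<open>B\<close> are almost periodic: a monomial moves on a circle under conjugation by \<open>P s\<close>, and total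
  boundedness of the orbit passes to sums and norm limits.\<close>

lemma conj_totally_bounded:
  assumes "Y \<in> B" "e > 0"
  shows "\<exists>k. finite k \<and> (\<forall>s. \<exists>y\<in>k. norm (P s * Y * P (- s) - y) < e)"
  using assms
proof (induction arbitrary: e rule: wspan_induct)
  case zero
  then show ?case by (intro exI[of _ "{0}"]) simp
next
  case (monomial c a b)
  let ?Y = "sc c * (P a * Q b)"
  have "compact ((\<lambda>z. sc z * ?Y) ` sphere 0 1)"
    by (intro compact_continuous_image continuous_on_mult continuous_on_const)
      (auto simp: continuous_on_def intro: tendsto_sc)
  then obtain k where k: "finite k" "(\<lambda>z. sc z * ?Y) ` sphere 0 1 \<subseteq> (\<Union>x\<in>k. ball x e)"
    using monomial(3) unfolding compact_eq_totally_bounded by meson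
  have "\<exists>y\<in>k. norm (P s * ?Y * P (- s) - y) < e" for s
  proof -
    have "P s * ?Y * P (- s) \<in> (\<lambda>z. sc z * ?Y) ` sphere 0 1"
      unfolding conj_monomial by (intro imageI) simp
    with k(2) obtain y where "y \<in> k" "P s * ?Y * P (- s) \<in> ball y e" by blast
    then show ?thesis by (auto simp: dist_norm norm_minus_commute)
  qed
  with k(1) show ?case by blast
next
  case (add S T)
  obtain k1 k2 where k: "finite k1" "\<And>s. \<exists>y\<in>k1. norm (P s * S * P (- s) - y) < e / 2"
    "finite k2" "\<And>s. \<exists>y\<in>k2. norm (P s * T * P (- s) - y) < e / 2"
    using add.IH[of "e / 2"] add.prems by auto
  have "\<exists>y\<in>(\<lambda>(x, y). x + y) ` (k1 \<times> k2). norm (P s * (S + T) * P (- s) - y) < e" for s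
  proof -
    obtain x y where xy: "x \<in> k1" "norm (P s * S * P (- s) - x) < e / 2"
      "y \<in> k2" "norm (P s * T * P (- s) - y) < e / 2"
      using k by blast
    have eq: "P s * (S + T) * P (- s) - (x + y) = (P s * S * P (- s) - x) + (P s * T * P (- s) - y)"
      by (simp add: algebra_simps)
    have "norm (P s * (S + T) * P (- s) - (x + y)) < e"
      unfolding eq
      using norm_triangle_ineq[of "P s * S * P (- s) - x" "P s * T * P (- s) - y"] xy by linarith
    then show ?thesis using xy by force
  qed
  then show ?case using k by (intro exI[of _ "(\<lambda>(x, y). x + y) ` (k1 \<times> k2)"]) auto
next
  case (limit Y T)
  obtain n where n: "norm (Y n - T) < e / 2"
    using LIMSEQ_D[OF limit.hyps(2), of "e/2"] limit.prems by auto
  obtain k where k: "finite k" "\<And>s. \<exists>y\<in>k. norm (P s * Y n * P (- s) - y) < e / 2"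
    using limit.IH[of "e / 2" n] limit.prems by auto
  have "\<exists>y\<in>k. norm (P s * T * P (- s) - y) < e" for s
  proof -
    obtain y where y: "y \<in> k" "norm (P s * Y n * P (- s) - y) < e / 2" using k by blast
    have eq: "P s * T * P (- s) - y = (P s * Y n * P (- s) - y) - P s * (Y n - T) * P (- s)"
      by (simp add: algebra_simps)
    have "norm (P s * (Y n - T) * P (- s)) < e / 2" using n by simp
    then have "norm (P s * T * P (- s) - y) < e"
      unfolding eq
      using norm_triangle_ineq4[of "P s * Y n * P (- s) - y" "P s * (Y n - T) * P (- s)"] y by linarith
    with y(1) show ?thesis by blast
  qed
  with k(1) show ?case by blast
qed

text \<open>A nonnegative almost periodic function with mean zero vanishes.  If \<open>(Y \<star> v) \<bullet> v > 0\<close>, total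
  boundedness of the orbit provides finitely many translates of the function
  \<open>s \<mapsto> (P s * Y * P (- s) \<star> v) \<bullet> v\<close> whose sum is bounded below by a positive \<open>\<delta>\<close> for all \<open>s\<close>, while each of
  the translates has mean zero.\<close>

lemma mode_faithful:
  assumes Y: "Y \<in> B" and pos: "\<And>v. 0 \<le> (Y \<star> v) \<bullet> v" and E0: "mode P 0 Y = 0"
  shows "(Y \<star> v) \<bullet> v = 0"
proof (rule ccontr)
  assume "(Y \<star> v) \<bullet> v \<noteq> 0"
  define \<delta> where "\<delta> = (Y \<star> v) \<bullet> v / 2"
  have "\<delta> > 0" using pos[of v] \<open>(Y \<star> v) \<bullet> v \<noteq> 0\<close> by (simp add: \<delta>_def)
  define \<epsilon> where "\<epsilon> = \<delta> / ((norm v)\<^sup>2 + 1)"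
  have n1: "(norm v)\<^sup>2 + 1 > 0" by (simp add: add_nonneg_pos)
  have "\<epsilon> > 0" using \<open>\<delta> > 0\<close> n1 by (simp add: \<epsilon>_def)
  have \<epsilon>: "\<epsilon> * (norm v)\<^sup>2 \<le> \<delta>"
  proof -
    have "\<epsilon> * (norm v)\<^sup>2 \<le> \<epsilon> * ((norm v)\<^sup>2 + 1)"
      using \<open>\<epsilon> > 0\<close> by (intro mult_left_mono) auto
    also have "\<dots> = \<delta>" using n1 by (simp add: \<epsilon>_def)
    finally show ?thesis .
  qed
  obtain k where k: "finite k" "\<And>s. \<exists>y\<in>k. norm (P s * Y * P (- s) - y) < \<epsilon> / 2"
    using conj_totally_bounded[OF Y, of "\<epsilon> / 2"] \<open>\<epsilon> > 0\<close> by auto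
  \<comment> \<open>A representative of the orbit near each centre of the finite net that is near the orbit at all.\<close>
  define x where "x y = (SOME s. norm (P s * Y * P (- s) - y) < \<epsilon> / 2)" for y
  define g where "g y s = (P s * Y * P (- s) \<star> P (x y) \<star> v) \<bullet> (P (x y) \<star> v)" for y s
  have g0: "0 \<le> g y s" for y s
    unfolding g_def app_mult P_adj by (rule pos)
  have "\<delta> \<le> (\<Sum>y\<in>k. g y s)" for s
  proof -
    obtain y where y: "y \<in> k" "norm (P s * Y * P (- s) - y) < \<epsilon> / 2" using k(2) by blast
    then have x: "norm (P (x y) * Y * P (- x y) - y) < \<epsilon> / 2"
      unfolding x_def by (rule_tac someI)
    define t where "t = x y"
    have "norm (P s * Y * P (- s) - P t * Y * P (- t)) < \<epsilon>"
      using norm_triangle_ineq4[of "P s * Y * P (- s) - y" "P t * Y * P (- t) - y"] y x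
      by (simp add: t_def)
    also have "norm (P s * Y * P (- s) - P t * Y * P (- t)) =
        norm (P (- t) * (P s * Y * P (- s) - P t * Y * P (- t)) * P t)" by simp
    finally have "norm (P (- t) * (P s * Y * P (- s) - P t * Y * P (- t)) * P t) < \<epsilon>" .
    moreover define Z where "Z = P (- t) * (P s * Y * P (- s)) * P t"
    ultimately have Z: "norm (Z - Y) < \<epsilon>"
      by (simp add: algebra_simps)
    have "\<bar>((Z - Y) \<star> v) \<bullet> v\<bar> \<le> norm ((Z - Y) \<star> v) * norm v" by (rule Cauchy_Schwarz_ineq2)
    also have "\<dots> \<le> (norm (Z - Y) * norm v) * norm v" by (intro mult_right_mono norm_app) auto
    also have "\<dots> \<le> \<epsilon> * (norm v)\<^sup>2"
      using Z by (simp add: power2_eq_square mult_right_mono flip: mult.assoc)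
    finally have "\<bar>((Z - Y) \<star> v) \<bullet> v\<bar> \<le> \<delta>" using \<epsilon> by simp
    moreover have "g y s = (Z \<star> v) \<bullet> v"
      unfolding g_def Z_def t_def[symmetric] using P_adj[of "- t" _ v] by simp
    ultimately have "\<delta> \<le> g y s"
      unfolding app_diff inner_diff_left \<delta>_def by linarith
    also have "\<dots> \<le> (\<Sum>y\<in>k. g y s)" using k(1) y(1) g0 by (intro member_le_sum) auto
    finally show ?thesis .
  qed
  then have "cesaro (\<lambda>_. \<delta>) N \<le> cesaro (\<lambda>s. \<Sum>y\<in>k. g y s) N" for N
    by (rule cesaro_mono)
  moreover have "cesaro (g y) N = (mode_mean P 0 Y N \<star> P (x y) \<star> v) \<bullet> (P (x y) \<star> v)" for y N
  proof -
    have "linear (\<lambda>T. (T \<star> P (x y) \<star> v) \<bullet> (P (x y) \<star> v))"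
      by (rule linearI) (simp_all add: app_add app_scaleR inner_add_left)
    then show ?thesis
      unfolding mode_mean_def g_def[abs_def]
      by (simp add: cesaro_linear[where f = "\<lambda>T. (T \<star> P (x y) \<star> v) \<bullet> (P (x y) \<star> v)"])
  qed
  ultimately have le: "\<delta> \<le> (\<Sum>y\<in>k. (mode_mean P 0 Y N \<star> P (x y) \<star> v) \<bullet> (P (x y) \<star> v))" if "N > 0" for N
    using cesaro_const[OF that, of \<delta>] by (simp add: cesaro_sum) metis
  have "(\<lambda>N. \<Sum>y\<in>k. (mode_mean P 0 Y N \<star> P (x y) \<star> v) \<bullet> (P (x y) \<star> v)) \<longlonglongrightarrow>
      (\<Sum>y\<in>k. (mode P 0 Y \<star> P (x y) \<star> v) \<bullet> (P (x y) \<star> v))"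
    by (intro tendsto_intros tendsto_app mode_mean_tendsto Y)
  then have "\<delta> \<le> (\<Sum>y\<in>k. (mode P 0 Y \<star> P (x y) \<star> v) \<bullet> (P (x y) \<star> v))"
    by (rule LIMSEQ_le_const) (use le in \<open>auto intro!: exI[of _ 1]\<close>)
  then show False using E0 \<open>\<delta> > 0\<close> by simp
qed

lemma adjoint_pair_mode_mean: "adjoint_pair T S \<Longrightarrow> adjoint_pair (mode_mean P \<nu> T N) (mode_mean P (- \<nu>) S N)"
  unfolding mode_mean_def
proof (rule adjoint_pair_cesaro)
  fix s assume "adjoint_pair T S"
  then have "adjoint_pair (sc (cis (- (\<nu> * s))) * (P s * T * P (- s)))
      ((P (- (- s)) * (S * P (- s))) * sc (cnj (cis (- (\<nu> * s)))))"
    by (intro adjoint_pair_mult adjoint_pair_sc adjoint_pair_P)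
  then show "adjoint_pair (sc (cis (- (\<nu> * s))) * (P s * T * P (- s)))
      (sc (cis (- (- \<nu> * s))) * (P s * S * P (- s)))"
    unfolding sc_commute[of "P (- (- s)) * (S * P (- s))"] by (simp add: cis_cnj mult.assoc)
qed

text \<open>If all modes of \<open>T\<close> vanish, then with \<open>S\<close> the adjoint of \<open>T\<close> the mean of \<open>S * R\<close> vanishes for every monomial \<open>R\<close>, as it is
  the adjoint of a mode of \<open>T\<close> times \<open>R\<close>; by approximation it vanishes for \<open>R = T\<close>, and the mean is faithful.\<close>

lemma mode_injective:
  assumes T: "T \<in> B" and E0: "\<And>\<nu>. mode P \<nu> T = 0"
  shows "T = 0"
proof -
  obtain S where S: "S \<in> B" "adjoint_pair T S"
    using wspan_adjoint[OF T, of UNIV UNIV] by auto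
  have ES: "mode_mean P \<nu> S \<longlonglongrightarrow> 0" for \<nu>
  proof (rule Lim_null_comparison)
    show "\<forall>\<^sub>F N in sequentially. norm (mode_mean P \<nu> S N) \<le> norm (mode_mean P (- \<nu>) T N)"
      using adjoint_pair_norm_le[OF adjoint_pair_mode_mean[OF S(2), of "- \<nu>"]] by simp
    show "(\<lambda>N. norm (mode_mean P (- \<nu>) T N)) \<longlonglongrightarrow> 0"
      using mode_mean_tendsto[OF T, of "- \<nu>"] E0 tendsto_norm_zero by force
  qed
  have "mode P 0 (S * R) = 0" if "R \<in> B" for R
    using that
  proof (induction rule: wspan_induct)
    case (monomial c a b)
    let ?R = "sc c * (P a * Q b)"
    have "sc (cis (- (0 * s))) * (P s * (S * ?R) * P (- s)) =
        sc (cis (- (- (\<sigma> * b) * s))) * (P s * S * P (- s)) * ?R" for s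
    proof -
      have "P s * (S * ?R) * P (- s) = P s * S * P (- s) * (P s * ?R * P (- s))"
        by (simp add: mult.assoc)
      also have "\<dots> = sc (cis (\<sigma> * b * s)) * (P s * S * P (- s)) * ?R"
        unfolding conj_monomial sc_left_commute[of "P s * S * P (- s)" "cis (\<sigma> * b * s)"] by (simp only: mult.assoc)
      finally show ?thesis by simp
    qed
    moreover have "linear (\<lambda>T. T * ?R)" by (rule linearI) (simp_all add: distrib_right)
    ultimately have "mode_mean P 0 (S * ?R) = (\<lambda>N. mode_mean P (- (\<sigma> * b)) S N * ?R)"
      unfolding mode_mean_def by (simp only: cesaro_linear[where f = "\<lambda>T. T * ?R"])
    moreover have "(\<lambda>N. mode_mean P (- (\<sigma> * b)) S N * ?R) \<longlonglongrightarrow> 0 * ?R"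
      by (intro tendsto_intros ES)
    ultimately show ?case by (intro mode_eqI) simp
  next
    case (add R R')
    then show ?case
      using wspan_mult[OF S(1), of _ UNIV UNIV UNIV UNIV] by (simp add: distrib_left mode_add)
  next
    case (limit Y R)
    have "(\<lambda>n. mode P 0 (S * Y n)) \<longlonglongrightarrow> mode P 0 (S * R)"
      using limit by (intro mode_limit wspan_mult[OF S(1)] tendsto_intros) auto
    then show ?case using limit by (simp add: LIMSEQ_const_iff)
  qed simp
  from this[OF T] have "(S * T \<star> v) \<bullet> v = 0" for v
  proof (rule mode_faithful[rotated 2])
    show "S * T \<in> B" by (rule wspan_mult[OF S(1) T]) auto
    show "0 \<le> (S * T \<star> w) \<bullet> w" for w
      using S(2) by (simp add: adjoint_pair_def inner_commute[of _ w]) (metis inner_ge_zero)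
  qed
  then have "(T \<star> v) \<bullet> (T \<star> v) = 0" for v
    using S(2) unfolding adjoint_pair_def by (metis app_mult inner_commute)
  then show ?thesis by (intro oper_eqI) simp
qed

end

section \<open>The expectation onto the analytic almost periodic operators\<close>

context weyl0 begin

text \<open>\<open>A\<close> is the parabolic algebra, \<open>H\<close> its subalgebra generated by the \<open>P a\<close>, \<open>K\<close> the closed ideal generated by
  the \<open>Q b\<close> with \<open>b > 0\<close>, and \<open>\<pi>\<close> will be the homomorphism of \<open>A\<close> onto \<open>H\<close> with kernel \<open>K\<close>.\<close>

abbreviation "A \<equiv> wspan P Q {0..} {0..}"
abbreviation "H \<equiv> wspan P Q {0..} {0}"
abbreviation "K \<equiv> wspan P Q {0..} {0<..}"
abbreviation "\<pi> \<equiv> mode P 0"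

lemma H_sub_A: "T \<in> H \<Longrightarrow> T \<in> A" and K_sub_A: "T \<in> K \<Longrightarrow> T \<in> A"
  by (rule subsetD[OF wspan_mono], auto)+

lemma A_mult: "S \<in> A \<Longrightarrow> T \<in> A \<Longrightarrow> S * T \<in> A"
  by (rule wspan_mult) auto

lemma H_mult: "S \<in> H \<Longrightarrow> T \<in> H \<Longrightarrow> S * T \<in> H"
  by (rule wspan_mult) auto

lemma pi_H: "T \<in> A \<Longrightarrow> \<pi> T \<in> H"
  using mode_in_wspan[of T "{0..}" "{0..}" 0] by simp

lemma pi_K: "T \<in> K \<Longrightarrow> \<pi> T = 0"
  using mode_eq_0[of T "{0..}" "{0<..}" 0] by simp

lemma pi_id: "T \<in> wspan P Q I {0} \<Longrightarrow> \<pi> T = T"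
  using mode_id[of T I 0] by simp

lemma pi_one [simp]: "\<pi> 1 = 1"
  using pi_id[of 1 "{0}"] P_in_wspan[of 0 "{0}" "{0}"] by simp

lemma pi_ker: "T \<in> A \<Longrightarrow> T - \<pi> T \<in> K"
proof (induction rule: wspan_induct)
  case (monomial c a b)
  then show ?case
    using mode_sigma_monomial[of 0 c a b] wspan_zero[of P Q] by (auto intro!: wspan_monomial)
next
  case (add S T)
  have eq: "S + T - \<pi> (S + T) = (S - \<pi> S) + (T - \<pi> T)"
    using add.hyps by (simp add: mode_add[OF sub_B sub_B])
  show ?case unfolding eq by (intro wspan_add add.IH)
next
  case (limit Y T)
  show ?case
    by (rule wspan_limit[of "\<lambda>n. Y n - \<pi> (Y n)", OF limit.IH])
      (intro tendsto_intros limit.hyps(2) mode_limit sub_B[OF limit.hyps(1)])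
qed (simp add: wspan_zero)

text \<open>Only the nonnegativity of the frequencies makes \<open>\<pi>\<close> multiplicative: it makes \<open>K\<close> an ideal.\<close>

lemma pi_mult:
  assumes "S \<in> A" "T \<in> A"
  shows "\<pi> (S * T) = \<pi> S * \<pi> T"
proof -
  have K: "S * (T - \<pi> T) \<in> K" "(S - \<pi> S) * \<pi> T \<in> K"
    by (rule wspan_mult[OF assms(1) pi_ker[OF assms(2)]], auto)
      (rule wspan_mult[OF pi_ker[OF assms(1)] pi_H[OF assms(2)]], auto)
  have H: "\<pi> S * \<pi> T \<in> H" by (intro H_mult pi_H assms)
  have "S * T = S * (T - \<pi> T) + ((S - \<pi> S) * \<pi> T + \<pi> S * \<pi> T)"
    by (simp add: algebra_simps)
  also have "\<pi> \<dots> = \<pi> S * \<pi> T"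
    using K H by (subst mode_add; simp add: sub_B wspan_add)+ (simp add: mode_add sub_B pi_K pi_id[OF H])
  finally show ?thesis .
qed

text \<open>The operator \<open>Y = 1 - F * S\<close> has nonnegative real part, because \<open>F * S\<close> is a contraction, and its mean is
  \<open>1 - F * f = 0\<close>.  By faithfulness \<open>(S \<star> v) \<bullet> (f \<star> v) = v \<bullet> v\<close>, which is the equality case of the
  Cauchy--Schwarz inequality for two vectors no longer than \<open>v\<close>.\<close>

lemma contraction_eq_expectation:
  assumes S: "S \<in> B" "norm S \<le> 1" and f: "\<pi> S = f" "F \<in> wspan P Q UNIV {0}" "adjoint_pair f F" "F * f = 1"
  shows "S = f"
proof -
  have "norm f \<le> 1" using norm_mode[OF S(1), of 0] S(2) f(1) by simp
  have le: "norm (T \<star> v) \<le> norm v" if "norm T \<le> 1" for T v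
    using norm_app[of T v] mult_right_mono[OF that, of "norm v"] by simp
  have FS: "(F * S \<star> v) \<bullet> v = (S \<star> v) \<bullet> (f \<star> v)" for v
    using f(3) by (simp add: adjoint_pair_def inner_commute)
  have FS_le: "(S \<star> v) \<bullet> (f \<star> v) \<le> v \<bullet> v" for v
  proof -
    have "(S \<star> v) \<bullet> (f \<star> v) \<le> norm (S \<star> v) * norm (f \<star> v)" by (rule norm_cauchy_schwarz)
    also have "\<dots> \<le> norm v * norm v"
      by (intro mult_mono le S \<open>norm f \<le> 1\<close>) auto
    finally show ?thesis by (simp add: power2_eq_square flip: power2_norm_eq_inner)
  qed
  have B: "1 \<in> B" using P_in_wspan[of 0 UNIV UNIV] by simp
  have FSB: "F * S \<in> B" by (rule wspan_mult[OF f(2) S(1)]) auto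
  have "((1 - F * S) \<star> v) \<bullet> v = 0" for v
  proof (rule mode_faithful)
    show "1 - F * S \<in> B" by (intro wspan_diff B FSB)
    show "0 \<le> ((1 - F * S) \<star> w) \<bullet> w" for w
      using FS_le[of w] FS[of w] by (simp add: app_diff inner_diff_left)
    show "\<pi> (1 - F * S) = 0"
      using f(1,4) by (simp add: mode_diff[OF B FSB] mode_left[OF commute_P[OF f(2)] S(1)])
  qed
  then have eq: "(S \<star> v) \<bullet> (f \<star> v) = v \<bullet> v" for v
    using FS[of v] by (simp add: app_diff inner_diff_left)
  have "(S \<star> v) - (f \<star> v) = 0" for v
  proof -
    have "(norm ((S \<star> v) - (f \<star> v)))\<^sup>2 = (norm (S \<star> v))\<^sup>2 + (norm (f \<star> v))\<^sup>2 - 2 * (v \<bullet> v)"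
      using eq[of v] by (simp add: power2_norm_eq_inner inner_diff inner_commute)
    also have "\<dots> \<le> (norm v)\<^sup>2 + (norm v)\<^sup>2 - 2 * (v \<bullet> v)"
      by (intro diff_right_mono add_mono power_mono le S \<open>norm f \<le> 1\<close>) auto
    also have "\<dots> = 0" by (simp add: power2_norm_eq_inner)
    finally show ?thesis by simp
  qed
  then show ?thesis by (intro oper_eqI) simp
qed

text \<open>Multiplying by \<open>P a\<close> with large \<open>a\<close> shifts any finite set of frequencies to the nonnegative ones.\<close>

lemma almost_analytic:
  assumes "h \<in> wspan P Q UNIV {0}" "e > 0"
  shows "\<exists>h' a0. norm (h - h') < e \<and> (\<forall>a\<ge>a0. P a * h' \<in> H)"
  using assms
proof (induction arbitrary: e rule: wspan_induct)
  case zero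
  then show ?case by (intro exI[of _ 0]) (simp add: wspan_zero)
next
  case (monomial c a b)
  have "P a' * (sc c * (P a * Q b)) \<in> H" if "a' \<ge> - a" for a'
  proof -
    have "P a' * (sc c * (P a * Q b)) = sc c * (P (a' + a) * Q 0)"
      using monomial by (simp add: weyl_simps P_add)
    then show ?thesis using that by (simp only:) (rule wspan_monomial, auto)
  qed
  then show ?case using monomial(3) by (intro exI[of _ "sc c * (P a * Q b)"]) auto
next
  case (add S T)
  obtain S' s T' t where "norm (S - S') < e / 2" "norm (T - T') < e / 2"
    and an: "\<And>a. a \<ge> s \<Longrightarrow> P a * S' \<in> H" "\<And>a. a \<ge> t \<Longrightarrow> P a * T' \<in> H"
    using add.IH[of "e/2"] add.prems by (metis half_gt_zero)
  then have "norm (S - S' + (T - T')) < e"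
    using norm_triangle_ineq[of "S - S'" "T - T'"] by linarith
  then have "norm (S + T - (S' + T')) < e" by (simp add: algebra_simps)
  moreover have "\<forall>a\<ge>max s t. P a * (S' + T') \<in> H"
    using an by (auto simp: distrib_left intro: wspan_add)
  ultimately show ?case by blast
next
  case (limit Y T)
  obtain n where n: "norm (Y n - T) < e / 2"
    using LIMSEQ_D[OF limit.hyps(2), of "e/2"] limit.prems by auto
  obtain h' a0 where h': "norm (Y n - h') < e / 2" "\<forall>a\<ge>a0. P a * h' \<in> H"
    using limit.IH[of "e/2" n] limit.prems by auto
  have "norm ((Y n - h') - (Y n - T)) < e"
    using norm_triangle_ineq4[of "Y n - h'" "Y n - T"] n h' by linarith
  then show ?case using h'(2) by (intro exI[of _ h'] exI[of _ a0]) simp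
qed

lemma isometric_multiplier_extends:
  assumes f: "f \<in> H" and iso: "\<And>h. h \<in> H \<Longrightarrow> norm (f * h) = norm h"
    and h: "h \<in> wspan P Q UNIV {0}"
  shows "norm (f * h) = norm h"
proof -
  have "norm f = 1" using iso[of 1] P_in_wspan[of 0 "{0..}" "{0}"] by simp
  have "\<bar>norm (f * h) - norm h\<bar> \<le> e" if e: "e > 0" for e
  proof -
    obtain h' a0 where h': "norm (h - h') < e / 2" "\<forall>a\<ge>a0. P a * h' \<in> H"
      using almost_analytic[OF h half_gt_zero[OF e]] by blast
    have "norm (f * h') = norm (P a0 * (f * h'))" by simp
    also have "P a0 * (f * h') = f * (P a0 * h')"
      using commute_P[OF f, of a0] by (simp flip: mult.assoc)
    also have "norm \<dots> = norm h'" using iso h'(2) by simp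
    finally have 1: "norm (f * h') = norm h'" .
    have "norm (f * h - f * h') \<le> norm (h - h')"
      unfolding right_diff_distrib[symmetric]
      using norm_mult_ineq[of f "h - h'"] \<open>norm f = 1\<close> by simp
    then show ?thesis
      using h'(1) 1 norm_triangle_ineq3[of "f * h" "f * h'"] norm_triangle_ineq3[of h h'] by linarith
  qed
  then have "\<bar>norm (f * h) - norm h\<bar> \<le> 0" by (rule field_le_epsilon) simp
  then show ?thesis by simp
qed

text \<open>With \<open>X = 1 - f\<^sup>* f\<close> and \<open>w = X \<star> v\<close> one has \<open>|f w|\<^sup>2 = |w|\<^sup>2 - (X w) \<bullet> w\<close>, and positivity of \<open>X\<close> gives
  \<open>(X w) \<bullet> w * |v|\<^sup>2 \<ge> |w|\<^sup>4\<close>.  So \<open>f * X\<close> has strictly smaller norm than \<open>X\<close> unless \<open>X = 0\<close>.  As \<open>X\<close> lies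
  outside \<open>H\<close>, the isometry property has to be extended to all frequencies before it can be applied to \<open>X\<close>.\<close>

lemma isometric_multiplier_unitary:
  assumes f: "f \<in> H" and iso: "\<And>h. h \<in> H \<Longrightarrow> norm (f * h) = norm h"
  obtains F where "F \<in> wspan P Q UNIV {0}" "adjoint_pair f F" "F * f = 1"
proof -
  obtain F where F: "F \<in> wspan P Q UNIV {0}" "adjoint_pair f F"
    using wspan_adjoint[OF f, of UNIV "{0}"] by auto
  define X where "X = 1 - F * f"
  have Ff: "F * f \<in> wspan P Q UNIV {0}" by (rule wspan_mult[OF F(1) f]) auto
  have X: "X \<in> wspan P Q UNIV {0}"
    unfolding X_def using P_in_wspan[of 0 UNIV "{0}"] Ff by (auto intro: wspan_diff)
  have "norm f = 1" using iso[of 1] P_in_wspan[of 0 "{0..}" "{0}"] by simp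
  have F': "(F \<star> v) \<bullet> w = v \<bullet> (f \<star> w)" for v w
    using F(2) by (metis adjoint_pair_def inner_commute)
  have Xi: "(X \<star> v) \<bullet> w = v \<bullet> w - (f \<star> v) \<bullet> (f \<star> w)" for v w
    by (simp add: X_def app_diff inner_diff_left F')
  have X0: "0 \<le> (X \<star> v) \<bullet> v" for v
  proof -
    have "(norm (f \<star> v))\<^sup>2 \<le> (norm v)\<^sup>2"
      using norm_app[of f v] \<open>norm f = 1\<close> by (intro power_mono) auto
    then show ?thesis unfolding Xi power2_norm_eq_inner by simp
  qed
  define k where "k = norm X"
  have "k = 0"
  proof (rule ccontr)
    assume "k \<noteq> 0"
    then have "k > 0" by (simp add: k_def)
    \<comment> \<open>A bound for \<open>t - t\<^sup>2\<close> on \<open>[0, k\<^sup>2]\<close> that is strictly below \<open>k\<^sup>2\<close>; here \<open>t = |w|\<^sup>2 / |v|\<^sup>2\<close>.\<close>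
    define c where "c = max (k\<^sup>2 / 2) (k\<^sup>2 - k\<^sup>2 * k\<^sup>2 / 4)"
    have c: "0 \<le> c" "c < k\<^sup>2" using \<open>k > 0\<close> by (auto simp: c_def le_max_iff_disj)
    have "norm (f * X) \<le> sqrt c"
    proof (rule norm_oper_bound)
      fix v
      define w where "w = X \<star> v"
      define m n u where "m = w \<bullet> w" and "n = v \<bullet> v" and "u = (X \<star> w) \<bullet> w"
      have m0: "0 \<le> m" and n0: "0 \<le> n" by (auto simp: m_def n_def)
      have mk: "m \<le> k\<^sup>2 * n"
      proof -
        have "(norm w)\<^sup>2 \<le> (k * norm v)\<^sup>2"
          unfolding w_def k_def by (intro power_mono norm_app) auto
        then show ?thesis by (simp add: m_def n_def power_mult_distrib power2_norm_eq_inner)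
      qed
      have fw: "(f \<star> w) \<bullet> (f \<star> w) = m - u" by (simp add: u_def m_def Xi)
      have quad: "0 \<le> n - 2 * t * m + t\<^sup>2 * u" for t
      proof -
        have "(X \<star> (v - t *\<^sub>R w)) \<bullet> (v - t *\<^sub>R w) =
            (X \<star> v) \<bullet> v - 2 * t * m + t\<^sup>2 * u"
          using Xi[of v w] Xi[of w v]
          by (simp add: app_diff_right app_scaleR_right inner_diff_left inner_diff_right u_def m_def
              w_def[symmetric] power2_eq_square algebra_simps inner_commute)
        moreover have "(X \<star> v) \<bullet> v \<le> n" by (simp add: Xi n_def)
        ultimately show ?thesis using X0[of "v - t *\<^sub>R w"] by linarith
      qed
      have "m - u \<le> c * n"
      proof (cases "n = 0 \<or> m = 0")
        case True
        then have "m = 0" using mk m0 by auto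
        moreover have "0 \<le> u" using X0[of w] by (simp add: u_def)
        moreover have "0 \<le> c * n" using c(1) n0 by simp
        ultimately show ?thesis by linarith
      next
        case False
        then have "m > 0" "n > 0" using m0 n0 by auto
        define t where "t = m / n"
        \<comment> \<open>This choice of the parameter is the minimum of the quadratic when \<open>n * u = m\<^sup>2\<close>.\<close>
        have "0 \<le> n - 2 * (n / m) * m + (n / m)\<^sup>2 * u" by (rule quad)
        then have "n \<le> (n / m)\<^sup>2 * u" using \<open>m > 0\<close> by simp
        then have "m * m \<le> n * u"
          using \<open>m > 0\<close> \<open>n > 0\<close> by (simp add: power2_eq_square field_simps)
        then have "t * t * n \<le> u"
          using \<open>n > 0\<close> by (simp add: t_def field_simps)
        then have "m - u \<le> (t - t * t) * n"
          using \<open>n > 0\<close> by (simp add: t_def left_diff_distrib)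
        moreover have "t - t * t \<le> c"
        proof (cases "t \<le> k\<^sup>2 / 2")
          case True
          moreover have "0 \<le> t * t" by simp
          ultimately show ?thesis unfolding c_def by linarith
        next
          case False
          have "t \<le> k\<^sup>2" using mk \<open>n > 0\<close> by (simp add: t_def field_simps)
          moreover have "k\<^sup>2 / 2 * (k\<^sup>2 / 2) \<le> t * t"
            using False \<open>m > 0\<close> \<open>n > 0\<close> by (intro mult_mono) (auto simp: t_def)
          ultimately show ?thesis unfolding c_def by (auto simp: max_def)
        qed
        ultimately show ?thesis
          using mult_right_mono[of "t - t * t" c n] \<open>n > 0\<close> by linarith
      qed
      then have "(norm (f * X \<star> v))\<^sup>2 \<le> c * (norm v)\<^sup>2"
        by (simp add: power2_norm_eq_inner fw n_def flip: w_def)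
      then have "sqrt ((norm (f * X \<star> v))\<^sup>2) \<le> sqrt (c * (norm v)\<^sup>2)"
        by (rule real_sqrt_le_mono)
      then show "norm (f * X \<star> v) \<le> sqrt c * norm v"
        by (simp add: real_sqrt_mult)
    qed (use c in simp)
    also have "sqrt c < sqrt (k\<^sup>2)" by (rule real_sqrt_less_mono[OF c(2)])
    also have "sqrt (k\<^sup>2) = norm X" by (simp add: k_def)
    finally show False using isometric_multiplier_extends[OF f iso X] by simp
  qed
  then have "F * f = 1" by (simp add: k_def X_def)
  with F that show ?thesis by blast
qed

end

section \<open>Analytic almost periodic operators form an integral domain\<close>

text \<open>An exponential polynomial in the \<open>P a\<close>, together with the entire function obtained by replacing \<open>P a\<close>
  with \<open>z \<mapsto> exp (\<i> a z)\<close>.  It is a relation because the operator alone is not a syntactic object from which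
  the function could be read off.\<close>

inductive exp_poly :: "(real \<Rightarrow> oper) \<Rightarrow> oper \<Rightarrow> (complex \<Rightarrow> complex) \<Rightarrow> bool" for P where
  monomial: "0 \<le> a \<Longrightarrow> exp_poly P (sc c * P a) (\<lambda>z. c * exp (\<i> * of_real a * z))"
| add: "exp_poly P S F \<Longrightarrow> exp_poly P T G \<Longrightarrow> exp_poly P (S + T) (\<lambda>z. F z + G z)"

lemma exp_poly_scale: "exp_poly P T F \<Longrightarrow> exp_poly P (sc c * T) (\<lambda>z. c * F z)"
proof (induction rule: exp_poly.induct)
  case (monomial a d)
  then show ?case using exp_poly.monomial[of a P "c * d"] by (simp add: sc_mult mult.assoc)
next
  case (add S F T G)
  then show ?case using exp_poly.add[OF add.IH] by (simp add: distrib_left)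
qed

lemma exp_poly_diff: "exp_poly P S F \<Longrightarrow> exp_poly P T G \<Longrightarrow> exp_poly P (S - T) (\<lambda>z. F z - G z)"
  using exp_poly.add[OF _ exp_poly_scale[of P T G "-1"]] by (fastforce simp: sc_minus)

lemma exp_poly_holomorphic: "exp_poly P T F \<Longrightarrow> F holomorphic_on U"
  by (induction rule: exp_poly.induct) (auto intro!: holomorphic_intros)

lemma exp_poly_bounded: "exp_poly P T F \<Longrightarrow> \<exists>C. \<forall>z. 0 \<le> Im z \<longrightarrow> cmod (F z) \<le> C"
proof (induction rule: exp_poly.induct)
  case (monomial a c)
  have "cmod (c * exp (\<i> * of_real a * z)) \<le> cmod c" if "0 \<le> Im z" for z
    using monomial that by (simp add: norm_mult mult_left_le)
  then show ?case by blast
next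
  case (add S F T G)
  then obtain C D where "\<forall>z. 0 \<le> Im z \<longrightarrow> cmod (F z) \<le> C" "\<forall>z. 0 \<le> Im z \<longrightarrow> cmod (G z) \<le> D"
    by blast
  then have "\<forall>z. 0 \<le> Im z \<longrightarrow> cmod (F z + G z) \<le> C + D"
    by (meson norm_triangle_mono)
  then show ?case by blast
qed

text \<open>The Phragmen--Lindelof principle for bounded functions.  Dividing by \<open>1 - \<i> e z\<close>, whose modulus is at
  least \<open>1\<close> on the half plane and grows at infinity, makes the maximum modulus principle applicable on a large half
  disc; then \<open>e\<close> tends to \<open>0\<close>.\<close>

lemma bounded_half_plane_max:
  fixes F :: "complex \<Rightarrow> complex"
  assumes holo: "F holomorphic_on UNIV" and C: "\<And>z. 0 \<le> Im z \<Longrightarrow> cmod (F z) \<le> C"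
    and real: "\<And>x. cmod (F (of_real x)) \<le> k" and z: "0 \<le> Im z"
  shows "cmod (F z) \<le> k"
proof -
  have k0: "0 \<le> k" using real[of 0] norm_ge_zero order_trans by blast
  have bound: "cmod (F z) \<le> (k + d) * cmod (1 - \<i> * of_real e * z)" if "e > 0" "d > 0" for e d
  proof (cases "Im z = 0")
    case True
    then have "z = of_real (Re z)" by (simp add: complex_eq_iff)
    then have "cmod (F z) \<le> k" using real[of "Re z"] by simp
    moreover have "1 \<le> cmod (1 - \<i> * of_real e * z)"
      using complex_Re_le_cmod[of "1 - \<i> * of_real e * z"] True by simp
    ultimately show ?thesis
      using mult_mono[of k "k + d" 1 "cmod (1 - \<i> * of_real e * z)"] k0 that by linarith
  next
    case False
    with z have "Im z > 0" by simp
    have ge1: "1 \<le> cmod (1 - \<i> * of_real e * w)" if "0 \<le> Im w" for w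
    proof -
      have "1 \<le> Re (1 - \<i> * of_real e * w)" using that \<open>e > 0\<close> by simp
      then show ?thesis using complex_Re_le_cmod order_trans by blast
    qed
    \<comment> \<open>Large enough for the quotient to be at most \<open>d\<close> on the arc.\<close>
    define R where "R = max (cmod z + 1) ((C / d + 1) / e)"
    have R: "cmod z < R" "C / d + 1 \<le> e * R" "R > 0"
    proof -
      show "cmod z < R" by (simp add: R_def max_def)
      then show "R > 0" using norm_ge_zero[of z] by linarith
      have "(C / d + 1) / e \<le> R" by (simp add: R_def)
      then show "C / d + 1 \<le> e * R" using \<open>e > 0\<close> by (simp add: field_simps)
    qed
    define S where "S = {w. 0 < Im w} \<inter> ball 0 R"
    define G where "G w = F w / (1 - \<i> * of_real e * w)" for w
    have clS: "closure S \<subseteq> {w. 0 \<le> Im w} \<inter> cball 0 R"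
      unfolding S_def by (intro closure_minimal)
        (auto simp: closed_halfspace_Im_ge intro!: closed_Int)
    have ne: "1 - \<i> * of_real e * w \<noteq> 0" if "0 \<le> Im w" for w
      using ge1[OF that] by auto
    have "cmod (G z) \<le> k + d"
    proof (rule maximum_modulus_frontier[where S = S and f = G])
      have "G holomorphic_on {w. 0 \<le> Im w}"
        unfolding G_def[abs_def] using ne
        by (intro holomorphic_intros holomorphic_on_subset[OF holo]) auto
      then show "G holomorphic_on interior S" "continuous_on (closure S) G"
        using clS interior_subset[of S]
        by (auto simp: S_def intro!: holomorphic_on_imp_continuous_on
            elim!: holomorphic_on_subset continuous_on_subset)
      show "bounded S" unfolding S_def by auto
      show "z \<in> S" using \<open>Im z > 0\<close> R by (simp add: S_def)
      fix w assume "w \<in> frontier S"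
      moreover have "open S" unfolding S_def by (intro open_Int open_halfspace_Im_gt open_ball)
      ultimately have w: "w \<in> closure S" "w \<notin> S" by (auto simp: frontier_def interior_open)
      then have w': "0 \<le> Im w" "cmod w \<le> R" "Im w = 0 \<or> cmod w = R"
        using clS by (auto simp: S_def)
      show "cmod (G w) \<le> k + d"
      proof (cases "Im w = 0")
        case True
        then have "w = of_real (Re w)" by (simp add: complex_eq_iff)
        then have "cmod (F w) \<le> k" using real[of "Re w"] by simp
        moreover have "cmod (G w) \<le> cmod (F w)"
          using ge1[OF w'(1)] by (simp add: G_def norm_divide divide_le_eq mult_le_cancel_left1)
        ultimately show ?thesis using \<open>d > 0\<close> by linarith
      next
        case False
        then have "cmod w = R" using w' by simp
        have "e * R - 1 \<le> cmod (1 - \<i> * of_real e * w)"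
          using norm_triangle_ineq2[of "\<i> * of_real e * w" 1] \<open>e > 0\<close> \<open>cmod w = R\<close>
          by (simp add: norm_mult norm_minus_commute)
        then have "C / d \<le> cmod (1 - \<i> * of_real e * w)" using R by linarith
        then have "C \<le> d * cmod (1 - \<i> * of_real e * w)"
          using \<open>d > 0\<close> by (simp add: field_simps)
        then have "cmod (F w) \<le> d * cmod (1 - \<i> * of_real e * w)"
          using C[OF w'(1)] by linarith
        then have "cmod (G w) \<le> d"
          using ge1[OF w'(1)] \<open>d > 0\<close> by (simp add: G_def norm_divide divide_le_eq)
        then show ?thesis using k0 by simp
      qed
    qed
    then show ?thesis using ge1[OF z] ne[OF z] by (simp add: G_def norm_divide divide_le_eq)
  qed
  have "((\<lambda>e. (k + e) * cmod (1 - \<i> * of_real e * z)) \<longlongrightarrow> (k + 0) * cmod (1 - \<i> * of_real 0 * z)) (at_right 0)"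
    by (intro tendsto_intros)
  then have "cmod (F z) \<le> (k + 0) * cmod (1 - \<i> * of_real 0 * z)"
    by (rule tendsto_lowerbound)
      (auto simp: eventually_at_right_field intro!: exI[of _ 1] bound)
  then show ?thesis by simp
qed

text \<open>Approximate joint eigenvectors of the \<open>P a\<close> at the eigenvalue \<open>1\<close>; translating them by \<open>Q\<close> gives every
  other point of the spectrum, so that the norm of an operator in \<open>H\<close> dominates its symbol.\<close>

locale weyl = weyl0 +
  assumes approximate_eigenvector: "\<exists>u. \<forall>n. norm (u n :: l2r) = 1 \<and> (\<forall>a. (\<lambda>n. (P a \<star> u n) - u n) \<longlonglongrightarrow> 0)"
begin

lemma exp_poly_real_bound:
  assumes "exp_poly P T F"
  shows "cmod (F (of_real x)) \<le> norm T"
proof -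
  obtain u where u: "\<And>n. norm (u n :: l2r) = 1" "\<And>a. (\<lambda>n. (P a \<star> u n) - u n) \<longlonglongrightarrow> 0"
    using approximate_eigenvector by blast
  define w where "w n = Q (\<sigma> * x) \<star> u n" for n
  have Qn: "norm (Q b \<star> v) = norm v" for b v
    by (rule weyl0.norm_P_app[OF swap])
  have "(\<lambda>n. (T \<star> w n) - scaleC (F (of_real x)) (w n)) \<longlonglongrightarrow> 0"
    using assms
  proof (induction rule: exp_poly.induct)
    case (monomial a c)
    have "((sc c * P a) \<star> w n) - scaleC (c * exp (\<i> * of_real a * of_real x)) (w n) =
        sc (c * cis (a * x)) * Q (\<sigma> * x) \<star> ((P a \<star> u n) - u n)" for n
    proof -
      have "P a * Q (\<sigma> * x) = sc (cis (a * x)) * (Q (\<sigma> * x) * P a)"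
        using P_mult_Q[of a "\<sigma> * x"] \<sigma> by (simp add: algebra_simps) (simp add: mult.assoc[symmetric])
      then have "P a \<star> Q (\<sigma> * x) \<star> u n = scaleC (cis (a * x)) (Q (\<sigma> * x) \<star> P a \<star> u n)"
        by (metis app_mult sc_app)
      moreover have "exp (\<i> * of_real a * of_real x) = cis (a * x)"
        by (simp add: cis_conv_exp mult.assoc)
      ultimately show ?thesis
        unfolding w_def by (simp add: app_diff_right scaleC_scaleC del: of_real_mult)
    qed
    moreover have "(\<lambda>n. sc (c * cis (a * x)) * Q (\<sigma> * x) \<star> ((P a \<star> u n) - u n)) \<longlonglongrightarrow> 0"
    proof (rule tendsto_norm_zero_cancel)
      have "(\<lambda>n. cmod c * norm ((P a \<star> u n) - u n)) \<longlonglongrightarrow> cmod c * norm (0::l2r)"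
        by (intro tendsto_intros u)
      then show "(\<lambda>n. norm (sc (c * cis (a * x)) * Q (\<sigma> * x) \<star> ((P a \<star> u n) - u n))) \<longlonglongrightarrow> 0"
        by (simp add: norm_scaleC Qn norm_mult)
    qed
    ultimately show ?case by simp
  next
    case (add S F T G)
    then show ?case
      using tendsto_add[OF add.IH] by (simp add: app_add scaleC_add_left algebra_simps)
  qed
  then have "(\<lambda>n. norm T + norm ((T \<star> w n) - scaleC (F (of_real x)) (w n))) \<longlonglongrightarrow> norm T + norm (0::l2r)"
    by (intro tendsto_intros)
  moreover have "cmod (F (of_real x)) \<le> norm T + norm ((T \<star> w n) - scaleC (F (of_real x)) (w n))" for n
  proof -
    have "norm (w n) = 1" by (simp add: w_def Qn u)
    then have "cmod (F (of_real x)) = norm (scaleC (F (of_real x)) (w n))" by (simp add: norm_scaleC)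
    also have "\<dots> \<le> norm (T \<star> w n) + norm ((T \<star> w n) - scaleC (F (of_real x)) (w n))"
      by (metis norm_minus_commute norm_triangle_sub)
    also have "norm (T \<star> w n) \<le> norm T" using norm_app[of T "w n"] \<open>norm (w n) = 1\<close> by simp
    finally show ?thesis by simp
  qed
  ultimately show ?thesis by (intro LIMSEQ_le_const) auto
qed

lemma exp_poly_bound:
  assumes "exp_poly P T F" "0 \<le> Im z"
  shows "cmod (F z) \<le> norm T"
proof -
  obtain C where "\<And>z. 0 \<le> Im z \<Longrightarrow> cmod (F z) \<le> C"
    using exp_poly_bounded[OF assms(1)] by blast
  from bounded_half_plane_max[OF exp_poly_holomorphic[OF assms(1)] this exp_poly_real_bound[OF assms(1)] assms(2)]
  show ?thesis .
qed

lemma exp_poly_mult: "exp_poly P S F \<Longrightarrow> exp_poly P T G \<Longrightarrow> exp_poly P (S * T) (\<lambda>z. F z * G z)"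
proof (induction rule: exp_poly.induct)
  case (monomial a c)
  from monomial(2) show ?case
  proof (induction rule: exp_poly.induct)
    case (monomial b d)
    have "exp_poly P (sc (c * d) * P (a + b)) (\<lambda>z. (c * d) * exp (\<i> * of_real (a + b) * z))"
      using monomial \<open>0 \<le> a\<close> by (intro exp_poly.monomial) auto
    moreover have "sc (c * d) * P (a + b) = sc c * P a * (sc d * P b)"
      by (simp add: weyl_simps P_add)
    ultimately show ?case by (simp add: exp_add algebra_simps)
  next
    case (add S F T G)
    then show ?case using exp_poly.add[OF add.IH] by (simp add: algebra_simps)
  qed
next
  case (add S F S' F')
  then show ?case using exp_poly.add[OF add.IH(1)[OF add.prems] add.IH(2)[OF add.prems]]
    by (simp add: algebra_simps)
qed

lemma exp_poly_approx:
  assumes "T \<in> H"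
  shows "\<exists>X F. (\<forall>n. exp_poly P (X n) (F n)) \<and> X \<longlonglongrightarrow> T"
proof -
  have "\<exists>S F. exp_poly P S F \<and> norm (S - T) < e" if "e > 0" for e
    using assms that
  proof (induction arbitrary: e rule: wspan_induct)
    case zero
    then show ?case using exp_poly.monomial[of 0 P 0] by force
  next
    case (monomial c a b)
    then show ?case using exp_poly.monomial[of a P c] by force
  next
    case (add S T)
    obtain S' F T' G where "exp_poly P S' F" "norm (S' - S) < e / 2" "exp_poly P T' G" "norm (T' - T) < e / 2"
      using add.IH[of "e / 2"] add.prems by (metis half_gt_zero)
    moreover from this have "norm ((S' - S) + (T' - T)) < e"
      using norm_triangle_ineq[of "S' - S" "T' - T"] by linarith
    ultimately show ?case using exp_poly.add by (metis add_diff_add)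
  next
    case (limit Y T)
    obtain n where n: "norm (Y n - T) < e / 2"
      using LIMSEQ_D[OF limit.hyps(2), of "e/2"] limit.prems by auto
    obtain S F where S: "exp_poly P S F" "norm (S - Y n) < e / 2"
      using limit.IH[of "e / 2" n] limit.prems by (metis half_gt_zero)
    have "norm ((S - Y n) + (Y n - T)) < e"
      using norm_triangle_ineq[of "S - Y n" "Y n - T"] n S by linarith
    then show ?case using S(1) by auto
  qed
  then have "\<exists>S F. exp_poly P S F \<and> norm (S - T) < inverse (real (Suc n))" for n by simp
  then obtain X F where XF: "\<And>n. exp_poly P (X n) (F n)" "\<And>n. norm (X n - T) < inverse (real (Suc n))"
    by metis
  have "(\<lambda>n. X n - T) \<longlonglongrightarrow> 0"
    by (rule Lim_null_comparison[OF _ LIMSEQ_inverse_real_of_nat])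
      (intro always_eventually allI less_imp_le XF(2))
  then show ?thesis using XF(1) by (auto simp: LIM_zero_iff)
qed

text \<open>The coefficient of \<open>P s\<close> can be computed from the operator and from the values of the function on the line
  \<open>Im z = 1\<close>.  This is what makes the passage from operators to functions injective in the limit.\<close>

lemma exp_poly_coefficient:
  "exp_poly P T F \<Longrightarrow> \<exists>c. mode_mean Q (- \<sigma> * s) T \<longlonglongrightarrow> sc c * P s \<and>
    cesaro (\<lambda>x. cis (- (s * x)) * F (Complex x 1)) \<longlonglongrightarrow> c * of_real (exp (- s))"
proof (induction rule: exp_poly.induct)
  case (monomial a c)
  have \<sigma>0: "\<sigma> \<noteq> 0" using \<sigma> by auto
  interpret sw: weyl0 Q P "- \<sigma>" by (rule swap)
  define d where "d = (if a = s then c else 0)"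
  have "mode_mean Q (- \<sigma> * s) (sc c * P a) \<longlonglongrightarrow> sc d * P s"
    using sw.mode_mean_monomial_tendsto[of "- \<sigma> * s" c 0 a] \<sigma>0 by (auto simp: d_def split: if_splits)
  moreover have "cesaro (\<lambda>x. cis (- (s * x)) * (c * exp (\<i> * of_real a * Complex x 1))) \<longlonglongrightarrow> d * of_real (exp (- s))"
  proof -
    have "cis (- (s * x)) * (c * exp (\<i> * of_real a * Complex x 1)) =
        c * of_real (exp (- a)) * cis ((a - s) * x)" for x
    proof -
      have 1: "exp (\<i> * of_real a * Complex x 1) = of_real (exp (- a)) * cis (a * x)"
        by (subst exp_eq_polar) simp
      have 2: "cis (- (s * x)) * cis (a * x) = cis ((a - s) * x)"
        unfolding cis_mult by (simp add: left_diff_distrib)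
      show ?thesis unfolding 1 2[symmetric] by (simp only: mult_ac)
    qed
    moreover have "linear (\<lambda>z. c * of_real (exp (- a)) * z)"
      by (rule linearI) (simp_all add: algebra_simps)
    ultimately have eq: "cesaro (\<lambda>x. cis (- (s * x)) * (c * exp (\<i> * of_real a * Complex x 1))) =
        (\<lambda>N. c * of_real (exp (- a)) * cesaro (\<lambda>x. cis ((a - s) * x)) N)"
      by (simp only: cesaro_linear[where f = "\<lambda>z. c * of_real (exp (- a)) * z"])
    show ?thesis
    proof (cases "a = s")
      case True
      have "cesaro (\<lambda>x. cis ((a - s) * x)) N = 1" if "N \<ge> 1" for N
        using that by (simp add: True cesaro_const)
      then have "cesaro (\<lambda>x. cis ((a - s) * x)) \<longlonglongrightarrow> 1"
        by (intro tendsto_eventually eventually_sequentiallyI[of 1])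
      then have "(\<lambda>N. c * of_real (exp (- a)) * cesaro (\<lambda>x. cis ((a - s) * x)) N) \<longlonglongrightarrow>
          c * of_real (exp (- a)) * 1" by (intro tendsto_intros)
      then show ?thesis unfolding eq by (simp add: d_def True exp_of_real)
    next
      case False
      then have "(\<lambda>N. c * of_real (exp (- a)) * cesaro (\<lambda>x. cis ((a - s) * x)) N) \<longlonglongrightarrow>
          c * of_real (exp (- a)) * 0" by (intro tendsto_intros cesaro_cis) auto
      then show ?thesis unfolding eq by (simp add: d_def False)
    qed
  qed
  ultimately show ?case by blast
next
  case (add S F T G)
  interpret sw: weyl0 Q P "- \<sigma>" by (rule swap)
  obtain c d where c: "mode_mean Q (- \<sigma> * s) S \<longlonglongrightarrow> sc c * P s"
      "cesaro (\<lambda>x. cis (- (s * x)) * F (Complex x 1)) \<longlonglongrightarrow> c * of_real (exp (- s))"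
    and d: "mode_mean Q (- \<sigma> * s) T \<longlonglongrightarrow> sc d * P s"
      "cesaro (\<lambda>x. cis (- (s * x)) * G (Complex x 1)) \<longlonglongrightarrow> d * of_real (exp (- s))"
    using add.IH by blast
  have "mode_mean Q (- \<sigma> * s) (S + T) \<longlonglongrightarrow> sc (c + d) * P s"
    using tendsto_add[OF c(1) d(1)] by (simp add: sw.mode_mean_add[abs_def] sc_add distrib_right)
  moreover have "cesaro (\<lambda>x. cis (- (s * x)) * (F (Complex x 1) + G (Complex x 1))) \<longlonglongrightarrow>
      (c + d) * of_real (exp (- s))"
  proof -
    have eq: "cesaro (\<lambda>x. cis (- (s * x)) * (F (Complex x 1) + G (Complex x 1))) =
      (\<lambda>N. cesaro (\<lambda>x. cis (- (s * x)) * F (Complex x 1)) N + cesaro (\<lambda>x. cis (- (s * x)) * G (Complex x 1)) N)"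
      by (rule ext) (simp add: distrib_left cesaro_add)
    show ?thesis
      unfolding eq using tendsto_add[OF c(2) d(2)] by (simp add: distrib_right)
  qed
  ultimately show ?case by blast
qed

text \<open>A limit of exponential polynomials has a holomorphic symbol in the open half plane; if the symbol
  vanishes, the coefficients tend to zero, so all modes of the limit vanish.\<close>

lemma exp_poly_limit:
  assumes X: "\<And>n. exp_poly P (X n) (F n)" "X \<longlonglongrightarrow> T"
  obtains f where "f holomorphic_on {z. 0 < Im z}"
    "uniform_limit {z. 0 < Im z} F f sequentially"
    "(\<forall>z. 0 < Im z \<longrightarrow> f z = 0) \<longrightarrow> T = 0"
proof -
  let ?U = "{z. 0 < Im z}"
  have "uniformly_Cauchy_on ?U F"
    unfolding uniformly_Cauchy_on_def
  proof (intro allI impI)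
    fix e :: real assume "e > 0"
    moreover have "Cauchy X" using X(2) LIMSEQ_imp_Cauchy by blast
    ultimately obtain M where M: "\<And>m n. m \<ge> M \<Longrightarrow> n \<ge> M \<Longrightarrow> norm (X m - X n) < e"
      by (meson CauchyD)
    have "dist (F m z) (F n z) < e" if "z \<in> ?U" "m \<ge> M" "n \<ge> M" for z m n
      using exp_poly_bound[OF exp_poly_diff[OF X(1)[of m] X(1)[of n]], of z] M[OF that(2,3)] that(1)
      by (simp add: dist_norm)
    then show "\<exists>M. \<forall>x\<in>?U. \<forall>m\<ge>M. \<forall>n\<ge>M. dist (F m x) (F n x) < e" by blast
  qed
  then obtain f where f: "uniform_limit ?U F f sequentially"
    using Cauchy_uniformly_convergent by (auto simp: uniformly_convergent_on_def)
  have "f holomorphic_on ?U"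
  proof (rule holomorphic_uniform_sequence[OF open_halfspace_Im_gt])
    show "F n holomorphic_on ?U" for n by (rule exp_poly_holomorphic[OF X(1)])
    fix x assume "x \<in> ?U"
    then obtain d where "d > 0" "cball x d \<subseteq> ?U"
      using open_contains_cball[of ?U] open_halfspace_Im_gt by blast
    then show "\<exists>d>0. cball x d \<subseteq> ?U \<and> uniform_limit (cball x d) F f sequentially"
      using uniform_limit_on_subset[OF f] by blast
  qed
  moreover have "T = 0" if f0: "\<forall>z. 0 < Im z \<longrightarrow> f z = 0"
  proof -
    interpret sw: weyl0 Q P "- \<sigma>" by (rule swap)
    have XH: "X n \<in> sw.B" for n
    proof -
      have "exp_poly P S G \<Longrightarrow> S \<in> B" for S G
        by (induction rule: exp_poly.induct)
          (auto intro: wspan_add wspan_sc P_in_wspan)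
      then show ?thesis unfolding wspan_swap using X(1) by blast
    qed
    have TB: "T \<in> sw.B" by (rule wspan_limit[OF XH X(2)])
    show ?thesis
    proof (rule sw.mode_injective[OF TB])
      fix \<nu>
      define s where "s = - \<sigma> * \<nu>"
      have \<nu>: "\<nu> = - \<sigma> * s" using \<sigma> by (simp add: s_def flip: mult.assoc)
      have "\<forall>n. \<exists>c. mode_mean Q (- \<sigma> * s) (X n) \<longlonglongrightarrow> sc c * P s \<and>
        cesaro (\<lambda>x. cis (- (s * x)) * F n (Complex x 1)) \<longlonglongrightarrow> c * of_real (exp (- s))"
        using exp_poly_coefficient[OF X(1)] by blast
      then obtain c where c: "\<And>n. mode_mean Q (- \<sigma> * s) (X n) \<longlonglongrightarrow> sc (c n) * P s"
        "\<And>n. cesaro (\<lambda>x. cis (- (s * x)) * F n (Complex x 1)) \<longlonglongrightarrow> c n * of_real (exp (- s))"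
        by metis
      have ev: "mode Q \<nu> (X n) = sc (c n) * P s" for n
        unfolding \<nu> by (rule sw.mode_eqI) (rule c)
      have "(\<lambda>n. sc (c n) * P s) \<longlonglongrightarrow> 0"
      proof (rule LIMSEQ_I)
        fix r :: real assume "r > 0"
        define e where "e = r * exp (- s) / 2"
        have "e > 0" using \<open>r > 0\<close> by (simp add: e_def)
        then obtain M where M: "\<And>n z. n \<ge> M \<Longrightarrow> 0 < Im z \<Longrightarrow> dist (F n z) (f z) < e"
          using f unfolding uniform_limit_iff eventually_sequentially by blast
        have "norm (sc (c n) * P s - 0) < r" if "n \<ge> M" for n
        proof -
          have "norm (cesaro (\<lambda>x. cis (- (s * x)) * F n (Complex x 1)) N) \<le> e" for N
            using M[OF that] f0 \<open>e > 0\<close> by (intro norm_cesaro) (auto simp: norm_mult less_imp_le)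
          then have "norm (c n * of_real (exp (- s))) \<le> e"
            using LIMSEQ_le_const2[OF tendsto_norm[OF c(2)[of n]]] by blast
          then have "cmod (c n) * exp (- s) \<le> r / 2 * exp (- s)"
            by (simp add: norm_mult e_def)
          then have "cmod (c n) \<le> r / 2" by (simp only: mult_le_cancel_right_pos exp_gt_zero)
          then show ?thesis using \<open>r > 0\<close> by simp
        qed
        then show "\<exists>M. \<forall>n\<ge>M. norm (sc (c n) * P s - 0) < r" by blast
      qed
      moreover have "(\<lambda>n. sc (c n) * P s) \<longlonglongrightarrow> mode Q \<nu> T"
        using sw.mode_limit[OF XH X(2), of \<nu>] by (simp add: ev)
      ultimately show "mode Q \<nu> T = 0" by (rule LIMSEQ_unique[THEN sym])
    qed
  qed
  ultimately show ?thesis using that f by blast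
qed

theorem H_domain:
  assumes g: "g \<in> H" and h: "h \<in> H" and gh: "g * h = 0"
  shows "g = 0 \<or> h = 0"
proof -
  let ?U = "{z. 0 < Im z}"
  obtain X F Y G where X: "\<And>n. exp_poly P (X n) (F n)" "X \<longlonglongrightarrow> g"
    and Y: "\<And>n. exp_poly P (Y n) (G n)" "Y \<longlonglongrightarrow> h"
    using exp_poly_approx[OF g] exp_poly_approx[OF h] by blast
  obtain f where f: "f holomorphic_on ?U" "uniform_limit ?U F f sequentially"
    "(\<forall>z. 0 < Im z \<longrightarrow> f z = 0) \<longrightarrow> g = 0"
    using exp_poly_limit[OF X] .
  obtain k where k: "k holomorphic_on ?U" "uniform_limit ?U G k sequentially"
    "(\<forall>z. 0 < Im z \<longrightarrow> k z = 0) \<longrightarrow> h = 0"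
    using exp_poly_limit[OF Y] .
  have fk: "f z * k z = 0" if "0 < Im z" for z
  proof -
    have "(\<lambda>n. F n z * G n z) \<longlonglongrightarrow> f z * k z"
      using that by (intro tendsto_intros tendsto_uniform_limitI[OF f(2)] tendsto_uniform_limitI[OF k(2)]) auto
    moreover have "(\<lambda>n. F n z * G n z) \<longlonglongrightarrow> 0"
    proof (rule Lim_null_comparison)
      show "\<forall>\<^sub>F n in sequentially. norm (F n z * G n z) \<le> norm (X n * Y n)"
        using exp_poly_bound[OF exp_poly_mult[OF X(1) Y(1)]] that by auto
      have "(\<lambda>n. X n * Y n) \<longlonglongrightarrow> g * h" by (intro tendsto_intros X Y)
      then show "(\<lambda>n. norm (X n * Y n)) \<longlonglongrightarrow> 0" using gh tendsto_norm_zero by force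
    qed
    ultimately show ?thesis by (rule LIMSEQ_unique)
  qed
  show ?thesis
  proof (cases "\<forall>z. 0 < Im z \<longrightarrow> f z = 0")
    case True
    then show ?thesis using f(3) by blast
  next
    case False
    then obtain z0 where z0: "0 < Im z0" "f z0 \<noteq> 0" by blast
    define V where "V = ?U \<inter> f -` (- {0})"
    have V: "open V" "V \<noteq> {}" "V \<subseteq> ?U"
      unfolding V_def using z0
      by (auto intro!: continuous_open_preimage[OF holomorphic_on_imp_continuous_on[OF f(1)] open_halfspace_Im_gt])
    have U: "open ?U" "connected ?U" "?U \<noteq> {}"
      using z0 by (auto intro: convex_connected convex_halfspace_Im_gt open_halfspace_Im_gt)
    have "k z = 0" if z: "z \<in> ?U" for z
    proof (rule analytic_continuation_open[OF V(1) U(1) V(2) U(2) V(3) k(1) holomorphic_on_const _ z])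
      fix w assume "w \<in> V"
      then show "k w = 0" using fk[of w] by (simp add: V_def)
    qed
    then show ?thesis using k(3) by blast
  qed
qed

end

section \<open>Rigidity of isometric automorphisms\<close>

definition isometric_aut :: "oper set \<Rightarrow> (oper \<Rightarrow> oper) \<Rightarrow> bool" where
  "isometric_aut A \<Phi> \<longleftrightarrow> bij_betw \<Phi> A A \<and>
     (\<forall>S\<in>A. \<forall>T\<in>A. \<Phi> (S + T) = \<Phi> S + \<Phi> T) \<and>
     (\<forall>c. \<forall>T\<in>A. \<Phi> (sc c * T) = sc c * \<Phi> T) \<and>
     (\<forall>S\<in>A. \<forall>T\<in>A. \<Phi> (S * T) = \<Phi> S * \<Phi> T) \<and>
     (\<forall>T\<in>A. norm (\<Phi> T) = norm T)"

text \<open>Additive and nonnegative means monotone, which is enough regularity for linearity.\<close>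

lemma nonneg_additive_linear:
  fixes k :: "real \<Rightarrow> real"
  assumes nonneg: "\<And>a. 0 \<le> a \<Longrightarrow> 0 \<le> k a"
    and add: "\<And>a b. 0 \<le> a \<Longrightarrow> 0 \<le> b \<Longrightarrow> k (a + b) = k a + k b"
    and x: "0 \<le> x"
  shows "k x = k 1 * x"
proof -
  have mono: "k a \<le> k b" if "0 \<le> a" "a \<le> b" for a b
    using add[of a "b - a"] nonneg[of "b - a"] that by simp
  have mult: "k (real n * a) = real n * k a" if "0 \<le> a" for n a
  proof (induction n)
    case 0
    then show ?case using add[of 0 0] by simp
  next
    case (Suc n)
    then show ?case using add[of a "real n * a"] that by (simp add: algebra_simps)
  qed
  have "\<bar>k x - k 1 * x\<bar> * real n \<le> k 1" for n
  proof -
    define m where "m = nat \<lfloor>real n * x\<rfloor>"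
    have "real m = of_int \<lfloor>real n * x\<rfloor>" using x by (simp add: m_def)
    then have m: "real m \<le> real n * x" "real n * x \<le> real (Suc m)"
      using floor_correct[of "real n * x"] unfolding of_nat_Suc by linarith+
    have "real m * k 1 \<le> real n * k x"
      using mono[OF _ m(1)] mult[of 1 m] mult[OF x, of n] by simp
    moreover have "real n * k x \<le> real (Suc m) * k 1"
      using mono[OF _ m(2)] x mult[of 1 "Suc m"] mult[OF x, of n] by simp
    moreover have "real m * k 1 \<le> real n * x * k 1" "real n * x * k 1 \<le> real (Suc m) * k 1"
      using m nonneg[of 1] by (auto intro!: mult_right_mono)
    ultimately have "\<bar>real n * k x - real n * x * k 1\<bar> \<le> k 1"
      by (simp add: algebra_simps abs_le_iff)
    moreover have "real n * k x - real n * x * k 1 = (k x - k 1 * x) * real n"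
      by (simp add: algebra_simps)
    ultimately show ?thesis by (simp add: abs_mult)
  qed
  then have "\<bar>k x - k 1 * x\<bar> \<le> 0"
    by (metis abs_ge_zero ex_less_of_nat_mult linorder_not_le mult.commute order_le_less)
  then show ?thesis by simp
qed

lemma frequency_zero_if_cis_1:
  assumes "\<And>r. 0 \<le> r \<Longrightarrow> cis (x * r) = 1"
  shows "x = 0"
proof (rule ccontr)
  assume "x \<noteq> 0"
  then have "cis (x * (pi / \<bar>x\<bar>)) = cis pi \<or> cis (x * (pi / \<bar>x\<bar>)) = cis (- pi)"
    by (cases "x > 0") auto
  with assms[of "pi / \<bar>x\<bar>"] show False by (auto simp: complex_eq_iff)
qed

context weyl0 begin

text \<open>The line spanned by a monomial is already closed, as scalars depend isometrically on the multiples.\<close>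

lemma wspan_single: "T \<in> wspan P Q {a} {b} \<Longrightarrow> \<exists>c. T = sc c * (P a * Q b)"
proof (induction rule: wspan_induct)
  case zero
  then show ?case by (intro exI[of _ 0]) simp
next
  case (monomial c a b)
  then show ?case by auto
next
  case (add S T)
  then show ?case by (metis distrib_right sc_add)
next
  case (limit Y T)
  interpret sw: weyl0 Q P "- \<sigma>" by (rule swap)
  obtain c where c: "\<And>n. Y n = sc (c n) * (P a * Q b)" using limit.IH by metis
  have "dist (c m) (c n) \<le> dist (Y m) (Y n)" for m n
    by (simp add: dist_norm c sc_diff[symmetric] left_diff_distrib[symmetric])
  then obtain d where "c \<longlonglongrightarrow> d" using convergent_if_dist_le[OF limit.hyps(2)] by blast
  then have "Y \<longlonglongrightarrow> sc d * (P a * Q b)"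
    unfolding c[abs_def] by (intro tendsto_intros tendsto_sc)
  then show ?case using limit.hyps(2) LIMSEQ_unique by blast
qed

lemma conj_wspan: "T \<in> wspan P Q I {\<nu>} \<Longrightarrow> P t * T * P (- t) = sc (cis (\<sigma> * \<nu> * t)) * T"
proof (induction rule: wspan_induct)
  case (monomial c a b)
  then show ?case using conj_monomial by simp
next
  case (limit Y T)
  have "(\<lambda>n. P t * Y n * P (- t)) \<longlonglongrightarrow> P t * T * P (- t)"
    "(\<lambda>n. sc (cis (\<sigma> * \<nu> * t)) * Y n) \<longlonglongrightarrow> sc (cis (\<sigma> * \<nu> * t)) * T"
    by (intro tendsto_intros limit.hyps)+
  then show ?case using limit.IH LIMSEQ_unique by auto
qed (auto simp: algebra_simps)

lemma P_monomial_eq: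
  assumes "sc c * P s = sc c' * P s'" "c \<noteq> 0"
  shows "s = s'" "c = c'"
proof -
  have \<sigma>0: "\<sigma> \<noteq> 0" using \<sigma> by auto
  interpret sw: weyl0 Q P "- \<sigma>" by (rule swap)
  have "sc c * P s \<noteq> 0" using norm_sc_mult[of c "P s"] assms(2) by force
  moreover have "mode Q (- \<sigma> * s) (sc c * P s) = sc c * P s"
    using sw.mode_monomial[of "- \<sigma> * s" c 0 s] by simp
  moreover have "mode Q (- \<sigma> * s) (sc c' * P s') = 0" if "s \<noteq> s'"
    using sw.mode_monomial[of "- \<sigma> * s" c' 0 s'] that \<sigma>0 by auto
  ultimately show "s = s'" using assms(1) by metis
  then have "sc c * P s * P (- s) = sc c' * P s * P (- s)" using assms(1) by simp
  then have "sc (c - c') = 0" by (simp add: mult.assoc sc_diff)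
  then show "c = c'" using norm_sc[of "c - c'"] by simp
qed

end

text \<open>The algebra is presented by two Weyl pairs: \<open>p, q\<close> on the side where \<open>\<Phi>\<close> is evaluated, \<open>P, Q\<close> on the side
  where its values are analysed.  Taking the same or the opposite order of modulations and translations on
  the two sides covers both possible actions of \<open>\<Phi>\<close> on the ideals.\<close>

locale weyl_aut = tgt: weyl P Q \<sigma> + src: weyl p q \<tau> for P Q \<sigma> p q \<tau> +
  fixes \<Phi> \<Psi> :: "oper \<Rightarrow> oper"
  assumes same: "src.A = tgt.A"
    and \<Phi>: "isometric_aut tgt.A \<Phi>" and \<Psi>: "isometric_aut tgt.A \<Psi>"
    and inv: "\<And>T. T \<in> tgt.A \<Longrightarrow> \<Psi> (\<Phi> T) = T" "\<And>T. T \<in> tgt.A \<Longrightarrow> \<Phi> (\<Psi> T) = T"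
begin

abbreviation "\<A> \<equiv> tgt.A"

lemma reverse: "weyl_aut p q \<tau> P Q \<sigma> \<Psi> \<Phi>"
  by unfold_locales (use same \<Phi> \<Psi> inv in auto)

lemma Phi_in: "T \<in> \<A> \<Longrightarrow> \<Phi> T \<in> \<A>"
  using \<Phi> by (auto simp: isometric_aut_def bij_betw_def)
lemma Psi_in: "T \<in> \<A> \<Longrightarrow> \<Psi> T \<in> \<A>"
  using \<Psi> by (auto simp: isometric_aut_def bij_betw_def)
lemma Phi_add: "S \<in> \<A> \<Longrightarrow> T \<in> \<A> \<Longrightarrow> \<Phi> (S + T) = \<Phi> S + \<Phi> T"
  and Phi_sc: "T \<in> \<A> \<Longrightarrow> \<Phi> (sc c * T) = sc c * \<Phi> T"
  and Phi_mult: "S \<in> \<A> \<Longrightarrow> T \<in> \<A> \<Longrightarrow> \<Phi> (S * T) = \<Phi> S * \<Phi> T"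
  and norm_Phi: "T \<in> \<A> \<Longrightarrow> norm (\<Phi> T) = norm T"
  using \<Phi> by (auto simp: isometric_aut_def)

lemma Phi_diff: "S \<in> \<A> \<Longrightarrow> T \<in> \<A> \<Longrightarrow> \<Phi> (S - T) = \<Phi> S - \<Phi> T"
  using Phi_add[of S "sc (-1) * T"] Phi_sc[of T "-1"] by (simp add: wspan_sc sc_minus wspan_uminus)

lemma Phi_zero: "\<Phi> 0 = 0"
  using Phi_diff[of 0 0] wspan_zero[of P Q] by simp

lemma Phi_limit:
  assumes "\<And>n. Y n \<in> \<A>" "Y \<longlonglongrightarrow> T"
  shows "(\<lambda>n. \<Phi> (Y n)) \<longlonglongrightarrow> \<Phi> T"
proof -
  have T: "T \<in> \<A>" by (rule wspan_limit[OF assms])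
  show ?thesis
    by (rule tendsto_if_norm_le[OF assms(2)])
      (use norm_Phi[OF wspan_diff[OF assms(1) T]] in \<open>simp add: Phi_diff assms T\<close>)
qed

lemma p_in: "0 \<le> a \<Longrightarrow> p a \<in> \<A>" and q_in: "0 \<le> b \<Longrightarrow> q b \<in> \<A>"
  unfolding same[symmetric] by (auto intro: src.P_in_wspan src.Q_in_wspan)

lemma src_sub: "T \<in> wspan p q I J \<Longrightarrow> I \<subseteq> {0..} \<Longrightarrow> J \<subseteq> {0..} \<Longrightarrow> T \<in> \<A>"
  unfolding same[symmetric] using wspan_mono[of I "{0..}" J "{0..}" p q] by auto

lemma Phi_monomial:
  "0 \<le> a \<Longrightarrow> 0 \<le> b \<Longrightarrow> \<Phi> (sc c * (p a * q b)) = sc c * (\<Phi> (p a) * \<Phi> (q b))"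
  by (simp add: Phi_sc Phi_mult p_in q_in tgt.A_mult)

lemma kills_from_generators:
  assumes I: "I \<subseteq> {0..}" "J \<subseteq> {0..}"
    and gen: "\<And>a b. a \<in> I \<Longrightarrow> b \<in> J \<Longrightarrow> tgt.\<pi> (\<Phi> (p a)) * tgt.\<pi> (\<Phi> (q b)) = 0"
    and T: "T \<in> wspan p q I J"
  shows "tgt.\<pi> (\<Phi> T) = 0"
  using T
proof (induction rule: wspan_induct)
  case zero
  then show ?case by (simp add: Phi_zero)
next
  case (monomial c a b)
  then have ab: "0 \<le> a" "0 \<le> b" using I by auto
  have "\<Phi> (p a) * \<Phi> (q b) \<in> \<A>" by (intro tgt.A_mult Phi_in p_in q_in ab)
  then have "tgt.\<pi> (\<Phi> (sc c * (p a * q b))) = sc c * (tgt.\<pi> (\<Phi> (p a)) * tgt.\<pi> (\<Phi> (q b)))"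
    using ab by (simp add: Phi_monomial tgt.mode_sc tgt.sub_B tgt.pi_mult Phi_in p_in q_in)
  then show ?case using gen monomial by simp
next
  case (add S T)
  then have "S \<in> \<A>" "T \<in> \<A>" using src_sub I by blast+
  then show ?case using add by (simp add: Phi_add tgt.mode_add tgt.sub_B[OF Phi_in])
next
  case (limit Y T)
  have Y: "Y n \<in> \<A>" for n using limit.hyps(1) src_sub I by blast
  have "(\<lambda>n. tgt.\<pi> (\<Phi> (Y n))) \<longlonglongrightarrow> tgt.\<pi> (\<Phi> T)"
    by (intro tgt.mode_limit tgt.sub_B[OF Phi_in] Phi_limit Y limit.hyps)
  then show ?case using limit.IH by (simp add: LIMSEQ_const_iff)
qed

text \<open>\<open>F a = \<pi> (\<Phi> (p a))\<close> and \<open>G b = \<pi> (\<Phi> (q b))\<close> lie in the commutative domain \<open>H\<close> and satisfy the Weyl relation, so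
  \<open>F a * G b = 0\<close> whenever the phase is not \<open>1\<close>.  If some \<open>F a0\<close> is nonzero, so is \<open>F a\<close> for all smaller \<open>a\<close>, and
  \<open>a\<close> can be chosen with a nontrivial phase for any given \<open>b\<close>.\<close>

lemma kills_dichotomy:
  "(\<forall>T \<in> wspan p q {0..} {0<..}. tgt.\<pi> (\<Phi> T) = 0) \<or> (\<forall>T \<in> wspan p q {0<..} {0..}. tgt.\<pi> (\<Phi> T) = 0)"
proof (cases "\<forall>a>0. tgt.\<pi> (\<Phi> (p a)) = 0")
  case True
  then have "\<forall>T \<in> wspan p q {0<..} {0..}. tgt.\<pi> (\<Phi> T) = 0"
    by (intro ballI kills_from_generators[of "{0<..}" "{0..}"]) auto
  then show ?thesis ..
next
  case False
  define F where "F a = tgt.\<pi> (\<Phi> (p a))" for a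
  define G where "G b = tgt.\<pi> (\<Phi> (q b))" for b
  have FH: "F a \<in> tgt.H" if "0 \<le> a" for a unfolding F_def by (intro tgt.pi_H Phi_in p_in that)
  have GH: "G a \<in> tgt.H" if "0 \<le> a" for a unfolding G_def by (intro tgt.pi_H Phi_in q_in that)
  have Fadd: "F (a + b) = F a * F b" if "0 \<le> a" "0 \<le> b" for a b
    unfolding F_def using that by (simp add: src.P_add Phi_mult p_in tgt.pi_mult Phi_in)
  obtain a0 where a0: "a0 > 0" "F a0 \<noteq> 0" using False by (auto simp: F_def)
  have "G b = 0" if b: "b > 0" for b
  proof -
    \<comment> \<open>Then \<open>0 < a * b \<le> 1 < pi\<close>, so the phase of the Weyl relation is not \<open>1\<close>.\<close>
    define a where "a = min a0 (1 / b)"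
    have a: "0 < a" "a \<le> a0" "a * b \<le> 1"
      using a0 b by (auto simp: a_def min_def field_simps)
    have "F a \<noteq> 0" using Fadd[of a "a0 - a"] a a0 by auto
    define z where "z = cis (- (\<tau> * a * b))"
    have z: "z \<noteq> 1"
    proof
      assume "z = 1"
      then have "sin (\<tau> * a * b) = 0" by (simp add: z_def complex_eq_iff)
      moreover have "\<tau> = 1 \<or> \<tau> = -1" using src.\<sigma> by (simp add: square_eq_1_iff)
      ultimately have "sin (a * b) = 0" by auto
      moreover have "0 < sin (a * b)"
        using a b pi_gt3 by (intro sin_gt_zero) (auto intro: le_less_trans[of _ 1])
      ultimately show False by simp
    qed
    have "G b * F a = tgt.\<pi> (\<Phi> (q b * p a))"
      unfolding F_def G_def using a b by (simp add: Phi_mult p_in q_in tgt.pi_mult Phi_in)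
    also have "\<dots> = sc z * (F a * G b)"
      unfolding F_def G_def z_def src.weyl
      using a b tgt.sub_B[OF tgt.A_mult[OF Phi_in[OF p_in[of a]] Phi_in[OF q_in[of b]]]] by (simp add: Phi_mult Phi_sc p_in q_in tgt.pi_mult tgt.mode_sc Phi_in tgt.A_mult tgt.sub_B)
    finally have "F a * G b = sc z * (F a * G b)"
      using tgt.commute_wspan[OF FH GH] a b by simp
    then have "sc (1 - z) * (F a * G b) = 0"
      by (simp add: sc_diff left_diff_distrib)
    then have "F a * G b = 0"
      using z norm_sc_mult[of "1 - z" "F a * G b"] by auto
    then show "G b = 0"
      using tgt.H_domain[OF FH GH, of a b] a b \<open>F a \<noteq> 0\<close> by auto
  qed
  then have "\<forall>T \<in> wspan p q {0..} {0<..}. tgt.\<pi> (\<Phi> T) = 0"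
    by (intro ballI kills_from_generators[of "{0..}" "{0<..}"]) (auto simp: G_def)
  then show ?thesis ..
qed

text \<open>The norm of \<open>\<pi> T\<close> is the distance of \<open>T\<close> from the kernel, and \<open>\<Phi>\<close> maps one kernel into the other.\<close>

lemma norm_pi_Phi_le:
  assumes kills: "\<And>T. T \<in> src.K \<Longrightarrow> tgt.\<pi> (\<Phi> T) = 0" and T: "T \<in> \<A>"
  shows "norm (tgt.\<pi> (\<Phi> T)) \<le> norm (src.\<pi> T)"
proof -
  have T': "T \<in> src.A" using T same by simp
  have pT: "src.\<pi> T \<in> \<A>" using src.H_sub_A[OF src.pi_H[OF T']] same by simp
  have "T = (T - src.\<pi> T) + src.\<pi> T" by simp
  then have "tgt.\<pi> (\<Phi> T) = tgt.\<pi> (\<Phi> ((T - src.\<pi> T) + src.\<pi> T))" by simp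
  also have "\<dots> = tgt.\<pi> (\<Phi> (T - src.\<pi> T)) + tgt.\<pi> (\<Phi> (src.\<pi> T))"
    unfolding Phi_add[OF wspan_diff[OF T pT] pT]
    by (rule tgt.mode_add[OF tgt.sub_B[OF Phi_in[OF wspan_diff[OF T pT]]] tgt.sub_B[OF Phi_in[OF pT]]])
  also have "\<dots> = tgt.\<pi> (\<Phi> (src.\<pi> T))" using kills[OF src.pi_ker[OF T']] by simp
  finally have "tgt.\<pi> (\<Phi> T) = tgt.\<pi> (\<Phi> (src.\<pi> T))" .
  then show ?thesis
    using tgt.norm_mode[OF tgt.sub_B[OF Phi_in[OF pT]], of 0] norm_Phi[OF pT] by simp
qed

end

text \<open>The situation in which \<open>\<Phi>\<close> maps the ideal of the source pair onto that of the target pair.\<close>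

locale weyl_aut_matched = weyl_aut +
  assumes kills: "\<And>T. T \<in> src.K \<Longrightarrow> tgt.\<pi> (\<Phi> T) = 0"
    and kills': "\<And>T. T \<in> tgt.K \<Longrightarrow> src.\<pi> (\<Psi> T) = 0"
begin

lemma norm_pi_Phi: "T \<in> \<A> \<Longrightarrow> norm (tgt.\<pi> (\<Phi> T)) = norm (src.\<pi> T)"
  using norm_pi_Phi_le[OF kills, of T] weyl_aut.norm_pi_Phi_le[OF reverse kills', of "\<Phi> T"]
  by (simp add: same inv Phi_in antisym)

text \<open>\<open>\<Phi>\<close> induces an isometry between the quotients by the two ideals.  As \<open>p a\<close> multiplies isometrically, so does its
  image \<open>f\<close>, which is therefore unitary; then \<open>\<Phi> (p a)\<close> is a contraction with unitary mean \<open>f\<close>.\<close>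

lemma Phi_p_in_H:
  assumes a: "0 \<le> a"
  shows "\<Phi> (p a) \<in> tgt.H"
proof -
  define f where "f = tgt.\<pi> (\<Phi> (p a))"
  have f: "f \<in> tgt.H" unfolding f_def by (intro tgt.pi_H Phi_in p_in a)
  have "norm (f * h) = norm h" if h: "h \<in> tgt.H" for h
  proof -
    define T where "T = \<Psi> h"
    have T: "T \<in> \<A>" unfolding T_def by (intro Psi_in tgt.H_sub_A h)
    have \<Phi>T: "tgt.\<pi> (\<Phi> T) = h" unfolding T_def by (simp add: inv tgt.H_sub_A h tgt.pi_id[OF h])
    have "f * h = tgt.\<pi> (\<Phi> (p a * T))"
      unfolding f_def \<Phi>T[symmetric] using a T by (simp add: Phi_mult p_in tgt.pi_mult Phi_in)
    then have "norm (f * h) = norm (src.\<pi> (p a * T))"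
      using norm_pi_Phi[OF tgt.A_mult[OF p_in[OF a] T]] by simp
    also have "src.\<pi> (p a * T) = p a * src.\<pi> T"
      using T by (intro src.mode_left src.P_commute) (simp add: same[symmetric] src.sub_B)
    also have "norm \<dots> = norm (tgt.\<pi> (\<Phi> T))" using norm_pi_Phi[OF T] by simp
    finally show ?thesis using \<Phi>T by simp
  qed
  then obtain F where F: "F \<in> wspan P Q UNIV {0}" "adjoint_pair f F" "F * f = 1"
    using tgt.isometric_multiplier_unitary[OF f] by blast
  have "\<Phi> (p a) = f"
    by (rule tgt.contraction_eq_expectation[OF _ _ f_def[symmetric] F])
      (use a in \<open>auto intro: tgt.sub_B[OF Phi_in] p_in simp: norm_Phi p_in\<close>)
  with f show ?thesis by simp
qed

text \<open>The \<open>\<nu>\<close>-th mode of \<open>R = \<Phi> (q b)\<close> has the form \<open>g * Q \<nu>\<close> with \<open>g\<close> in \<open>H\<close>, and the Weyl relation for \<open>R\<close> and \<open>f = \<Phi> (p a)\<close>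
  says that \<open>g\<close> annihilates \<open>Q \<nu> * f * Q (- \<nu>) - \<omega> f\<close>.  Since \<open>H\<close> is a domain, every frequency \<open>r\<close> of \<open>f\<close> satisfies
  \<open>cis (- \<sigma> r \<nu>) = \<omega>\<close> for every \<open>\<nu>\<close> occurring in \<open>R\<close>.  For two frequencies \<open>s\<close>, \<open>s'\<close> this means that conjugation by
  \<open>P (s - s')\<close> fixes all modes of \<open>R\<close>, hence \<open>R\<close>.  So \<open>P (s - s')\<close> commutes with \<open>\<Phi> (q b)\<close> and with \<open>\<Phi> (p a)\<close>, hence with the
  whole algebra, in particular with all \<open>Q r\<close>.\<close>

lemma frequency_unique:
  assumes a: "0 \<le> a"
    and s: "mode Q (- \<sigma> * s) (\<Phi> (p a)) \<noteq> 0" and s': "mode Q (- \<sigma> * s') (\<Phi> (p a)) \<noteq> 0"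
  shows "s = s'"
proof -
  interpret sw: weyl0 Q P "- \<sigma>" by (rule tgt.swap)
  define f where "f = \<Phi> (p a)"
  have f: "f \<in> tgt.H" unfolding f_def by (rule Phi_p_in_H[OF a])
  have fB: "f \<in> sw.B" using tgt.sub_B[OF f] by (simp add: tgt.wspan_swap)
  have Pf: "P t * f = f * P t" for t by (rule tgt.commute_P[OF f])
  have key: "cis (- (\<sigma> * r * \<nu>)) = cis (- (\<tau> * a * b))"
    if b: "0 \<le> b" and \<nu>: "mode P (\<sigma> * \<nu>) (\<Phi> (q b)) \<noteq> 0" and r: "mode Q (- \<sigma> * r) f \<noteq> 0" for b \<nu> r
  proof -
    define R where "R = \<Phi> (q b)"
    define \<omega> where "\<omega> = cis (- (\<tau> * a * b))"
    define G where "G = mode P (\<sigma> * \<nu>) R"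
    have R: "R \<in> \<A>" "R \<in> tgt.B" unfolding R_def using b by (auto intro: Phi_in q_in tgt.sub_B)
    have "\<nu> \<in> {0..}" using tgt.mode_eq_0[OF R(1), of \<nu>] \<nu> unfolding R_def by blast
    then have G: "G \<in> wspan P Q {0..} {\<nu>}" unfolding G_def by (rule tgt.mode_in_wspan[OF R(1)])
    define g where "g = G * Q (- \<nu>)"
    have g: "g \<in> tgt.H"
      unfolding g_def by (rule tgt.wspan_mult[OF G tgt.Q_in_wspan[of "{0}" "- \<nu>" "{- \<nu>}"]]) auto
    have Gg: "G = g * Q \<nu>" by (simp add: g_def mult.assoc)
    have "R * f = sc \<omega> * (f * R)"
      unfolding R_def f_def \<omega>_def using a b src.weyl[of b a]
      by (metis Phi_mult Phi_sc p_in q_in tgt.A_mult)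
    then have "mode P (\<sigma> * \<nu>) (R * f) = mode P (\<sigma> * \<nu>) (sc \<omega> * f * R)" by (simp add: mult.assoc)
    then have "G * f = sc \<omega> * f * G"
      unfolding G_def
      by (subst (asm) tgt.mode_right[OF Pf R(2)], subst (asm) tgt.mode_left[OF _ R(2)])
        (simp_all add: sc_left_commute Pf mult.assoc)
    moreover have "g * (Q \<nu> * f * Q (- \<nu>)) = G * f * Q (- \<nu>)" by (simp add: g_def mult.assoc)
    ultimately have gf: "g * (Q \<nu> * f * Q (- \<nu>)) = sc \<omega> * f * g"
      by (simp add: g_def mult.assoc)
    define f' where "f' = Q \<nu> * f * Q (- \<nu>)"
    have f': "f' \<in> tgt.H"
      unfolding f'_def
      by (rule tgt.wspan_mult[OF tgt.wspan_mult[OF tgt.Q_in_wspan[of "{0}" \<nu> "{\<nu>}"] f, of "{0..}" "{\<nu>}"]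
            tgt.Q_in_wspan[of "{0}" "- \<nu>" "{- \<nu>}"]]) auto
    have "g * (f' - sc \<omega> * f) = 0"
      using gf tgt.commute_wspan[OF f g] unfolding f'_def[symmetric]
      by (simp add: right_diff_distrib sc_left_commute[of g] mult.assoc)
    moreover have "g \<noteq> 0" using Gg \<nu> by (auto simp: G_def R_def)
    ultimately have "f' - sc \<omega> * f = 0"
      using tgt.H_domain[OF g wspan_diff[OF f' wspan_sc[OF f]]] by blast
    then have "f' = sc \<omega> * f" by simp
    then have "mode Q (- \<sigma> * r) f' = sc \<omega> * mode Q (- \<sigma> * r) f"
      using sw.mode_sc[OF fB] by simp
    moreover have "mode Q (- \<sigma> * r) f' = Q \<nu> * mode Q (- \<sigma> * r) f * Q (- \<nu>)"
    proof -
      have "Q \<nu> * f \<in> sw.B" by (rule sw.wspan_mult[OF sw.P_in_wspan fB, of _ UNIV "{0}"]) auto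
      then show ?thesis
        unfolding f'_def
        by (simp add: sw.mode_right[OF sw.P_commute] sw.mode_left[OF sw.P_commute fB])
    qed
    moreover have "Q \<nu> * mode Q (- \<sigma> * r) f * Q (- \<nu>) = sc (cis (- (\<sigma> * r * \<nu>))) * mode Q (- \<sigma> * r) f"
      using sw.conj_wspan[OF sw.mode_in_wspan[of f UNIV UNIV r, OF fB], of \<nu>] by simp
    ultimately have "sc (cis (- (\<sigma> * r * \<nu>)) - \<omega>) * mode Q (- \<sigma> * r) f = 0"
      by (simp add: sc_diff left_diff_distrib)
    then have "cmod (cis (- (\<sigma> * r * \<nu>)) - \<omega>) * norm (mode Q (- \<sigma> * r) f) = 0"
      unfolding norm_sc_mult[symmetric] by simp
    then show ?thesis using r by (simp add: \<omega>_def)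
  qed
  define t where "t = s - s'"
  have comm_q: "P t * \<Phi> (q b) = \<Phi> (q b) * P t" if b: "0 \<le> b" for b
  proof -
    define R where "R = \<Phi> (q b)"
    have R: "R \<in> tgt.B" unfolding R_def using b by (auto intro: Phi_in q_in tgt.sub_B)
    have PR: "P t * R \<in> tgt.B" by (rule tgt.wspan_mult[OF tgt.P_in_wspan R, of _ UNIV "{0}"]) auto
    have PRP: "P t * R * P (- t) \<in> tgt.B"
      by (rule tgt.wspan_mult[OF PR tgt.P_in_wspan[of _ UNIV "{0}"]]) auto
    have "P t * R * P (- t) - R = 0"
    proof (rule tgt.mode_injective[OF wspan_diff[OF PRP R]])
      fix \<nu>'
      define \<nu> where "\<nu> = \<sigma> * \<nu>'"
      have \<nu>': "\<nu>' = \<sigma> * \<nu>" using tgt.\<sigma> by (simp add: \<nu>_def flip: mult.assoc)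
      have "mode P \<nu>' (P t * R * P (- t)) = P t * mode P \<nu>' R * P (- t)"
        by (simp add: tgt.mode_right[OF tgt.P_commute PR] tgt.mode_left[OF tgt.P_commute R])
      also have "\<dots> = sc (cis (\<sigma> * \<nu> * t)) * mode P \<nu>' R"
        unfolding \<nu>' using tgt.conj_wspan[OF tgt.mode_in_wspan[OF R UNIV_I, of \<nu>]] .
      finally have ev: "mode P \<nu>' (P t * R * P (- t) - R) = sc (cis (\<sigma> * \<nu> * t) - 1) * mode P \<nu>' R"
        by (simp add: tgt.mode_diff[OF PRP R] sc_diff left_diff_distrib)
      show "mode P \<nu>' (P t * R * P (- t) - R) = 0"
      proof (cases "mode P \<nu>' R = 0")
        case True
        then show ?thesis using ev by simp
      next
        case False
        have "cis (- (\<sigma> * s' * \<nu>)) = cis (- (\<sigma> * s * \<nu>))"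
          using key[OF b _ s[folded f_def]] key[OF b _ s'[folded f_def]] False
          unfolding \<nu>' R_def by metis
        then have "cis (\<sigma> * s * \<nu>) * cis (- (\<sigma> * s' * \<nu>)) = 1"
          by (simp add: cis_mult)
        then have "cis (\<sigma> * \<nu> * t) = 1" by (simp add: cis_mult t_def algebra_simps)
        then show ?thesis using ev by simp
      qed
    qed
    then have "P t * R * P (- t) * P t = R * P t" by simp
    then show ?thesis by (simp add: R_def mult.assoc)
  qed
  have comm: "P t * \<Phi> T = \<Phi> T * P t" if "T \<in> src.A" for T
    using that
  proof (induction rule: wspan_induct)
    case zero
    then show ?case by (simp add: Phi_zero)
  next
    case (monomial c x y)
    have "P t * (\<Phi> (p x) * \<Phi> (q y)) = \<Phi> (p x) * \<Phi> (q y) * P t"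
      using monomial tgt.commute_P[OF Phi_p_in_H[of x], of t] comm_q[of y]
      by (metis atLeast_iff mult.assoc)
    then show ?case using monomial by (simp add: Phi_monomial tgt.P_sc mult.assoc)
  next
    case (add S T)
    then show ?case by (simp add: same Phi_add algebra_simps)
  next
    case (limit Y T)
    have lim: "(\<lambda>n. \<Phi> (Y n)) \<longlonglongrightarrow> \<Phi> T" by (rule Phi_limit) (use limit.hyps same in auto)
    have "(\<lambda>n. P t * \<Phi> (Y n)) \<longlonglongrightarrow> P t * \<Phi> T" "(\<lambda>n. \<Phi> (Y n) * P t) \<longlonglongrightarrow> \<Phi> T * P t"
      by (intro tendsto_intros lim)+
    then show ?case using limit.IH LIMSEQ_unique by auto
  qed
  have "cis (\<sigma> * t * r) = 1" if "0 \<le> r" for r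
  proof -
    have "Q r \<in> \<A>" using that by (intro tgt.Q_in_wspan) auto
    then have "P t * Q r = Q r * P t"
      using comm[of "\<Psi> (Q r)"] by (simp add: same Psi_in inv)
    then have "sc (cis (\<sigma> * t * r) - 1) * (Q r * P t) = 0"
      using tgt.P_mult_Q[of t r] by (simp add: sc_diff left_diff_distrib)
    then have "cmod (cis (\<sigma> * t * r) - 1) * norm (Q r * P t) = 0"
      unfolding norm_sc_mult[symmetric] by simp
    then show ?thesis by simp
  qed
  then have "\<sigma> * t = 0" by (rule frequency_zero_if_cis_1)
  then show ?thesis using tgt.\<sigma> by (auto simp: t_def)
qed

lemma Phi_p_monomial:
  assumes a: "0 \<le> a"
  shows "\<exists>c s. cmod c = 1 \<and> 0 \<le> s \<and> \<Phi> (p a) = sc c * P s"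
proof -
  interpret sw: weyl0 Q P "- \<sigma>" by (rule tgt.swap)
  define f where "f = \<Phi> (p a)"
  have f: "f \<in> wspan Q P {0} {0..}" unfolding f_def tgt.wspan_swap by (rule Phi_p_in_H[OF a])
  have fB: "f \<in> sw.B" by (rule sw.sub_B[OF f])
  have nf: "norm f = 1" unfolding f_def using a by (simp add: norm_Phi p_in)
  then have "f \<noteq> 0" by auto
  then obtain \<nu> where \<nu>: "mode Q \<nu> f \<noteq> 0" using sw.mode_injective[OF fB] by blast
  define s where "s = - \<sigma> * \<nu>"
  have "\<nu> = - \<sigma> * s" using tgt.\<sigma> by (simp add: s_def flip: mult.assoc)
  with \<nu> have s: "mode Q (- \<sigma> * s) f \<noteq> 0" by simp
  then have s0: "s \<in> {0..}" using sw.mode_eq_0[OF f, of s] by auto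
  define g where "g = mode Q (- \<sigma> * s) f"
  have g: "g \<in> wspan Q P {0} {s}" unfolding g_def by (rule sw.mode_in_wspan[OF f s0])
  have gB: "g \<in> sw.B" by (rule sw.sub_B[OF g])
  have "f - g = 0"
  proof (rule sw.mode_injective[OF wspan_diff[OF fB gB]])
    fix \<mu>
    define r where "r = - \<sigma> * \<mu>"
    have \<mu>: "\<mu> = - \<sigma> * r" using tgt.\<sigma> by (simp add: r_def flip: mult.assoc)
    show "mode Q \<mu> (f - g) = 0"
    proof (cases "r = s")
      case True
      then show ?thesis
        unfolding sw.mode_diff[OF fB gB] \<mu> using sw.mode_id[OF g] by (simp add: g_def)
    next
      case False
      then have "mode Q (- \<sigma> * r) f = 0"
        using frequency_unique[OF a, of r s] s by (auto simp: f_def)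
      moreover have "mode Q (- \<sigma> * r) g = 0" using sw.mode_eq_0[OF g, of r] False by simp
      ultimately show ?thesis unfolding sw.mode_diff[OF fB gB] \<mu> by simp
    qed
  qed
  then obtain c where c: "f = sc c * P s" using sw.wspan_single[OF g] by auto
  then have "cmod c = 1" using nf by simp
  with c s0 show ?thesis by (auto simp: f_def)
qed

theorem rigidity:
  "\<exists>\<kappa> d. 0 \<le> \<kappa> \<and> (\<forall>a\<ge>0. cmod (d a) = 1 \<and> \<Phi> (p a) = sc (d a) * P (\<kappa> * a)) \<and>
     (\<forall>a\<ge>0. \<forall>b\<ge>0. d (a + b) = d a * d b)"
proof -
  have "\<forall>a. \<exists>c s. 0 \<le> a \<longrightarrow> cmod c = 1 \<and> 0 \<le> s \<and> \<Phi> (p a) = sc c * P s"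
    using Phi_p_monomial by blast
  then obtain d k where dk: "\<And>a. 0 \<le> a \<Longrightarrow> cmod (d a) = 1 \<and> 0 \<le> k a \<and> \<Phi> (p a) = sc (d a) * P (k a)"
    by metis
  have add: "k (a + b) = k a + k b" "d (a + b) = d a * d b" if ab: "0 \<le> a" "0 \<le> b" for a b
  proof -
    have "sc (d (a + b)) * P (k (a + b)) = \<Phi> (p a * p b)"
      using dk[of "a + b"] ab by (simp add: src.P_add)
    also have "\<dots> = sc (d a * d b) * P (k a + k b)"
      using ab dk by (simp add: Phi_mult p_in tgt.P_add tgt.weyl_simps)
    finally have eq: "sc (d (a + b)) * P (k (a + b)) = sc (d a * d b) * P (k a + k b)" .
    have "d (a + b) \<noteq> 0" using dk[of "a + b"] ab by auto
    from tgt.P_monomial_eq[OF eq this] show "k (a + b) = k a + k b" "d (a + b) = d a * d b" .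
  qed
  have lin: "k a = k 1 * a" if "0 \<le> a" for a
  proof (rule nonneg_additive_linear[OF _ _ that])
    show "0 \<le> k a" if "0 \<le> a" for a using dk[OF that] by blast
  qed (rule add(1))
  show ?thesis
  proof (intro exI[of _ "k 1"] exI[of _ d] conjI allI impI)
    show "0 \<le> k 1" using dk[of 1] by simp
    show "d (a + b) = d a * d b" if "0 \<le> a" "0 \<le> b" for a b using that by (rule add(2))
    show "cmod (d a) = 1" "\<Phi> (p a) = sc (d a) * P (k 1 * a)" if "0 \<le> a" for a
      using dk[OF that] lin[OF that] by simp_all
  qed
qed

end

section \<open>The parabolic algebra as a closed span\<close>

text \<open>\<^const>\<open>M_op\<close>, \<^const>\<open>D_op\<close> and \<^const>\<open>V_op\<close> as elements of the operator algebra.\<close>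

lift_definition Mo :: "real \<Rightarrow> oper" is M_op by (rule M_op_B_L2)
lift_definition Do :: "real \<Rightarrow> oper" is D_op by (rule D_op_B_L2)
lift_definition Vo :: "real \<Rightarrow> oper" is V_op by (rule V_op_B_L2)

lemma Mo_app [simp]: "Mo a \<star> v = M_fun a v" by transfer simp
lemma Do_app [simp]: "Do a \<star> v = D_fun a v" by transfer simp
lemma Vo_app [simp]: "Vo a \<star> v = V_fun a v" by transfer simp

lemma weyl0_Mo_Do: "weyl0 Mo Do 1"
proof unfold_locales
  show "Do b * Mo a = sc (cis (- (1 * a * b))) * (Mo a * Do b)" for a b
    by (rule oper_eqI) (simp add: D_fun_M_fun)
qed (auto intro!: oper_eqI simp: M_fun_0 D_fun_0 M_fun_add D_fun_add inner_l2r_def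
    cinner_M_fun_adjoint cinner_D_fun_adjoint)

lemma Vo_add: "Vo s * Vo t = Vo (s + t)"
  by (rule oper_eqI) (simp add: V_fun_V_fun)

lemma Vo_0 [simp]: "Vo 0 = 1"
  by (rule oper_eqI) (simp add: V_fun_0)

lemma Vo_Mo: "Vo t * Mo a = Mo (exp t * a) * Vo t"
  by (rule oper_eqI) (simp add: V_fun_M_fun)

lemma Vo_Do: "Vo t * Do a = Do (exp (- t) * a) * Vo t"
  by (rule oper_eqI) (simp add: V_fun_D_fun)

lemma norm_V_fun [simp]: "norm (V_fun t v) = norm v"
  by (rule norm_eqI) (rule cinner_V_fun)

lemma V_fun_diff: "V_fun t (v - w) = V_fun t v - V_fun t w"
  using app_diff_right[of "Vo t" v w] by simp

lemma exp_mult_exp_minus_mult: "exp t * (exp (- t) * a) = (a :: real)"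
  by (simp add: exp_minus)

text \<open>Dilating concentrates the unit box at the origin, where modulations act trivially; dilating the
  other way flattens it, which makes it almost invariant under translations.\<close>

lemma Mo_approximate_eigenvector:
  "\<exists>u. \<forall>n. norm (u n) = 1 \<and> (\<forall>a. (\<lambda>n. (Mo a \<star> u n) - u n) \<longlonglongrightarrow> 0)"
proof (intro exI[of _ "\<lambda>n. V_fun (real n) unit_box"] allI conjI)
  fix a
  have "(\<lambda>n. M_fun (exp (- real n) * a) unit_box) \<longlonglongrightarrow> unit_box"
    by (rule M_fun_unit_box_tendsto) real_asymp
  then have lim: "(\<lambda>n. norm (M_fun (exp (- real n) * a) unit_box - unit_box)) \<longlonglongrightarrow> 0"
    by (rule tendsto_norm_zero[OF LIM_zero])
  have eq: "(Mo a \<star> V_fun (real n) unit_box) - V_fun (real n) unit_box =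
      V_fun (real n) (M_fun (exp (- real n) * a) unit_box - unit_box)" for n
    by (simp add: V_fun_diff V_fun_M_fun exp_mult_exp_minus_mult)
  show "(\<lambda>n. (Mo a \<star> V_fun (real n) unit_box) - V_fun (real n) unit_box) \<longlonglongrightarrow> 0"
    unfolding eq by (rule tendsto_norm_zero_cancel) (simp only: norm_V_fun lim)
qed simp

lemma Do_approximate_eigenvector:
  "\<exists>u. \<forall>n. norm (u n) = 1 \<and> (\<forall>a. (\<lambda>n. (Do a \<star> u n) - u n) \<longlonglongrightarrow> 0)"
proof (intro exI[of _ "\<lambda>n. V_fun (- real n) unit_box"] allI conjI)
  fix a
  have "(\<lambda>n. D_fun (exp (- real n) * a) unit_box) \<longlonglongrightarrow> unit_box"
    by (rule D_fun_unit_box_tendsto) real_asymp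
  then have lim: "(\<lambda>n. norm (D_fun (exp (- real n) * a) unit_box - unit_box)) \<longlonglongrightarrow> 0"
    by (rule tendsto_norm_zero[OF LIM_zero])
  have eq: "(Do a \<star> V_fun (- real n) unit_box) - V_fun (- real n) unit_box =
      V_fun (- real n) (D_fun (exp (- real n) * a) unit_box - unit_box)" for n
    by (simp add: V_fun_diff V_fun_D_fun exp_mult_exp_minus_mult)
  show "(\<lambda>n. (Do a \<star> V_fun (- real n) unit_box) - V_fun (- real n) unit_box) \<longlonglongrightarrow> 0"
    unfolding eq by (rule tendsto_norm_zero_cancel) (simp only: norm_V_fun lim)
qed simp

lemma weyl_Mo_Do: "weyl Mo Do 1"
  by (intro weyl.intro weyl0_Mo_Do weyl_axioms.intro Mo_approximate_eigenvector)

lemma weyl_Do_Mo: "weyl Do Mo (- 1)"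
  by (intro weyl.intro weyl0.swap[OF weyl0_Mo_Do] weyl_axioms.intro Do_approximate_eigenvector)

interpretation md: weyl Mo Do 1
  by (rule weyl_Mo_Do)

interpretation dm: weyl Do Mo "- 1"
  by (rule weyl_Do_Mo)

abbreviation "\<P> \<equiv> wspan Mo Do {0..} {0..}"

lemma Rep_sc_mult: "Rep_oper (sc c * T) = scaleC_op c (Rep_oper T)"
  by (rule blinfun_eqI) (simp add: times_oper.rep_eq sc.rep_eq)

lemma A_p_eq: "A_p = Rep_oper ` \<P>"
proof
  show "A_p \<subseteq> Rep_oper ` \<P>"
    unfolding A_p_def
  proof (rule hull_minimal)
    have "Mo l \<in> \<P>" if "0 \<le> l" for l using that by (intro md.P_in_wspan) auto
    moreover have "Do m \<in> \<P>" if "0 \<le> m" for m using that by (intro md.Q_in_wspan) auto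
    ultimately show "{M_op l |l. 0 \<le> l} \<union> {D_op m |m. 0 \<le> m} \<subseteq> Rep_oper ` \<P>"
      unfolding Mo.rep_eq[symmetric] Do.rep_eq[symmetric] by blast
    have "closed (Rep_oper ` \<P>)"
    proof (rule closed_sequential_limits[THEN iffD2], intro allI impI, elim conjE)
      fix X L assume X: "\<forall>n. X n \<in> Rep_oper ` \<P>" and L: "X \<longlonglongrightarrow> L"
      then have "\<forall>n. \<exists>y. y \<in> \<P> \<and> X n = Rep_oper y" by blast
      from choice[OF this] obtain Y where Y: "\<And>n. Y n \<in> \<P>" "\<And>n. X n = Rep_oper (Y n)"
        by blast
      have "X n \<in> B_L2" for n unfolding Y(2) by (rule Rep_oper)
      then have "L \<in> B_L2" by (rule closed_sequentially[OF closed_B_L2 _ L])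
      then have RL: "Rep_oper (Abs_oper L) = L" by (simp add: Abs_oper_inverse)
      then have "Y \<longlonglongrightarrow> Abs_oper L"
        using L unfolding tendsto_Rep_oper_iff RL Y(2)[symmetric] by simp
      then have "Abs_oper L \<in> \<P>" by (rule wspan_limit[OF Y(1)])
      then have "Rep_oper (Abs_oper L) \<in> Rep_oper ` \<P>" by (rule imageI)
      then show "L \<in> Rep_oper ` \<P>" by (simp only: RL)
    qed
    moreover have "Rep_oper S + Rep_oper T \<in> Rep_oper ` \<P>" "Rep_oper S o\<^sub>L Rep_oper T \<in> Rep_oper ` \<P>"
      if "S \<in> \<P>" "T \<in> \<P>" for S T
      using wspan_add[OF that] md.A_mult[OF that]
      by (auto simp flip: plus_oper.rep_eq times_oper.rep_eq)
    moreover have "scaleC_op c (Rep_oper T) \<in> Rep_oper ` \<P>" if "T \<in> \<P>" for c T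
      using wspan_sc[OF that] by (auto simp flip: Rep_sc_mult)
    moreover have "0 \<in> Rep_oper ` \<P>" using wspan_zero[of Mo Do] by (auto simp flip: zero_oper.rep_eq)
    ultimately show "closed_subalgebra (Rep_oper ` \<P>)"
      using Rep_oper by (auto simp: closed_subalgebra_def)
  qed
  have "\<P> \<subseteq> {T. Rep_oper T \<in> A_p}"
  proof (rule wspan_least)
    note A = closed_subalgebra_A_p[unfolded closed_subalgebra_def]
    show "closed {T. Rep_oper T \<in> A_p}"
      unfolding closed_sequential_limits
      using A closed_sequentially[of A_p] by (fastforce simp: tendsto_Rep_oper_iff)
    show "sc c * (Mo a * Do b) \<in> {T. Rep_oper T \<in> A_p}" if "a \<in> {0..}" "b \<in> {0..}" for c a b
    proof -
      have "Rep_oper (sc c * (Mo a * Do b)) = scaleC_op c (M_op a o\<^sub>L D_op b)"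
        unfolding Rep_sc_mult by (simp only: times_oper.rep_eq Mo.rep_eq Do.rep_eq)
      then show ?thesis using A M_op_A_p[of a] D_op_A_p[of b] that by simp
    qed
  qed (use closed_subalgebra_A_p in \<open>auto simp: closed_subalgebra_def zero_oper.rep_eq plus_oper.rep_eq\<close>)
  then show "Rep_oper ` \<P> \<subseteq> A_p" by auto
qed

lemma A_p_isometric_aut:
  assumes "isometric_automorphism A_p \<Phi>"
  shows "isometric_aut \<P> (\<lambda>T. Abs_oper (\<Phi> (Rep_oper T)))"
    and "T \<in> \<P> \<Longrightarrow> Rep_oper (Abs_oper (\<Phi> (Rep_oper T))) = \<Phi> (Rep_oper T)"
proof -
  note a = assms[unfolded isometric_automorphism_def]
  have in_A: "Rep_oper T \<in> A_p \<longleftrightarrow> T \<in> \<P>" for T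
    by (auto simp: A_p_eq Rep_oper_inject)
  have AB: "A_p \<subseteq> B_L2" using closed_subalgebra_A_p by (simp add: closed_subalgebra_def)
  have \<Phi>A: "\<Phi> (Rep_oper T) \<in> A_p" if "T \<in> \<P>" for T
    using a that in_A by (auto simp: bij_betw_def)
  then show R: "Rep_oper (Abs_oper (\<Phi> (Rep_oper T))) = \<Phi> (Rep_oper T)" if "T \<in> \<P>" for T
    using AB that by (auto intro: Abs_oper_inverse)
  have "bij_betw (\<lambda>T. Abs_oper (\<Phi> (Rep_oper T))) \<P> \<P>"
  proof -
    have 1: "bij_betw Rep_oper \<P> A_p"
      by (simp add: A_p_eq bij_betw_def inj_on_def Rep_oper_inject)
    have 2: "bij_betw Abs_oper A_p \<P>"
      by (rule bij_betw_byWitness[where f' = Rep_oper])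
        (use AB in \<open>auto simp: A_p_eq Rep_oper_inverse\<close>)
    have "bij_betw (Abs_oper \<circ> (\<Phi> \<circ> Rep_oper)) \<P> \<P>"
      using a by (intro bij_betw_trans[OF bij_betw_trans[OF 1] 2]) auto
    then show ?thesis by (simp add: o_def)
  qed
  moreover have eqI: "S = T" if "Rep_oper S = Rep_oper T" for S T using that by (simp add: Rep_oper_inject)
  ultimately show "isometric_aut \<P> (\<lambda>T. Abs_oper (\<Phi> (Rep_oper T)))"
    unfolding isometric_aut_def
  proof (intro conjI ballI allI)
    fix S T assume ST: "S \<in> \<P>" "T \<in> \<P>"
    have "Rep_oper (Abs_oper (\<Phi> (Rep_oper (S + T)))) = \<Phi> (Rep_oper S + Rep_oper T)"
      using R[OF wspan_add[OF ST]] by (simp only: plus_oper.rep_eq)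
    also have "\<dots> = \<Phi> (Rep_oper S) + \<Phi> (Rep_oper T)" using a ST in_A by blast
    also have "\<dots> = Rep_oper (Abs_oper (\<Phi> (Rep_oper S)) + Abs_oper (\<Phi> (Rep_oper T)))"
      by (simp only: plus_oper.rep_eq R ST)
    finally show "Abs_oper (\<Phi> (Rep_oper (S + T))) = Abs_oper (\<Phi> (Rep_oper S)) + Abs_oper (\<Phi> (Rep_oper T))"
      by (rule eqI)
    have "Rep_oper (Abs_oper (\<Phi> (Rep_oper (S * T)))) = \<Phi> (Rep_oper S o\<^sub>L Rep_oper T)"
      using R[OF md.A_mult[OF ST]] by (simp only: times_oper.rep_eq)
    also have "\<dots> = \<Phi> (Rep_oper S) o\<^sub>L \<Phi> (Rep_oper T)" using a ST in_A by blast
    also have "\<dots> = Rep_oper (Abs_oper (\<Phi> (Rep_oper S)) * Abs_oper (\<Phi> (Rep_oper T)))"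
      by (simp only: times_oper.rep_eq R ST)
    finally show "Abs_oper (\<Phi> (Rep_oper (S * T))) = Abs_oper (\<Phi> (Rep_oper S)) * Abs_oper (\<Phi> (Rep_oper T))"
      by (rule eqI)
  next
    fix c T assume T: "T \<in> \<P>"
    have "Rep_oper (Abs_oper (\<Phi> (Rep_oper (sc c * T)))) = \<Phi> (scaleC_op c (Rep_oper T))"
      using R[OF wspan_sc[OF T]] by (simp only: Rep_sc_mult)
    also have "\<dots> = scaleC_op c (\<Phi> (Rep_oper T))" using a T in_A by blast
    also have "\<dots> = Rep_oper (sc c * Abs_oper (\<Phi> (Rep_oper T)))"
      by (simp only: Rep_sc_mult R T)
    finally show "Abs_oper (\<Phi> (Rep_oper (sc c * T))) = sc c * Abs_oper (\<Phi> (Rep_oper T))"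
      by (rule eqI)
    show "norm (Abs_oper (\<Phi> (Rep_oper T))) = norm T"
      using a T in_A by (simp add: norm_oper.rep_eq R)
  qed
qed

lemma isometric_automorphism_A_p:
  assumes "isometric_aut \<P> \<Gamma>"
  shows "isometric_automorphism A_p (\<lambda>T. Rep_oper (\<Gamma> (Abs_oper T)))"
proof -
  note a = assms[unfolded isometric_aut_def]
  have AB: "A_p \<subseteq> B_L2" using closed_subalgebra_A_p by (simp add: closed_subalgebra_def)
  have 1: "bij_betw Rep_oper \<P> A_p"
    by (simp add: A_p_eq bij_betw_def inj_on_def Rep_oper_inject)
  have 2: "bij_betw Abs_oper A_p \<P>"
    by (rule bij_betw_byWitness[where f' = Rep_oper])
      (use AB in \<open>auto simp: A_p_eq Rep_oper_inverse\<close>)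
  have "bij_betw (Rep_oper \<circ> (\<Gamma> \<circ> Abs_oper)) A_p A_p"
    using a by (intro bij_betw_trans[OF bij_betw_trans[OF 2] 1]) auto
  then have "bij_betw (\<lambda>T. Rep_oper (\<Gamma> (Abs_oper T))) A_p A_p" by (simp add: o_def)
  moreover have "Abs_oper (Rep_oper S + Rep_oper T) = S + T"
    "Abs_oper (Rep_oper S o\<^sub>L Rep_oper T) = S * T"
    "Abs_oper (scaleC_op c (Rep_oper S)) = sc c * S" for S T c
    by (simp_all add: Rep_oper_inverse flip: plus_oper.rep_eq times_oper.rep_eq Rep_sc_mult)
  ultimately show ?thesis
    using a unfolding isometric_automorphism_def A_p_eq
    by (simp add: Rep_oper_inverse norm_oper.rep_eq[symmetric] Rep_sc_mult[symmetric]
        plus_oper.rep_eq[symmetric] times_oper.rep_eq[symmetric])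
qed

section \<open>Kronecker approximation of discrete characters\<close>

definition int_independent :: "real set \<Rightarrow> bool" where
  "int_independent B \<longleftrightarrow> (\<forall>u :: real \<Rightarrow> int. (\<Sum>b\<in>B. of_int (u b) * b) = 0 \<longrightarrow> (\<forall>b\<in>B. u b = 0))"

text \<open>A finitely generated subgroup of the reals is free.  An element \<open>l\<close> that is dependent on the basis found so
  far, say \<open>N * l\<close> is an integer combination, is absorbed by dividing the whole basis by \<open>N\<close>.\<close>

lemma finite_int_independent_generators:
  assumes "finite (L :: real set)"
  obtains B where "finite B" "int_independent B"
    "\<And>l. l \<in> L \<Longrightarrow> \<exists>u :: real \<Rightarrow> int. l = (\<Sum>b\<in>B. of_int (u b) * b)"
proof -
  have "\<exists>B. finite B \<and> int_independent B \<and>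
      (\<forall>l\<in>L. \<exists>u :: real \<Rightarrow> int. l = (\<Sum>b\<in>B. of_int (u b) * b))"
    using assms
  proof (induction L)
    case empty
    then show ?case by (intro exI[of _ "{}"]) (simp add: int_independent_def)
  next
    case (insert l L)
    then obtain B where B: "finite B" "int_independent B"
      "\<And>l. l \<in> L \<Longrightarrow> \<exists>u :: real \<Rightarrow> int. l = (\<Sum>b\<in>B. of_int (u b) * b)" by blast
    have comb: "\<exists>u :: real \<Rightarrow> int. b' = (\<Sum>b\<in>C. of_int (u b) * b)" if "finite C" "b' \<in> C" for b' C
      using that by (intro exI[of _ "\<lambda>b. if b = b' then 1 else 0"])
        (simp add: if_distrib[of "\<lambda>x. x * _"] if_distrib[of of_int] cong: if_cong)
    show ?case
    proof (cases "l \<in> B")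
      case True
      then show ?thesis using B comb[OF B(1)] by (intro exI[of _ B]) auto
    next
      case lB: False
      show ?thesis
      proof (cases "int_independent (insert l B)")
        case True
        have "\<exists>u :: real \<Rightarrow> int. x = (\<Sum>b\<in>insert l B. of_int (u b) * b)" if x: "x \<in> L" for x
        proof -
          obtain u :: "real \<Rightarrow> int" where "x = (\<Sum>b\<in>B. of_int (u b) * b)" using B(3)[OF x] by blast
          moreover have "(\<Sum>b\<in>B. of_int (u b) * b) = (\<Sum>b\<in>B. of_int ((u(l := 0)) b) * b)"
            using lB by (intro sum.cong) auto
          ultimately show ?thesis using B(1) lB by (intro exI[of _ "u(l := 0)"]) simp
        qed
        then show ?thesis
          using B(1) True comb[of "insert l B" l] by (intro exI[of _ "insert l B"]) auto
      next
        case False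
        then obtain u :: "real \<Rightarrow> int" where u: "(\<Sum>b\<in>insert l B. of_int (u b) * b) = 0"
          "\<exists>b\<in>insert l B. u b \<noteq> 0" by (auto simp: int_independent_def)
        have u': "of_int (u l) * l + (\<Sum>b\<in>B. of_int (u b) * b) = 0" using u(1) B(1) lB by simp
        have ul: "u l \<noteq> 0"
        proof
          assume "u l = 0"
          then have "\<forall>b\<in>B. u b = 0" using u' B(2) by (auto simp: int_independent_def)
          then show False using u(2) \<open>u l = 0\<close> by auto
        qed
        define N where "N = real_of_int (u l)"
        have N: "N \<noteq> 0" using ul by (simp add: N_def)
        define B' where "B' = (\<lambda>b. b / N) ` B"
        have inj: "inj_on (\<lambda>b. b / N) B" using N by (auto simp: inj_on_def)
        have sumB': "(\<Sum>b\<in>B'. of_int (v b) * b) = (\<Sum>b\<in>B. of_int (v (b / N)) * b) / N"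
          for v :: "real \<Rightarrow> int"
          unfolding B'_def by (simp add: sum.reindex[OF inj] sum_divide_distrib)
        have "int_independent B'"
          unfolding int_independent_def
        proof (intro allI impI)
          fix v :: "real \<Rightarrow> int" assume "(\<Sum>b\<in>B'. of_int (v b) * b) = 0"
          then have "(\<Sum>b\<in>B. of_int (v (b / N)) * b) = 0" using N by (simp add: sumB')
          then have "\<forall>b\<in>B. v (b / N) = 0"
            using B(2)[unfolded int_independent_def, rule_format, of "\<lambda>b. v (b / N)"] by blast
          then show "\<forall>b\<in>B'. v b = 0" by (auto simp: B'_def)
        qed
        moreover have "\<exists>w :: real \<Rightarrow> int. x = (\<Sum>b\<in>B'. of_int (w b) * b)" if x: "x \<in> insert l L" for x
        proof -
          have "\<exists>w :: real \<Rightarrow> int. N * x = (\<Sum>b\<in>B. of_int (w b) * b)"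
          proof (cases "x = l")
            case True
            have "N * x = (\<Sum>b\<in>B. of_int (- u b) * b)"
              using u' by (simp add: N_def True sum_negf eq_neg_iff_add_eq_0)
            then show ?thesis by (rule exI[of _ "\<lambda>b. - u b"])
          next
            case False
            then obtain w :: "real \<Rightarrow> int" where "x = (\<Sum>b\<in>B. of_int (w b) * b)" using B(3) x by blast
            then have "N * x = (\<Sum>b\<in>B. of_int (u l * w b) * b)"
              by (simp add: N_def sum_distrib_left mult.assoc)
            then show ?thesis by (rule exI[of _ "\<lambda>b. u l * w b"])
          qed
          then obtain w :: "real \<Rightarrow> int" where w: "N * x = (\<Sum>b\<in>B. of_int (w b) * b)" by blast
          have "(\<Sum>b\<in>B'. of_int (w (b * N)) * b) = (\<Sum>b\<in>B. of_int (w (b / N * N)) * b) / N"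
            by (rule sumB')
          also have "\<dots> = x" using N w[symmetric] by simp
          finally show ?thesis by (intro exI[of _ "\<lambda>b. w (b * N)"]) simp
        qed
        moreover have "finite B'" using B(1) by (simp add: B'_def)
        ultimately show ?thesis by blast
      qed
    qed
  qed
  then show ?thesis using that by blast
qed

lemma real_character_0: "real_character d \<Longrightarrow> d 0 = 1"
  unfolding real_character_def by (metis add_0 mult_cancel_right1 norm_zero zero_neq_one)

lemma real_character_minus: "real_character d \<Longrightarrow> d (- x) = cnj (d x)"
proof -
  assume d: "real_character d"
  then have "d x * d (- x) = 1"
    using real_character_0[OF d] unfolding real_character_def by (metis add.right_inverse)
  moreover have "d x * cnj (d x) = 1"
    using d by (simp add: real_character_def flip: complex_norm_square)
  moreover have "d x \<noteq> 0" using d by (metis norm_zero real_character_def zero_neq_one)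
  ultimately show ?thesis by (metis mult_cancel_left)
qed

text \<open>Kronecker's theorem matches the values of \<open>d\<close> on an independent generating set; since both sides are characters,
  convergence on the generators implies convergence on the group that they generate.\<close>

lemma character_approximation:
  assumes d: "real_character d" and L: "finite L"
  shows "\<exists>r :: nat \<Rightarrow> real. \<forall>l\<in>L. (\<lambda>k. cis (l * r k)) \<longlonglongrightarrow> d l"
proof -
  obtain B where B: "finite B" "int_independent B"
    "\<And>l. l \<in> L \<Longrightarrow> \<exists>u :: real \<Rightarrow> int. l = (\<Sum>b\<in>B. of_int (u b) * b)"
    using finite_int_independent_generators[OF L] by blast
  define n where "n = card B"
  obtain \<theta> where \<theta>: "bij_betw \<theta> {..<n} B"
    using ex_bij_betw_nat_finite[OF B(1)] by (auto simp: n_def atLeast0LessThan)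
  interpret Z: module "\<lambda>(r::int) x::real. of_int r * x"
    by unfold_locales (simp_all add: algebra_simps)
  have "Z.independent (\<theta> ` {..<n})"
    using \<theta> B(1,2) unfolding bij_betw_def
    by (auto simp: Z.dependent_finite int_independent_def)
  moreover have "inj_on \<theta> {..<n}" using \<theta> by (simp add: bij_betw_def)
  ultimately have "\<exists>t. \<forall>i<n. \<exists>h::int. \<bar>t * \<theta> i - of_int h - Arg (d (\<theta> i)) / (2 * pi)\<bar> < 1 / real (Suc k)" for k
    by (rule Kronecker_thm_1[where \<epsilon> = "1 / real (Suc k)" and \<alpha> = "\<lambda>i. Arg (d (\<theta> i)) / (2 * pi)"])
      auto
  then obtain t h where t: "\<And>k i. i < n \<Longrightarrow>
      \<bar>t k * \<theta> i - of_int (h k i :: int) - Arg (d (\<theta> i)) / (2 * pi)\<bar> < 1 / real (Suc k)"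
    by metis
  define r where "r k = 2 * pi * t k" for k
  have gen: "(\<lambda>k. cis (b * r k)) \<longlonglongrightarrow> d b" if b: "b \<in> B" for b
  proof -
    obtain i where i: "i < n" "b = \<theta> i" using \<theta> b by (auto simp: bij_betw_def)
    define x where "x k = t k * \<theta> i - of_int (h k i) - Arg (d b) / (2 * pi)" for k
    have "x \<longlonglongrightarrow> 0"
      by (rule Lim_null_comparison[OF _ LIMSEQ_inverse_real_of_nat])
        (use t[OF i(1)] less_imp_le in \<open>auto simp: x_def i(2) inverse_eq_divide intro!: always_eventually\<close>)
    then have "(\<lambda>k. cis (2 * pi * x k + Arg (d b))) \<longlonglongrightarrow> cis (2 * pi * 0 + Arg (d b))"
      by (intro tendsto_intros)
    moreover have "cis (2 * pi * x k + Arg (d b)) = cis (b * r k)" for k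
    proof -
      have "2 * pi * x k + Arg (d b) = b * r k + 2 * pi * of_int (- h k i)"
        by (simp add: x_def r_def i(2) field_simps)
      then show ?thesis by (simp only: cis_mult[symmetric] cis_multiple_2pi[OF Ints_of_int] mult_1_right)
    qed
    moreover have "cis (Arg (d b)) = d b"
      using rcis_cmod_Arg[of "d b"] d by (simp add: rcis_def real_character_def)
    ultimately show ?thesis by simp
  qed
  define G where "G = {l. (\<lambda>k. cis (l * r k)) \<longlonglongrightarrow> d l}"
  have G_add: "x + y \<in> G" if "x \<in> G" "y \<in> G" for x y
    using tendsto_mult[of "\<lambda>k. cis (x * r k)" "d x" sequentially "\<lambda>k. cis (y * r k)" "d y"] that d
    by (simp add: G_def cis_mult distrib_right real_character_def)
  have G_minus: "- x \<in> G" if "x \<in> G" for x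
    using tendsto_cnj[of "\<lambda>k. cis (x * r k)" "d x" sequentially] that
    by (simp add: G_def cis_cnj real_character_minus[OF d])
  have G_0: "0 \<in> G" by (simp add: G_def real_character_0[OF d])
  have G_nat: "real n * x \<in> G" if "x \<in> G" for n x
    by (induction n) (auto simp: G_0 distrib_right intro: G_add that)
  have G_int: "of_int n * x \<in> G" if "x \<in> G" for n :: int and x
    using G_nat[OF that, of "nat n"] G_minus[OF G_nat[OF that, of "nat (- n)"]]
    by (cases "n \<ge> 0") auto
  have G_sum: "(\<Sum>b\<in>C. of_int (u b) * b) \<in> G" if "C \<subseteq> B" for C and u :: "real \<Rightarrow> int"
    using that by (induction C rule: infinite_finite_induct)
      (auto simp: G_0 intro!: G_add G_int, simp add: G_def gen)
  have "l \<in> G" if "l \<in> L" for l using B(3)[OF that] G_sum[of B] by auto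
  then show ?thesis by (intro exI[of _ r]) (auto simp: G_def)
qed

lemma character_filter:
  assumes d: "real_character d"
  obtains F :: "real filter" where "F \<noteq> bot" "\<And>l. ((\<lambda>r. cis (l * r)) \<longlongrightarrow> d l) F"
proof
  define F where "F = (INF l. filtercomap (\<lambda>r. cis (l * r)) (nhds (d l)))"
  show "F \<noteq> bot"
    unfolding F_def
  proof (rule INF_filter_not_bot)
    fix L :: "real set" assume "finite L"
    then obtain r :: "nat \<Rightarrow> real" where r: "\<forall>l\<in>L. (\<lambda>k. cis (l * r k)) \<longlonglongrightarrow> d l"
      using character_approximation[OF d] by blast
    have "filtermap r sequentially \<le> (INF l\<in>L. filtercomap (\<lambda>r. cis (l * r)) (nhds (d l)))"
    proof (rule INF_greatest)
      fix l assume "l \<in> L"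
      then show "filtermap r sequentially \<le> filtercomap (\<lambda>r. cis (l * r)) (nhds (d l))"
        using r unfolding filtermap_le_iff_le_filtercomap[symmetric] filtermap_filtermap
        by (simp add: filterlim_def)
    qed
    moreover have "filtermap r sequentially \<noteq> bot" by (simp add: filtermap_bot_iff)
    ultimately show "(INF l\<in>L. filtercomap (\<lambda>r. cis (l * r)) (nhds (d l))) \<noteq> bot"
      by (metis bot.extremum_unique)
  qed
  show "((\<lambda>r. cis (l * r)) \<longlongrightarrow> d l) F" for l
    unfolding filterlim_iff_le_filtercomap F_def by (rule INF_lower) simp
qed

section \<open>Gauge automorphisms composed with dilations\<close>

lemma Vo_monomial: "Vo t * (sc k * (Mo a * Do b)) = sc k * (Mo (exp t * a) * Do (exp (- t) * b)) * Vo t"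
  by (simp only: mult.assoc sc_left_commute[of "Vo t"] Vo_Do[symmetric])
    (simp only: mult.assoc[symmetric] Vo_Mo)

lemma norm_Vo_mult: "norm (Vo t * T) = norm T" "norm (T * Vo t) = norm T"
proof -
  have V: "norm (Vo t) \<le> 1" for t by (rule norm_oper_bound) auto
  have "Vo t * Vo (- t) = 1" "Vo (- t) * Vo t = 1" by (simp_all add: Vo_add)
  from norm_mult_invertible_contraction[OF V V this]
  show "norm (Vo t * T) = norm T" "norm (T * Vo t) = norm T" by auto
qed

text \<open>The automorphism is the limit of the conjugations by \<open>Vo t * Mo s * Do r\<close> along a filter of pairs \<open>(r, s)\<close> on which
  \<open>cis (- a r)\<close> tends to \<open>d a\<close> and \<open>cis (b s)\<close> to \<open>c b\<close>.  A limit of isometric homomorphisms is again one, and it is onto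
  because its range is closed and contains all monomials.\<close>

lemma gauge_dilation_aut:
  assumes c: "real_character c" and d: "real_character d"
  obtains \<Gamma> where "isometric_aut \<P> \<Gamma>"
    "\<And>k a b. 0 \<le> a \<Longrightarrow> 0 \<le> b \<Longrightarrow> \<Gamma> (sc k * (Mo a * Do b)) =
      sc (c b * d a) * (sc k * (Mo (exp t * a) * Do (exp (- t) * b)))"
proof -
  \<comment> \<open>Conjugation by \<open>Do r\<close> multiplies \<open>Mo a\<close> by \<open>cis (- a r)\<close>, whence the complex conjugate.\<close>
  have d': "real_character (\<lambda>x. cnj (d x))" using d by (simp add: real_character_def)
  obtain F1 where F1: "F1 \<noteq> bot" "\<And>l. ((\<lambda>r. cis (l * r)) \<longlongrightarrow> cnj (d l)) F1"
    using character_filter[OF d'] by blast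
  obtain F2 where F2: "F2 \<noteq> bot" "\<And>l. ((\<lambda>r. cis (l * r)) \<longlongrightarrow> c l) F2"
    using character_filter[OF c] by blast
  define F where "F = F1 \<times>\<^sub>F F2"
  have F: "F \<noteq> bot" using F1(1) F2(1) by (simp add: F_def prod_filter_eq_bot)
  have Fd: "((\<lambda>w. cis (- (a * fst w))) \<longlongrightarrow> d a) F" for a
  proof -
    have "((\<lambda>w. cis (a * fst w)) \<longlongrightarrow> cnj (d a)) F"
      unfolding F_def by (rule filterlim_compose[OF F1(2) filterlim_fst])
    from tendsto_cnj[OF this] show ?thesis by (simp add: cis_cnj)
  qed
  have Fc: "((\<lambda>w. cis (b * snd w)) \<longlongrightarrow> c b) F" for b
    unfolding F_def by (rule filterlim_compose[OF F2(2) filterlim_snd])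
  define \<phi> where "\<phi> w T = Vo t * (Mo (snd w) * (Do (fst w) * T * Do (- fst w)) * Mo (- snd w)) * Vo (- t)"
    for w T
  have norm_\<phi>: "norm (\<phi> w T) = norm T" for w T
    unfolding \<phi>_def norm_Vo_mult md.norm_P_mult dm.norm_P_mult ..
  have \<phi>_add: "\<phi> w (S + T) = \<phi> w S + \<phi> w T" for w S T
    by (simp add: \<phi>_def algebra_simps)
  have \<phi>_diff: "\<phi> w (S - T) = \<phi> w S - \<phi> w T" for w S T
    by (simp add: \<phi>_def algebra_simps)
  have V1: "Vo (- t) * (Vo t * X) = X" "Vo t * Vo (- t) = 1" for X
    by (simp_all add: Vo_add flip: mult.assoc)
  have \<phi>_mult: "\<phi> w (S * T) = \<phi> w S * \<phi> w T" for w S T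
    by (simp add: \<phi>_def mult.assoc V1)
  have \<phi>_monomial: "\<phi> w (sc k * (Mo a * Do b)) =
      sc (cis (b * snd w) * cis (- (a * fst w))) * (sc k * (Mo (exp t * a) * Do (exp (- t) * b)))" for w k a b
  proof -
    have 1: "Do r * (sc k * (Mo a * Do b)) * Do (- r) = sc (cis (- (a * r))) * (sc k * (Mo a * Do b))" for r
    proof -
      have eq: "sc k * (Mo a * Do b) = sc (k * cis (a * b)) * (Do b * Mo a)"
        using md.P_mult_Q[of a b] by (simp add: sc_sc)
      show ?thesis unfolding eq using dm.conj_monomial[of r "k * cis (a * b)" b a] by simp
    qed
    have 2: "Mo s * (sc z * (sc k * (Mo a * Do b))) * Mo (- s) = sc (cis (b * s) * z) * (sc k * (Mo a * Do b))" for s z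
      using md.conj_monomial[of s "z * k" a b] by (simp add: sc_sc mult.assoc mult.left_commute)
    show ?thesis
      unfolding \<phi>_def 1 2 sc_left_commute[of "Vo t"] Vo_monomial
      by (simp add: mult.assoc V1)
  qed
  have conv: "\<exists>L\<in>\<P>. ((\<lambda>w. \<phi> w T) \<longlongrightarrow> L) F" if "T \<in> \<P>" for T
    using that
  proof (induction rule: wspan_induct)
    case zero
    show ?case by (intro bexI[of _ 0] wspan_zero) (simp add: \<phi>_def)
  next
    case (monomial k a b)
    show ?case
    proof
      show "((\<lambda>w. \<phi> w (sc k * (Mo a * Do b))) \<longlongrightarrow>
        sc (c b * d a) * (sc k * (Mo (exp t * a) * Do (exp (- t) * b)))) F"
        unfolding \<phi>_monomial by (intro tendsto_intros tendsto_sc Fd Fc)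
      show "sc (c b * d a) * (sc k * (Mo (exp t * a) * Do (exp (- t) * b))) \<in> \<P>"
        using monomial by (intro wspan_sc wspan_monomial) auto
    qed
  next
    case (add S T)
    then obtain L L' where "L \<in> \<P>" "((\<lambda>w. \<phi> w S) \<longlongrightarrow> L) F" "L' \<in> \<P>" "((\<lambda>w. \<phi> w T) \<longlongrightarrow> L') F"
      by blast
    then show ?case unfolding \<phi>_add by (intro bexI[of _ "L + L'"] tendsto_add wspan_add)
  next
    case (limit Y T)
    then have "\<forall>n. \<exists>L. L \<in> \<P> \<and> ((\<lambda>w. \<phi> w (Y n)) \<longlongrightarrow> L) F" by blast
    from choice[OF this] obtain L where L: "\<And>n. L n \<in> \<P>" "\<And>n. ((\<lambda>w. \<phi> w (Y n)) \<longlongrightarrow> L n) F"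
      by blast
    have "dist (L m) (L n) \<le> dist (Y m) (Y n)" for m n
      unfolding dist_norm
    proof (rule tendsto_upperbound[OF tendsto_norm[OF tendsto_diff[OF L(2) L(2)]] _ F])
      show "\<forall>\<^sub>F w in F. norm (\<phi> w (Y m) - \<phi> w (Y n)) \<le> norm (Y m - Y n)"
        by (simp add: norm_\<phi> flip: \<phi>_diff)
    qed
    then obtain R where R: "L \<longlonglongrightarrow> R" using convergent_if_dist_le[OF limit.hyps(2)] by blast
    have "((\<lambda>w. \<phi> w T) \<longlongrightarrow> R) F"
    proof (rule tendstoI)
      fix e :: real assume "e > 0"
      then have e3: "e / 3 > 0" by simp
      have "\<forall>\<^sub>F n in sequentially. dist (Y n) T < e / 3 \<and> dist (L n) R < e / 3"
        by (intro eventually_conj tendstoD[OF limit.hyps(2) e3] tendstoD[OF R e3])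
      then obtain n where n: "dist (Y n) T < e / 3" "dist (L n) R < e / 3"
        by (auto dest: eventually_happens)
      show "\<forall>\<^sub>F w in F. dist (\<phi> w T) R < e"
        using tendstoD[OF L(2)[of n] e3]
      proof eventually_elim
        case (elim w)
        have "dist (\<phi> w T) (\<phi> w (Y n)) = dist (Y n) T"
          by (simp add: dist_norm norm_\<phi> norm_minus_commute flip: \<phi>_diff)
        then show ?case
          using n elim dist_triangle[of "\<phi> w T" R "\<phi> w (Y n)"] dist_triangle[of "\<phi> w (Y n)" R "L n"]
          by linarith
      qed
    qed
    moreover have "R \<in> \<P>" by (rule wspan_limit[OF L(1) R])
    ultimately show ?case by blast
  qed
  define \<Gamma> where "\<Gamma> T = Lim F (\<lambda>w. \<phi> w T)" for T
  have \<Gamma>: "\<Gamma> T \<in> \<P>" "((\<lambda>w. \<phi> w T) \<longlongrightarrow> \<Gamma> T) F" if T: "T \<in> \<P>" for T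
    using conv[OF T] tendsto_Lim[OF F, of "\<lambda>w. \<phi> w T"] unfolding \<Gamma>_def by auto
  have \<Gamma>I: "\<Gamma> T = L" if "T \<in> \<P>" "((\<lambda>w. \<phi> w T) \<longlongrightarrow> L) F" for T L
    using tendsto_unique[OF F \<Gamma>(2)[OF that(1)] that(2)] .
  have \<Gamma>_mono: "\<Gamma> (sc k * (Mo a * Do b)) =
      sc (c b * d a) * (sc k * (Mo (exp t * a) * Do (exp (- t) * b)))" if "0 \<le> a" "0 \<le> b" for k a b
  proof (rule \<Gamma>I)
    show "sc k * (Mo a * Do b) \<in> \<P>" using that by (intro wspan_monomial) auto
    show "((\<lambda>w. \<phi> w (sc k * (Mo a * Do b))) \<longlongrightarrow>
        sc (c b * d a) * (sc k * (Mo (exp t * a) * Do (exp (- t) * b)))) F"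
      unfolding \<phi>_monomial by (intro tendsto_intros tendsto_sc Fd Fc)
  qed
  have \<Gamma>_add: "\<Gamma> (S + T) = \<Gamma> S + \<Gamma> T" if "S \<in> \<P>" "T \<in> \<P>" for S T
    using that by (intro \<Gamma>I wspan_add) (auto simp: \<phi>_add intro: tendsto_add \<Gamma>)
  have \<Gamma>_diff: "\<Gamma> (S - T) = \<Gamma> S - \<Gamma> T" if "S \<in> \<P>" "T \<in> \<P>" for S T
    using that by (intro \<Gamma>I wspan_diff) (auto simp: \<phi>_diff intro: tendsto_diff \<Gamma>)
  have \<Gamma>_mult: "\<Gamma> (S * T) = \<Gamma> S * \<Gamma> T" if "S \<in> \<P>" "T \<in> \<P>" for S T
    using that by (intro \<Gamma>I md.A_mult) (auto simp: \<phi>_mult intro: tendsto_mult \<Gamma>)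
  have \<Gamma>_sc: "\<Gamma> (sc k * T) = sc k * \<Gamma> T" if "T \<in> \<P>" for k T
  proof (rule \<Gamma>I[OF wspan_sc[OF that]])
    have "\<phi> w (sc k * T) = sc k * \<phi> w T" for w
      by (simp add: \<phi>_def mult.assoc sc_left_commute[of "Vo t"] md.P_sc md.Q_sc)
    then show "((\<lambda>w. \<phi> w (sc k * T)) \<longlongrightarrow> sc k * \<Gamma> T) F"
      by (simp only:) (intro tendsto_intros \<Gamma>(2) that)
  qed
  have norm_\<Gamma>: "norm (\<Gamma> T) = norm T" if "T \<in> \<P>" for T
    using tendsto_unique[OF F tendsto_norm[OF \<Gamma>(2)[OF that]], of "norm T"] by (simp add: norm_\<phi>)
  have "\<P> \<subseteq> \<Gamma> ` \<P>"
  proof (rule wspan_least)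
    show "closed (\<Gamma> ` \<P>)"
    proof (rule closed_sequential_limits[THEN iffD2], intro allI impI, elim conjE)
      fix X R assume "\<forall>n. X n \<in> \<Gamma> ` \<P>" and X: "X \<longlonglongrightarrow> R"
      then have "\<forall>n. \<exists>y. y \<in> \<P> \<and> X n = \<Gamma> y" by blast
      from choice[OF this] obtain Y where Y: "\<And>n. Y n \<in> \<P>" "\<And>n. X n = \<Gamma> (Y n)" by blast
      have "dist (Y m) (Y n) \<le> dist (X m) (X n)" for m n
        using norm_\<Gamma>[OF wspan_diff[OF Y(1) Y(1)], of m n] by (simp add: dist_norm Y \<Gamma>_diff)
      then obtain T where T: "Y \<longlonglongrightarrow> T" using convergent_if_dist_le[OF X] by blast
      have TP: "T \<in> \<P>" by (rule wspan_limit[OF Y(1) T])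
      have "X \<longlonglongrightarrow> \<Gamma> T"
        by (rule tendsto_if_norm_le[OF T])
          (use norm_\<Gamma>[OF wspan_diff[OF Y(1) TP]] in \<open>simp add: Y \<Gamma>_diff TP\<close>)
      then have "R = \<Gamma> T" using X LIMSEQ_unique by blast
      then show "R \<in> \<Gamma> ` \<P>" using TP by blast
    qed
    show "0 \<in> \<Gamma> ` \<P>" using \<Gamma>_diff[of 0 0] wspan_zero[of Mo Do] by (intro image_eqI[of _ _ 0]) auto
    show "S + T \<in> \<Gamma> ` \<P>" if st: "S \<in> \<Gamma> ` \<P>" "T \<in> \<Gamma> ` \<P>" for S T
    proof -
      obtain S' T' where "S' \<in> \<P>" "S = \<Gamma> S'" "T' \<in> \<P>" "T = \<Gamma> T'" using st by blast
      then show ?thesis by (intro image_eqI[of _ _ "S' + T'"] wspan_add) (simp_all add: \<Gamma>_add)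
    qed
    show "sc k * (Mo a * Do b) \<in> \<Gamma> ` \<P>" if ab: "a \<in> {0..}" "b \<in> {0..}" for k a b
    proof -
      \<comment> \<open>The factor that \<open>\<Gamma>\<close> puts on the preimage of this monomial up to scalars.\<close>
      define z where "z = c (exp t * b) * d (exp (- t) * a)"
      have "cmod z = 1" using c d by (simp add: z_def norm_mult real_character_def)
      then have z: "z \<noteq> 0" by auto
      have "\<Gamma> (sc (k / z) * (Mo (exp (- t) * a) * Do (exp t * b))) =
          sc z * (sc (k / z) * (Mo (exp t * (exp (- t) * a)) * Do (exp (- t) * (exp t * b))))"
        unfolding z_def using ab by (intro \<Gamma>_mono) auto
      also have "\<dots> = sc z * (sc (k / z) * (Mo a * Do b))"
        using exp_mult_exp_minus_mult[of "- t" b] by (simp only: exp_mult_exp_minus_mult minus_minus)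
      also have "\<dots> = sc k * (Mo a * Do b)" using z by (simp add: sc_sc)
      finally have "\<Gamma> (sc (k / z) * (Mo (exp (- t) * a) * Do (exp t * b))) = sc k * (Mo a * Do b)" .
      moreover have "sc (k / z) * (Mo (exp (- t) * a) * Do (exp t * b)) \<in> \<P>"
        using ab by (intro wspan_monomial) auto
      ultimately show ?thesis by (metis imageI)
    qed
  qed
  then have "\<Gamma> ` \<P> = \<P>" using \<Gamma>(1) by blast
  moreover have "inj_on \<Gamma> \<P>"
  proof (rule inj_onI)
    fix S T assume ST: "S \<in> \<P>" "T \<in> \<P>" "\<Gamma> S = \<Gamma> T"
    then have "norm (S - T) = 0" using norm_\<Gamma>[OF wspan_diff[OF ST(1,2)]] by (simp add: \<Gamma>_diff)
    then show "S = T" by simp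
  qed
  ultimately have "isometric_aut \<P> \<Gamma>"
    by (auto simp: isometric_aut_def bij_betw_def \<Gamma>_add \<Gamma>_sc \<Gamma>_mult norm_\<Gamma>)
  then show ?thesis using that \<Gamma>_mono by blast
qed

lemma Ad_V_monomial:
  "Ad (V_op t) (M_op l o\<^sub>L D_op m) = Rep_oper (Mo (exp t * l) * Do (exp (- t) * m))"
proof -
  have "Ad (V_op t) (M_op l o\<^sub>L D_op m) = Rep_oper (Vo t * (Mo l * Do m) * Vo (- t))"
    by (simp add: Ad_def adj_V_op times_oper.rep_eq Mo.rep_eq Do.rep_eq Vo.rep_eq)
  also have "Vo t * (Mo l * Do m) * Vo (- t) = Mo (exp t * l) * Do (exp (- t) * m)"
    using Vo_monomial[of t 1 l m] by (simp add: mult.assoc Vo_add)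
  finally show ?thesis .
qed

lemma isometric_aut_inverse:
  assumes "isometric_aut \<P> \<Phi>"
  obtains \<Psi> where "isometric_aut \<P> \<Psi>" "\<And>T. T \<in> \<P> \<Longrightarrow> \<Psi> (\<Phi> T) = T" "\<And>T. T \<in> \<P> \<Longrightarrow> \<Phi> (\<Psi> T) = T"
proof -
  note a = assms[unfolded isometric_aut_def]
  have bij: "bij_betw \<Phi> \<P> \<P>" using a by blast
  define \<Psi> where "\<Psi> = inv_into \<P> \<Phi>"
  have inv: "\<Psi> (\<Phi> T) = T" "\<Phi> (\<Psi> T) = T" "\<Psi> T \<in> \<P>" if "T \<in> \<P>" for T
    using bij that by (auto simp: \<Psi>_def bij_betw_inv_into_left bij_betw_inv_into_right
        intro: bij_betwE[OF bij_betw_inv_into[OF bij], rule_format])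
  have eqI: "\<Psi> Y = X" if "X \<in> \<P>" "\<Phi> X = Y" for X Y using inv(1)[OF that(1)] that(2) by simp
  have "isometric_aut \<P> \<Psi>"
    unfolding isometric_aut_def
  proof (intro conjI ballI allI)
    show "bij_betw \<Psi> \<P> \<P>" unfolding \<Psi>_def by (rule bij_betw_inv_into[OF bij])
    fix S T assume ST: "S \<in> \<P>" "T \<in> \<P>"
    show "\<Psi> (S + T) = \<Psi> S + \<Psi> T"
      by (rule eqI) (use a ST inv in \<open>auto intro: wspan_add\<close>)
    show "\<Psi> (S * T) = \<Psi> S * \<Psi> T"
      by (rule eqI) (use a ST inv in \<open>auto intro: md.A_mult\<close>)
  next
    fix k T assume T: "T \<in> \<P>"
    show "\<Psi> (sc k * T) = sc k * \<Psi> T"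
      by (rule eqI) (use a T inv in \<open>auto intro: wspan_sc\<close>)
    show "norm (\<Psi> T) = norm T" using a inv(2,3)[OF T] by metis
  qed
  then show ?thesis using that inv by blast
qed

section \<open>Every isometric automorphism is of this form\<close>

text \<open>Every real is a difference of nonnegative reals, and \<open>d p * cnj (d q)\<close> depends only on \<open>p - q\<close> because the common part
  cancels.\<close>

lemma character_extension:
  assumes "\<And>a. 0 \<le> a \<Longrightarrow> cmod (d a) = 1" "\<And>a b. 0 \<le> a \<Longrightarrow> 0 \<le> b \<Longrightarrow> d (a + b) = d a * d b"
  obtains d' where "real_character d'" "\<And>a. 0 \<le> a \<Longrightarrow> d' a = d a"
proof -
  have inv: "d a * cnj (d a) = 1" if "0 \<le> a" for a
    using assms(1)[OF that] by (simp flip: complex_norm_square)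
  define d' where "d' x = d (max x 0) * cnj (d (max (- x) 0))" for x
  have d'_eq: "d' (p - q) = d p * cnj (d q)" if "0 \<le> p" "0 \<le> q" for p q
  proof -
    define m where "m = min p q"
    have m: "0 \<le> m" "max (p - q) 0 = p - m" "max (- (p - q)) 0 = q - m" "0 \<le> p - m" "0 \<le> q - m"
      using that by (auto simp: m_def)
    have "d p = d (p - m) * d m" "d q = d (q - m) * d m"
      using assms(2)[of "p - m" m] assms(2)[of "q - m" m] m by auto
    then have "d p * cnj (d q) = d (p - m) * cnj (d (q - m)) * (d m * cnj (d m))" by simp
    then show ?thesis unfolding d'_def m inv[OF m(1)] by simp
  qed
  have d0: "d 0 = 1"
    using assms(2)[of 0 0] assms(1)[of 0] by auto
  have "real_character d'"
    unfolding real_character_def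
  proof (intro conjI allI)
    show "cmod (d' x) = 1" for x by (simp add: d'_def norm_mult assms(1))
    fix x y
    have "d' (x + y) = d' ((max x 0 + max y 0) - (max (- x) 0 + max (- y) 0))"
      by (rule arg_cong[of _ _ d']) (simp add: max_def)
    also have "\<dots> = d' x * d' y"
      by (subst d'_eq) (simp_all add: assms(2) d'_def)
    finally show "d' (x + y) = d' x * d' y" .
  qed
  moreover have "d' a = d a" if "0 \<le> a" for a using d'_eq[OF that, of 0] d0 by simp
  ultimately show ?thesis using that by blast
qed

text \<open>Applied to \<open>\<Phi>\<close> and its inverse, the dichotomy shows that \<open>\<Phi>\<close> permutes the ideals \<open>K\<^sub>M\<close>, generated by the translations,
  and \<open>K\<^sub>D\<close>, generated by the modulations; neither contains the other.  In both cases rigidity applies twice and the Weyl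
  relation compares the two scaling constants \<open>\<kappa>, \<mu> \<ge> 0\<close>: it requires \<open>\<kappa> \<mu> = 1\<close> if the ideals are preserved and
  \<open>\<kappa> \<mu> = -1\<close> if they are interchanged.\<close>

lemma automorphism_form:
  assumes \<Phi>: "isometric_aut \<P> \<Phi>"
  shows "\<exists>t c d. real_character c \<and> real_character d \<and>
    (\<forall>l\<ge>0. \<forall>m\<ge>0. \<Phi> (Mo l * Do m) = sc (c m * d l) * (Mo (exp t * l) * Do (exp (- t) * m)))"
proof -
  obtain \<Psi> where \<Psi>: "isometric_aut \<P> \<Psi>" "\<And>T. T \<in> \<P> \<Longrightarrow> \<Psi> (\<Phi> T) = T" "\<And>T. T \<in> \<P> \<Longrightarrow> \<Phi> (\<Psi> T) = T"
    using isometric_aut_inverse[OF \<Phi>] by blast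
  have sw: "wspan Do Mo J I = wspan Mo Do I J" for I J by (rule md.wspan_swap)
  have aut: "weyl_aut Mo Do 1 Mo Do 1 X Y" "weyl_aut Do Mo (- 1) Mo Do 1 X Y" "weyl_aut Mo Do 1 Do Mo (- 1) X Y"
    "weyl_aut Do Mo (- 1) Do Mo (- 1) X Y"
    if "isometric_aut \<P> X" "isometric_aut \<P> Y" "\<And>T. T \<in> \<P> \<Longrightarrow> Y (X T) = T" "\<And>T. T \<in> \<P> \<Longrightarrow> X (Y T) = T" for X Y
    using that by (auto intro!: weyl_aut.intro weyl_aut_axioms.intro weyl_Mo_Do weyl_Do_Mo simp: sw)
  let ?KM = "wspan Mo Do {0..} {0<..}" and ?KD = "wspan Mo Do {0<..} {0..}"
  have KM: "T \<in> ?KM \<longleftrightarrow> T \<in> \<P> \<and> mode Mo 0 T = 0" for T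
    using md.pi_K[of T] md.K_sub_A[of T] md.pi_ker[of T] by force
  have KD: "T \<in> ?KD \<longleftrightarrow> T \<in> \<P> \<and> mode Do 0 T = 0" for T
    using dm.pi_K[of T] dm.K_sub_A[of T] dm.pi_ker[of T] unfolding sw by force
  define sub where "sub X k k' \<longleftrightarrow> X ` k \<subseteq> k'" for X :: "oper \<Rightarrow> oper" and k k' :: "oper set"
  have sub: "(sub X ?KM ?KM \<or> sub X ?KD ?KM) \<and> (sub X ?KM ?KD \<or> sub X ?KD ?KD)"
    if X: "isometric_aut \<P> X" "isometric_aut \<P> Y" "\<And>T. T \<in> \<P> \<Longrightarrow> Y (X T) = T" "\<And>T. T \<in> \<P> \<Longrightarrow> X (Y T) = T" for X Y
  proof -
    have in_P: "X T \<in> \<P>" if "T \<in> \<P>" for T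
      using X(1) that by (auto simp: isometric_aut_def bij_betw_def)
    have "T \<in> \<P>" if "T \<in> ?KM \<or> T \<in> ?KD" for T using that KM KD by blast
    then have "sub X k ?KM" if "\<forall>T\<in>k. mode Mo 0 (X T) = 0" "k = ?KM \<or> k = ?KD" for k
      using that in_P unfolding sub_def KM by (force simp: KM)
    moreover have "sub X k ?KD" if "\<forall>T\<in>k. mode Do 0 (X T) = 0" "k = ?KM \<or> k = ?KD" for k
      using that in_P KM KD unfolding sub_def by blast
    ultimately show ?thesis
      using weyl_aut.kills_dichotomy[OF aut(1)[OF X]] weyl_aut.kills_dichotomy[OF aut(2)[OF X]] by metis
  qed
  have nn: "\<not> ?KM \<subseteq> ?KD" "\<not> ?KD \<subseteq> ?KM"
  proof -
    have "Do 1 \<in> ?KM" "Mo 1 \<in> ?KD" by (auto intro: md.P_in_wspan md.Q_in_wspan)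
    moreover have "mode Do 0 (Do 1) = Do 1"
      by (rule dm.pi_id[of _ UNIV]) (rule dm.P_in_wspan, auto)
    moreover have "mode Mo 0 (Mo 1) = Mo 1"
      by (rule md.pi_id[of _ UNIV]) (rule md.P_in_wspan, auto)
    moreover have "Do 1 \<noteq> 0" "Mo 1 \<noteq> 0" using md.norm_P[of 1] dm.norm_P[of 1] by force+
    ultimately show "\<not> ?KM \<subseteq> ?KD" "\<not> ?KD \<subseteq> ?KM" using KM KD by auto
  qed
  have sub_trans: "k'' \<subseteq> k'"
    if "sub X k k'" "sub Y k'' k" "k'' \<subseteq> \<P>" "\<And>T. T \<in> \<P> \<Longrightarrow> X (Y T) = T" for X Y k k' k''
  proof
    fix T assume T: "T \<in> k''"
    then have "X (Y T) \<in> k'" using that(1,2) unfolding sub_def by blast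
    then show "T \<in> k'" using that(3,4) T by auto
  qed
  have comp: "\<not> (sub \<Phi> k k' \<and> sub \<Psi> k'' k)" "\<not> (sub \<Psi> k k' \<and> sub \<Phi> k'' k)"
    if "\<not> k'' \<subseteq> k'" "k'' \<subseteq> \<P>" for k k' k''
    using that sub_trans[of \<Phi> k k' \<Psi> k''] sub_trans[of \<Psi> k k' \<Phi> k''] \<Psi>(2,3) by blast+
  have KP: "?KM \<subseteq> \<P>" "?KD \<subseteq> \<P>" using KM KD by blast+
  have sub1: "(sub \<Phi> ?KM ?KM \<or> sub \<Phi> ?KD ?KM) \<and> (sub \<Phi> ?KM ?KD \<or> sub \<Phi> ?KD ?KD)"
    by (rule sub[of \<Phi> \<Psi>]) (use \<Phi> \<Psi> in auto)
  have sub2: "(sub \<Psi> ?KM ?KM \<or> sub \<Psi> ?KD ?KM) \<and> (sub \<Psi> ?KM ?KD \<or> sub \<Psi> ?KD ?KD)"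
    by (rule sub[of \<Psi> \<Phi>]) (use \<Phi> \<Psi> in auto)
  have cases: "(sub \<Phi> ?KM ?KM \<and> sub \<Psi> ?KM ?KM \<and> sub \<Phi> ?KD ?KD \<and> sub \<Psi> ?KD ?KD) \<or>
      (sub \<Phi> ?KD ?KM \<and> sub \<Psi> ?KM ?KD \<and> sub \<Phi> ?KM ?KD \<and> sub \<Psi> ?KD ?KM)"
    using sub1 sub2
      comp[OF nn(1) KP(1), of ?KM] comp[OF nn(1) KP(1), of ?KD]
      comp[OF nn(2) KP(2), of ?KM] comp[OF nn(2) KP(2), of ?KD] by argo
  have in_P: "Mo a \<in> \<P>" "Do a \<in> \<P>" if "0 \<le> a" for a
    using that by (auto intro: md.P_in_wspan md.Q_in_wspan)
  have \<Phi>_mult: "\<Phi> (S * T) = \<Phi> S * \<Phi> T" and \<Phi>_sc: "\<Phi> (sc k * T) = sc k * \<Phi> T" if "S \<in> \<P>" "T \<in> \<P>" for k S T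
    using \<Phi> that by (auto simp: isometric_aut_def)
  have weyl_\<Phi>: "\<Phi> (Do b) * \<Phi> (Mo a) = sc (cis (- (a * b))) * (\<Phi> (Mo a) * \<Phi> (Do b))"
    if ab: "0 \<le> a" "0 \<le> b" for a b
  proof -
    have "\<Phi> (Do b) * \<Phi> (Mo a) = \<Phi> (sc (cis (- (a * b))) * (Mo a * Do b))"
      using md.weyl[of b a] ab by (simp add: \<Phi>_mult[symmetric] in_P)
    also have "\<dots> = sc (cis (- (a * b))) * (\<Phi> (Mo a) * \<Phi> (Do b))"
      using ab by (simp add: \<Phi>_mult \<Phi>_sc[OF in_P(1)[of 0] md.A_mult] in_P)
    finally show ?thesis .
  qed
  have sc_eq: "z = z'" if "sc z * T = sc z' * T" "norm T = 1" for z z' T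
  proof -
    have "sc (z - z') * T = 0" using that(1) by (simp add: sc_diff left_diff_distrib)
    then have "cmod (z - z') * norm T = 0" unfolding norm_sc_mult[symmetric] by simp
    then show ?thesis using that(2) by simp
  qed
  have kM: "mode Mo 0 (X T) = 0" if "sub X k ?KM" "T \<in> k" for X T k
    using that KM unfolding sub_def by blast
  have kD: "mode Do 0 (X T) = 0" if "sub X k ?KD" "T \<in> k" for X T k
    using that KD unfolding sub_def by blast
  show ?thesis
    using cases
  proof
    assume s: "sub \<Phi> ?KM ?KM \<and> sub \<Psi> ?KM ?KM \<and> sub \<Phi> ?KD ?KD \<and> sub \<Psi> ?KD ?KD"
    have m1: "weyl_aut_matched Mo Do 1 Mo Do 1 \<Phi> \<Psi>"
      using s by (intro weyl_aut_matched.intro aut[OF \<Phi> \<Psi>] weyl_aut_matched_axioms.intro)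
        (auto simp: sw intro: kM kD)
    have m2: "weyl_aut_matched Do Mo (- 1) Do Mo (- 1) \<Phi> \<Psi>"
      using s by (intro weyl_aut_matched.intro aut[OF \<Phi> \<Psi>] weyl_aut_matched_axioms.intro)
        (auto simp: sw intro: kM kD)
    obtain \<kappa> d where \<kappa>: "0 \<le> \<kappa>" and d: "\<And>a. 0 \<le> a \<Longrightarrow> cmod (d a) = 1" "\<And>a. 0 \<le> a \<Longrightarrow> \<Phi> (Mo a) = sc (d a) * Mo (\<kappa> * a)"
      "\<And>a b. 0 \<le> a \<Longrightarrow> 0 \<le> b \<Longrightarrow> d (a + b) = d a * d b"
      using weyl_aut_matched.rigidity[OF m1] by blast
    obtain \<mu> c where \<mu>: "0 \<le> \<mu>" and c: "\<And>a. 0 \<le> a \<Longrightarrow> cmod (c a) = 1" "\<And>a. 0 \<le> a \<Longrightarrow> \<Phi> (Do a) = sc (c a) * Do (\<mu> * a)"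
      "\<And>a b. 0 \<le> a \<Longrightarrow> 0 \<le> b \<Longrightarrow> c (a + b) = c a * c b"
      using weyl_aut_matched.rigidity[OF m2] by blast
    have "cis ((1 - \<kappa> * \<mu>) * r) = 1" if "0 \<le> r" for r
    proof -
      have "sc (c 1 * d r * cis (- (\<kappa> * r * \<mu>))) * (Mo (\<kappa> * r) * Do \<mu>) =
          sc (cis (- r) * (d r * c 1)) * (Mo (\<kappa> * r) * Do \<mu>)"
        using weyl_\<Phi>[of r 1] that d(2)[of r] c(2)[of 1] md.weyl[of \<mu> "\<kappa> * r"]
        by (simp add: md.weyl_simps)
      then have eq: "c 1 * d r * cis (- (\<kappa> * r * \<mu>)) = cis (- r) * (d r * c 1)"
        by (rule sc_eq) simp
      have "c 1 * d r \<noteq> 0" using c(1)[of 1] d(1)[of r] that by auto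
      then have "cis (- (\<kappa> * r * \<mu>)) = cis (- r)" using eq by (simp add: mult_ac)
      then have "cis r * cis (- (\<kappa> * r * \<mu>)) = cis r * cis (- r)" by simp
      then show ?thesis by (simp add: cis_mult algebra_simps)
    qed
    then have \<kappa>\<mu>: "1 - \<kappa> * \<mu> = 0" by (rule frequency_zero_if_cis_1)
    then have "\<kappa> \<noteq> 0" by auto
    then have "\<kappa> > 0" using \<kappa> by simp
    define t where "t = ln \<kappa>"
    have t: "exp t = \<kappa>" "exp (- t) = \<mu>"
      using \<open>\<kappa> > 0\<close> \<kappa>\<mu> by (auto simp: t_def exp_minus field_simps)
    obtain d' where d': "real_character d'" "\<And>a. 0 \<le> a \<Longrightarrow> d' a = d a"
      using character_extension[OF d(1) d(3)] by blast
    obtain c' where c': "real_character c'" "\<And>a. 0 \<le> a \<Longrightarrow> c' a = c a"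
      using character_extension[OF c(1) c(3)] by blast
    have "\<Phi> (Mo l * Do m) = sc (c' m * d' l) * (Mo (exp t * l) * Do (exp (- t) * m))"
      if "0 \<le> l" "0 \<le> m" for l m
      using that unfolding t by (simp add: \<Phi>_mult in_P d(2) c(2) d'(2) c'(2) md.weyl_simps mult.commute[of "c m"])
    then show ?thesis using d'(1) c'(1) by blast
  next
    assume s: "sub \<Phi> ?KD ?KM \<and> sub \<Psi> ?KM ?KD \<and> sub \<Phi> ?KM ?KD \<and> sub \<Psi> ?KD ?KM"
    have m1: "weyl_aut_matched Mo Do 1 Do Mo (- 1) \<Phi> \<Psi>"
      using s by (intro weyl_aut_matched.intro aut[OF \<Phi> \<Psi>] weyl_aut_matched_axioms.intro)
        (auto simp: sw intro: kM kD)
    have m2: "weyl_aut_matched Do Mo (- 1) Mo Do 1 \<Phi> \<Psi>"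
      using s by (intro weyl_aut_matched.intro aut[OF \<Phi> \<Psi>] weyl_aut_matched_axioms.intro)
        (auto simp: sw intro: kM kD)
    obtain \<kappa> c where \<kappa>: "0 \<le> \<kappa>" and c: "\<And>a. 0 \<le> a \<Longrightarrow> cmod (c a) = 1" "\<And>a. 0 \<le> a \<Longrightarrow> \<Phi> (Do a) = sc (c a) * Mo (\<kappa> * a)"
      using weyl_aut_matched.rigidity[OF m1] by blast
    obtain \<mu> d where \<mu>: "0 \<le> \<mu>" and d: "\<And>a. 0 \<le> a \<Longrightarrow> cmod (d a) = 1" "\<And>a. 0 \<le> a \<Longrightarrow> \<Phi> (Mo a) = sc (d a) * Do (\<mu> * a)"
      using weyl_aut_matched.rigidity[OF m2] by blast
    have "cis ((1 + \<kappa> * \<mu>) * r) = 1" if "0 \<le> r" for r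
    proof -
      have "sc (c 1 * d r) * (Mo \<kappa> * Do (\<mu> * r)) =
          sc (cis (- r) * (d r * (c 1 * cis (- (\<kappa> * (\<mu> * r)))))) * (Mo \<kappa> * Do (\<mu> * r))"
        using weyl_\<Phi>[of r 1] that d(2)[of r] c(2)[of 1] md.weyl[of "\<mu> * r" \<kappa>]
        by (simp add: md.weyl_simps)
      then have eq: "c 1 * d r = cis (- r) * (d r * (c 1 * cis (- (\<kappa> * (\<mu> * r)))))"
        by (rule sc_eq) simp
      have "c 1 * d r \<noteq> 0" using c(1)[of 1] d(1)[of r] that by auto
      moreover have "c 1 * d r * 1 = c 1 * d r * (cis (- r) * cis (- (\<kappa> * (\<mu> * r))))"
        using eq by (simp add: mult_ac)
      ultimately have "cis (- r) * cis (- (\<kappa> * (\<mu> * r))) = 1"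
        by (metis mult_left_cancel)
      then have "cnj (cis (- r) * cis (- (\<kappa> * (\<mu> * r)))) = 1" by simp
      then show ?thesis by (simp add: cis_mult cis_cnj algebra_simps)
    qed
    then have "1 + \<kappa> * \<mu> = 0" by (rule frequency_zero_if_cis_1)
    moreover have "0 \<le> \<kappa> * \<mu>" using \<kappa> \<mu> by simp
    ultimately show ?thesis by simp
  qed
qed

theorem theorem3p8:
  shows "(\<forall>\<Phi>. isometric_automorphism A_p \<Phi> \<longrightarrow>
           (\<exists>t c d. real_character c \<and> real_character d \<and>
             (\<forall>l\<ge>0. \<forall>m\<ge>0. \<Phi> (M_op l o\<^sub>L D_op m) =
                scaleC_op (c m * d l) (Ad (V_op t) (M_op l o\<^sub>L D_op m)))))
       \<and> (\<forall>t c d. real_character c \<and> real_character d \<longrightarrow>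
           (\<exists>\<Phi>. isometric_automorphism A_p \<Phi> \<and>
             (\<forall>l\<ge>0. \<forall>m\<ge>0. \<Phi> (M_op l o\<^sub>L D_op m) =
                scaleC_op (c m * d l) (Ad (V_op t) (M_op l o\<^sub>L D_op m))) \<and>
             (\<forall>\<Psi>. isometric_automorphism A_p \<Psi> \<and>
               (\<forall>l\<ge>0. \<forall>m\<ge>0. \<Psi> (M_op l o\<^sub>L D_op m) =
                  scaleC_op (c m * d l) (Ad (V_op t) (M_op l o\<^sub>L D_op m))) \<longrightarrow>
               (\<forall>T\<in>A_p. \<Psi> T = \<Phi> T))))"
proof (intro conjI allI impI)
  have MD: "M_op l o\<^sub>L D_op m = Rep_oper (Mo l * Do m)" for l m
    by (simp add: times_oper.rep_eq Mo.rep_eq Do.rep_eq)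
  have MD_in: "Mo l * Do m \<in> \<P>" if "0 \<le> l" "0 \<le> m" for l m
    using that wspan_monomial[of l "{0..}" m "{0..}" 1 Mo Do] by simp
  have target: "scaleC_op z (Ad (V_op t) (M_op l o\<^sub>L D_op m)) =
      Rep_oper (sc z * (Mo (exp t * l) * Do (exp (- t) * m)))" for z t l m
    by (simp only: Rep_sc_mult Ad_V_monomial)
  {
    fix \<Phi> assume \<Phi>: "isometric_automorphism A_p \<Phi>"
    note aut = A_p_isometric_aut[OF \<Phi>]
    obtain t c d where cd: "real_character c" "real_character d"
      and form: "\<And>l m. 0 \<le> l \<Longrightarrow> 0 \<le> m \<Longrightarrow> Abs_oper (\<Phi> (Rep_oper (Mo l * Do m))) =
        sc (c m * d l) * (Mo (exp t * l) * Do (exp (- t) * m))"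
      using automorphism_form[OF aut(1)] by blast
    have "\<Phi> (M_op l o\<^sub>L D_op m) = scaleC_op (c m * d l) (Ad (V_op t) (M_op l o\<^sub>L D_op m))"
      if "0 \<le> l" "0 \<le> m" for l m
    proof -
      have "\<Phi> (M_op l o\<^sub>L D_op m) = Rep_oper (Abs_oper (\<Phi> (Rep_oper (Mo l * Do m))))"
        by (simp only: MD aut(2)[OF MD_in[OF that]])
      also have "\<dots> = scaleC_op (c m * d l) (Ad (V_op t) (M_op l o\<^sub>L D_op m))"
        by (simp only: form[OF that] target)
      finally show ?thesis .
    qed
    then show "\<exists>t c d. real_character c \<and> real_character d \<and>
      (\<forall>l\<ge>0. \<forall>m\<ge>0. \<Phi> (M_op l o\<^sub>L D_op m) = scaleC_op (c m * d l) (Ad (V_op t) (M_op l o\<^sub>L D_op m)))"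
      using cd by blast
  next
    fix t c d assume cd: "real_character c \<and> real_character d"
    obtain \<Gamma> where \<Gamma>: "isometric_aut \<P> \<Gamma>"
      "\<And>k a b. 0 \<le> a \<Longrightarrow> 0 \<le> b \<Longrightarrow> \<Gamma> (sc k * (Mo a * Do b)) =
        sc (c b * d a) * (sc k * (Mo (exp t * a) * Do (exp (- t) * b)))"
      using gauge_dilation_aut[of c d t] cd by blast
    define \<Phi> where "\<Phi> T = Rep_oper (\<Gamma> (Abs_oper T))" for T
    have "\<Phi> (M_op l o\<^sub>L D_op m) = scaleC_op (c m * d l) (Ad (V_op t) (M_op l o\<^sub>L D_op m))"
      if "0 \<le> l" "0 \<le> m" for l m
      unfolding target unfolding MD \<Phi>_def using \<Gamma>(2)[OF that, of 1] by (simp add: Rep_oper_inverse)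
    moreover have \<Phi>: "isometric_automorphism A_p \<Phi>"
      unfolding \<Phi>_def[abs_def] by (rule isometric_automorphism_A_p[OF \<Gamma>(1)])
    moreover have "\<Psi> T = \<Phi> T"
      if \<Psi>: "isometric_automorphism A_p \<Psi>"
        and form: "\<forall>l\<ge>0. \<forall>m\<ge>0. \<Psi> (M_op l o\<^sub>L D_op m) = scaleC_op (c m * d l) (Ad (V_op t) (M_op l o\<^sub>L D_op m))"
        and T: "T \<in> A_p" for \<Psi> T
    proof -
      note p = A_p_isometric_aut[OF \<Psi>]
      define \<Omega> where "\<Omega> T = Abs_oper (\<Psi> (Rep_oper T))" for T
      have \<Omega>: "isometric_aut \<P> \<Omega>" unfolding \<Omega>_def[abs_def] by (rule p(1))
      note o = \<Omega>[unfolded isometric_aut_def] and g = \<Gamma>(1)[unfolded isometric_aut_def]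
      obtain \<Omega>' where \<Omega>': "isometric_aut \<P> \<Omega>'" "\<And>T. T \<in> \<P> \<Longrightarrow> \<Omega>' (\<Omega> T) = T" "\<And>T. T \<in> \<P> \<Longrightarrow> \<Omega> (\<Omega>' T) = T"
        using isometric_aut_inverse[OF \<Omega>] by blast
      obtain \<Gamma>' where \<Gamma>': "isometric_aut \<P> \<Gamma>'" "\<And>T. T \<in> \<P> \<Longrightarrow> \<Gamma>' (\<Gamma> T) = T" "\<And>T. T \<in> \<P> \<Longrightarrow> \<Gamma> (\<Gamma>' T) = T"
        using isometric_aut_inverse[OF \<Gamma>(1)] by blast
      interpret o: weyl_aut Mo Do 1 Mo Do 1 \<Omega> \<Omega>'
        by (intro weyl_aut.intro weyl_aut_axioms.intro weyl_Mo_Do refl \<Omega> \<Omega>')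
      interpret g: weyl_aut Mo Do 1 Mo Do 1 \<Gamma> \<Gamma>'
        by (intro weyl_aut.intro weyl_aut_axioms.intro weyl_Mo_Do refl \<Gamma>(1) \<Gamma>')
      have "\<Omega> S = \<Gamma> S" if "S \<in> \<P>" for S
        using that
      proof (induction rule: wspan_induct)
        case zero
        then show ?case by (simp add: o.Phi_zero g.Phi_zero)
      next
        case (monomial k a b)
        then have ab: "0 \<le> a" "0 \<le> b" by auto
        have "Rep_oper (\<Omega> (Mo a * Do b)) = \<Psi> (M_op a o\<^sub>L D_op b)"
          unfolding \<Omega>_def MD using p(2)[OF MD_in[OF ab]] .
        also have "\<dots> = Rep_oper (\<Gamma> (Mo a * Do b))"
          using form ab \<Gamma>(2)[OF ab, of 1] by (simp add: target)
        finally have "\<Omega> (Mo a * Do b) = \<Gamma> (Mo a * Do b)" by (simp add: Rep_oper_inject)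
        then show ?case by (simp add: o.Phi_sc g.Phi_sc MD_in[OF ab])
      next
        case (add S S')
        then show ?case by (simp add: o.Phi_add g.Phi_add)
      next
        case (limit Y S)
        have "(\<lambda>n. \<Omega> (Y n)) \<longlonglongrightarrow> \<Omega> S" "(\<lambda>n. \<Gamma> (Y n)) \<longlonglongrightarrow> \<Gamma> S"
          using limit.hyps by (auto intro: o.Phi_limit g.Phi_limit)
        then show ?case using limit.IH LIMSEQ_unique by auto
      qed
      moreover obtain S where S: "S \<in> \<P>" "T = Rep_oper S" using T by (auto simp: A_p_eq)
      ultimately show ?thesis
        using p(2)[OF S(1)] by (simp add: \<Phi>_def Rep_oper_inverse S(2) \<Omega>_def)
    qed
    ultimately show "\<exists>\<Phi>. isometric_automorphism A_p \<Phi> \<and>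
      (\<forall>l\<ge>0. \<forall>m\<ge>0. \<Phi> (M_op l o\<^sub>L D_op m) = scaleC_op (c m * d l) (Ad (V_op t) (M_op l o\<^sub>L D_op m))) \<and>
      (\<forall>\<Psi>. isometric_automorphism A_p \<Psi> \<and>
        (\<forall>l\<ge>0. \<forall>m\<ge>0. \<Psi> (M_op l o\<^sub>L D_op m) = scaleC_op (c m * d l) (Ad (V_op t) (M_op l o\<^sub>L D_op m))) \<longrightarrow>
        (\<forall>T\<in>A_p. \<Psi> T = \<Phi> T))"
      by blast
  }
qed

end
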